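(* Let $1\le m<n$, let $J\subset S$ be the generic link of the ideal $I=I_m(X)$ of maximal minors of a generic $m\times n$ matrix $X$ over a field $K$, and let $\operatorname{in}(J)$ be its initial ideal with respect to the term order $<_1$ on $S$ (all as defined in the context). Then the minimal generators of the monomial ideal $\operatorname{in}(J)$, equivalently the lead terms of the reduced Gröbner basis of $J$ with respect to $<_1$, are the following: (1) the $n-m+1$ squarefree monomials of $S$, each of degree $m+1$, given by $Y_{j,j}\cdot\alpha_j$ for $j=1,\ldots,n-m+1$; (2) the $\binom{n-1}{m-1}$ squarefree monomials of $S$, each of degree $m(n-m)+1$, given by $\left(\prod_{j=1}^{n-m+1}Y_{j,j}\right)\cdot\beta_A$, for every subset $A\subset\{2,\ldots,n\}$ of cardinality $m-1$.
   Context: Let $K$ be a field, $1\le m<n$ integers, $X=(x_{i,j})$ an $m\times n$ matrix of indeterminates, $R=K[X]$, and $I=I_m(X)$ the ideal generated by the $m$-minors $\Delta_1,\ldots,\Delta_\eta$ of $X$, $\eta=\binom nm$, enumerated so that for $j=1,\ldots,n-m+1$ the minor $\Delta_j$ is the one on columns $j,j+1,\ldots,j+m-1$. Let $Y=(Y_{i,j})$ be an $(n-m+1)\times\eta$ matrix of indeterminates, $S=R[Y]$ (standard graded), $\mathfrak a\subset S$ the ideal generated by the entries of $Y[\Delta_1,\ldots,\Delta_\eta]^T$. The generic link of $I$ is $J=\mathfrak a:IS$. Term order. Fix an antidiagonal term order $<$ on $R$ (one for which the initial term of every minor of $X$ is, up to sign, the product of the variables on its main antidiagonal), e.g. the reverse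 lexicographic order extending $x_{m,n}>x_{m,n-1}>\cdots>x_{m,1}>x_{m-1,n}>\cdots>x_{1,1}$. With $g=n-m+1$, order the $Y$-variables by $Y_{1,1}>Y_{2,2}>\cdots>Y_{g,g}>$ the remaining $Y_{i,j}$ (in any fixed order). For a monomial $u\in S$ let $u_x\in R$ be its image under the $R$-algebra map $S\to R$ sending every $Y_{i,j}$ to $1$. Define $u<_1 v$ iff $u/u_x$ is lexicographically smaller than $v/v_x$, or $u/u_x=v/v_x$ and $u_x<v_x$. Put $\operatorname{in}(J)=\operatorname{in}_{<_1}(J)$. Monomials. For $j=1,\ldots,n-m+1$ put $\alpha_j=\prod_{i=1}^m x_{m-i+1,\,j+i-1}$. Let $V=\{(i,j)\in\{1,\ldots,m\}\times\{1,\ldots,n\}: m-i<j\le n-i+1\}$. For $A=\{a_1<\cdots<a_{m-1}\}\subset\{2,\ldots,n\}$ put $a_0=1$, $a_m=n+1$, $D_A=\{(i,j)\in V: a_{m-i}\le j<a_{m-i+1}\}$, and $\beta_A=\prod_{(i,j)\in V\setminus D_A}x_{i,j}$. *)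

theory Defs
  imports
    "HOL-Library.Poly_Mapping"
    "HOL-Algebra.Ideal"
    "Jordan_Normal_Form.Determinant"
begin

section \<open>Polynomials in the matrix entries\<close>

text \<open>
  Matrix indices start at 1 throughout. A monomial is its exponent vector, so the product of two
  monomials is their sum \<open>u + v\<close>, the monomial \<open>1\<close> is \<open>0\<close>, and division is
  subtraction. As the set of indeterminates depends on \<open>m\<close> and \<open>n\<close>, the
  polynomial ring over a finite set of indeterminates is a subring of the ring of polynomials in
  all indeterminates.
\<close>

datatype indet = X nat nat | Y nat nat

type_synonym mon = "indet \<Rightarrow>\<^sub>0 nat"

type_synonym 'k mpoly = "mon \<Rightarrow>\<^sub>0 'k"

abbreviation var :: "indet \<Rightarrow> mon" where
  "var v \<equiv> Poly_Mapping.single v 1"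

abbreviation mono_poly :: "mon \<Rightarrow> 'k::field mpoly" where
  "mono_poly u \<equiv> Poly_Mapping.single u 1"

abbreviation var_poly :: "indet \<Rightarrow> 'k::field mpoly" where
  "var_poly v \<equiv> mono_poly (var v)"

definition monomials :: "indet set \<Rightarrow> mon set" where
  "monomials V = {u. Poly_Mapping.keys u \<subseteq> V}"

definition poly_ring :: "indet set \<Rightarrow> 'k::field mpoly ring" where
  "poly_ring V =
     \<lparr>carrier = {p. Poly_Mapping.keys p \<subseteq> monomials V},
      monoid.mult = (*), one = 1, ring.zero = 0, add = (+)\<rparr>"

lemma zero_in_monomials: "0 \<in> monomials V"
  by (simp add: monomials_def)

lemma add_in_monomials: "u \<in> monomials V \<Longrightarrow> v \<in> monomials V \<Longrightarrow> u + v \<in> monomials V"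
  using keys_add[of u v] by (auto simp: monomials_def)

lemma cring_poly_ring: "cring (poly_ring V :: 'k::field mpoly ring)"
proof (rule cringI)
  show "abelian_group (poly_ring V :: 'k mpoly ring)"
  proof (rule abelian_groupI)
    fix x :: "'k mpoly" assume "x \<in> carrier (poly_ring V)"
    then show "\<exists>y\<in>carrier (poly_ring V). y \<oplus>\<^bsub>poly_ring V\<^esub> x = \<zero>\<^bsub>poly_ring V\<^esub>"
      by (intro bexI[of _ "- x"]) (auto simp: poly_ring_def)
  qed (use keys_add in \<open>fastforce simp: poly_ring_def algebra_simps\<close>)+
  show "Group.comm_monoid (poly_ring V :: 'k mpoly ring)"
  proof (rule comm_monoidI)
    fix x y :: "'k mpoly"
    assume "x \<in> carrier (poly_ring V)" "y \<in> carrier (poly_ring V)"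
    then show "x \<otimes>\<^bsub>poly_ring V\<^esub> y \<in> carrier (poly_ring V)"
      using keys_mult[of x y] add_in_monomials[of _ V] by (fastforce simp: poly_ring_def)
  qed (auto simp: poly_ring_def zero_in_monomials algebra_simps)
qed (simp add: poly_ring_def algebra_simps)

definition squarefree_mon :: "mon \<Rightarrow> bool" where
  "squarefree_mon u \<longleftrightarrow> (\<forall>v. Poly_Mapping.lookup u v \<le> 1)"

definition mdegree :: "mon \<Rightarrow> nat" where
  "mdegree u = (\<Sum>v\<in>Poly_Mapping.keys u. Poly_Mapping.lookup u v)"


section \<open>Term orders, initial ideals and Groebner bases\<close>

text \<open>Orders are strict: \<open>lt u v\<close> means that \<open>u\<close> is smaller than \<open>v\<close>.\<close>

definition term_order_on :: "indet set \<Rightarrow> (mon \<Rightarrow> mon \<Rightarrow> bool) \<Rightarrow> bool" where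
  "term_order_on V lt \<longleftrightarrow>
     irreflp_on (monomials V) lt \<and> transp_on (monomials V) lt \<and>
     totalp_on (monomials V) lt \<and>
     (\<forall>u\<in>monomials V. u \<noteq> 0 \<longrightarrow> lt 0 u) \<and>
     (\<forall>u\<in>monomials V. \<forall>v\<in>monomials V. \<forall>w\<in>monomials V. lt u v \<longrightarrow> lt (u + w) (v + w))"

definition lead_mon :: "(mon \<Rightarrow> mon \<Rightarrow> bool) \<Rightarrow> 'k::field mpoly \<Rightarrow> mon" where
  "lead_mon lt p =
     (THE u. u \<in> Poly_Mapping.keys p \<and> (\<forall>v\<in>Poly_Mapping.keys p. v \<noteq> u \<longrightarrow> lt v u))"

definition lead_coeff_of :: "(mon \<Rightarrow> mon \<Rightarrow> bool) \<Rightarrow> 'k::field mpoly \<Rightarrow> 'k" where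
  "lead_coeff_of lt p = Poly_Mapping.lookup p (lead_mon lt p)"

definition initial_term :: "(mon \<Rightarrow> mon \<Rightarrow> bool) \<Rightarrow> 'k::field mpoly \<Rightarrow> 'k mpoly" where
  "initial_term lt p = Poly_Mapping.single (lead_mon lt p) (lead_coeff_of lt p)"

definition initial_ideal ::
  "indet set \<Rightarrow> (mon \<Rightarrow> mon \<Rightarrow> bool) \<Rightarrow> 'k::field mpoly set \<Rightarrow> 'k mpoly set" where
  "initial_ideal V lt J = Idl\<^bsub>poly_ring V\<^esub> {initial_term lt f | f. f \<in> J \<and> f \<noteq> 0}"

definition minimal_monomial_generators ::
  "indet set \<Rightarrow> 'k::field mpoly set \<Rightarrow> mon set \<Rightarrow> bool" where
  "minimal_monomial_generators V L M \<longleftrightarrow>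
     M \<subseteq> monomials V \<and> Idl\<^bsub>poly_ring V\<^esub> (mono_poly ` M) = L \<and>
     (\<forall>N. N \<subset> M \<longrightarrow> Idl\<^bsub>poly_ring V\<^esub> (mono_poly ` N) \<noteq> L)"

definition groebner_basis ::
  "indet set \<Rightarrow> (mon \<Rightarrow> mon \<Rightarrow> bool) \<Rightarrow> 'k::field mpoly set \<Rightarrow> 'k mpoly set \<Rightarrow> bool" where
  "groebner_basis V lt J G \<longleftrightarrow>
     finite G \<and> G \<subseteq> J \<and> 0 \<notin> G \<and>
     Idl\<^bsub>poly_ring V\<^esub> (initial_term lt ` G) = initial_ideal V lt J"

definition mon_dvd :: "mon \<Rightarrow> mon \<Rightarrow> bool" where
  "mon_dvd u v \<longleftrightarrow> (\<exists>w. v = u + w)"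

definition reduced_groebner_basis ::
  "indet set \<Rightarrow> (mon \<Rightarrow> mon \<Rightarrow> bool) \<Rightarrow> 'k::field mpoly set \<Rightarrow> 'k mpoly set \<Rightarrow> bool" where
  "reduced_groebner_basis V lt J G \<longleftrightarrow>
     groebner_basis V lt J G \<and>
     (\<forall>g\<in>G. lead_coeff_of lt g = 1) \<and>
     (\<forall>g\<in>G. \<forall>h\<in>G. g \<noteq> h \<longrightarrow> (\<forall>u\<in>Poly_Mapping.keys g. \<not> mon_dvd (lead_mon lt h) u))"


section \<open>Minors and the generic link\<close>

definition x_indets :: "nat \<Rightarrow> nat \<Rightarrow> indet set" where
  "x_indets m n = {X i j | i j. i \<in> {1..m} \<and> j \<in> {1..n}}"

definition y_indets :: "nat \<Rightarrow> nat \<Rightarrow> indet set" where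
  "y_indets m n = {Y i k | i k. i \<in> {1..n - m + 1} \<and> k \<in> {1..n choose m}}"

definition s_indets :: "nat \<Rightarrow> nat \<Rightarrow> indet set" where
  "s_indets m n = x_indets m n \<union> y_indets m n"

text \<open>The minor of the generic matrix on the rows in \<open>A\<close> and the columns in \<open>B\<close>.\<close>

definition minor :: "nat set \<Rightarrow> nat set \<Rightarrow> 'k::field mpoly" where
  "minor A B = det (mat (card A) (card B)
     (\<lambda>(r, s). var_poly (X (sorted_list_of_set A ! r) (sorted_list_of_set B ! s))))"

definition antidiagonal :: "nat set \<Rightarrow> nat set \<Rightarrow> mon" where
  "antidiagonal A B = (\<Sum>r<card A.
     var (X (sorted_list_of_set A ! r) (sorted_list_of_set B ! (card A - 1 - r))))"

text \<open>The type argument is the coefficient field of the minors.\<close>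

definition antidiagonal_term_order ::
  "'k::field itself \<Rightarrow> nat \<Rightarrow> nat \<Rightarrow> (mon \<Rightarrow> mon \<Rightarrow> bool) \<Rightarrow> bool" where
  "antidiagonal_term_order K m n lt \<longleftrightarrow>
     term_order_on (x_indets m n) lt \<and>
     (\<forall>A B. A \<subseteq> {1..m} \<and> B \<subseteq> {1..n} \<and> A \<noteq> {} \<and> card A = card B \<longrightarrow>
        initial_term lt (minor A B :: 'k mpoly)
          \<in> {mono_poly (antidiagonal A B), - mono_poly (antidiagonal A B)})"

text \<open>An enumeration \<open>C\<close> of the column sets of the maximal minors; \<open>\<Delta>\<^sub>k\<close> is the
  minor on the columns in \<open>C k\<close>.\<close>

definition minor_enumeration :: "nat \<Rightarrow> nat \<Rightarrow> (nat \<Rightarrow> nat set) \<Rightarrow> bool" where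
  "minor_enumeration m n C \<longleftrightarrow>
     bij_betw C {1..n choose m} {B. B \<subseteq> {1..n} \<and> card B = m} \<and>
     (\<forall>j\<in>{1..n - m + 1}. C j = {j..j + m - 1})"

definition determinantal_ideal :: "nat \<Rightarrow> nat \<Rightarrow> 'k::field mpoly set" where
  "determinantal_ideal m n =
     Idl\<^bsub>poly_ring (x_indets m n)\<^esub> {minor {1..m} B | B. B \<subseteq> {1..n} \<and> card B = m}"

definition link_relations :: "nat \<Rightarrow> nat \<Rightarrow> (nat \<Rightarrow> nat set) \<Rightarrow> 'k::field mpoly set" where
  "link_relations m n C = Idl\<^bsub>poly_ring (s_indets m n)\<^esub>
     {\<Sum>k = 1..n choose m. var_poly (Y i k) * minor {1..m} (C k) | i. i \<in> {1..n - m + 1}}"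

definition colon_ideal :: "('a, 'b) ring_scheme \<Rightarrow> 'a set \<Rightarrow> 'a set \<Rightarrow> 'a set" where
  "colon_ideal R L I = {f \<in> carrier R. \<forall>h\<in>I. f \<otimes>\<^bsub>R\<^esub> h \<in> L}"

definition generic_link :: "nat \<Rightarrow> nat \<Rightarrow> (nat \<Rightarrow> nat set) \<Rightarrow> 'k::field mpoly set" where
  "generic_link m n C = colon_ideal (poly_ring (s_indets m n)) (link_relations m n C)
     (Idl\<^bsub>poly_ring (s_indets m n)\<^esub> (determinantal_ideal m n))"


section \<open>The term order on the larger ring\<close>

definition x_part :: "mon \<Rightarrow> mon" where
  "x_part u = Poly_Mapping.mapp (\<lambda>v e. case v of X i j \<Rightarrow> e | Y i k \<Rightarrow> 0) u"

text \<open>\<open>ys\<close> lists the positions of the \<open>Y\<close>-indeterminates from the largest to the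
  smallest indeterminate.\<close>

definition y_ordering :: "nat \<Rightarrow> nat \<Rightarrow> (nat \<times> nat) list \<Rightarrow> bool" where
  "y_ordering m n ys \<longleftrightarrow>
     distinct ys \<and> set ys = {1..n - m + 1} \<times> {1..n choose m} \<and>
     take (n - m + 1) ys = map (\<lambda>j. (j, j)) [1..<n - m + 2]"

definition y_exponents :: "(nat \<times> nat) list \<Rightarrow> mon \<Rightarrow> nat list" where
  "y_exponents ys u = map (\<lambda>(i, k). Poly_Mapping.lookup u (Y i k)) ys"

definition link_order ::
  "(nat \<times> nat) list \<Rightarrow> (mon \<Rightarrow> mon \<Rightarrow> bool) \<Rightarrow> mon \<Rightarrow> mon \<Rightarrow> bool" where
  "link_order ys lt u v \<longleftrightarrow>
     (y_exponents ys (u - x_part u), y_exponents ys (v - x_part v)) \<in> lex less_than \<or>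
     u - x_part u = v - x_part v \<and> lt (x_part u) (x_part v)"


section \<open>The generators\<close>

definition alpha :: "nat \<Rightarrow> nat \<Rightarrow> mon" where
  "alpha m j = (\<Sum>i = 1..m. var (X (m - i + 1) (j + i - 1)))"

definition strip :: "nat \<Rightarrow> nat \<Rightarrow> (nat \<times> nat) set" where
  "strip m n = {(i, j). i \<in> {1..m} \<and> j \<in> {1..n} \<and> m - i < j \<and> j \<le> n - i + 1}"

text \<open>\<open>bound n A k\<close> is \<open>a\<^sub>k\<close>, including \<open>a\<^sub>0 = 1\<close> and \<open>a\<^sub>m = n + 1\<close>.\<close>

definition bound :: "nat \<Rightarrow> nat set \<Rightarrow> nat \<Rightarrow> nat" where
  "bound n A k = (1 # sorted_list_of_set A @ [n + 1]) ! k"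

definition staircase :: "nat \<Rightarrow> nat \<Rightarrow> nat set \<Rightarrow> (nat \<times> nat) set" where
  "staircase m n A =
     {(i, j) \<in> strip m n. bound n A (m - i) \<le> j \<and> j < bound n A (m - i + 1)}"

definition beta :: "nat \<Rightarrow> nat \<Rightarrow> nat set \<Rightarrow> mon" where
  "beta m n A = (\<Sum>(i, j)\<in>strip m n - staircase m n A. var (X i j))"

definition gens1 :: "nat \<Rightarrow> nat \<Rightarrow> mon set" where
  "gens1 m n = {var (Y j j) + alpha m j | j. j \<in> {1..n - m + 1}}"

definition gens2 :: "nat \<Rightarrow> nat \<Rightarrow> mon set" where
  "gens2 m n = {(\<Sum>j = 1..n - m + 1. var (Y j j)) + beta m n A | A.
     A \<subseteq> {2..n} \<and> card A = m - 1}"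

end

theory Submission
  imports Defs
begin

text \<open>
  Put \<open>g = n - m + 1\<close>, let \<open>f\<^sub>i = \<Sum>\<^sub>k Y\<^sub>i\<^sub>k \<Delta>\<^sub>k\<close> be the generators of \<open>\<aa>\<close>, and let \<open>L\<close> be
  the list of monomials in the theorem. The proof shows that the lead monomial of every nonzero
  element of \<open>J\<close> is divisible by a member of \<open>L\<close> and that every member of \<open>L\<close> is the lead monomial
  of an element of \<open>J\<close>. As no member of \<open>L\<close> divides another one, \<open>L\<close> is then the set of minimal
  generators of the initial ideal, and the reduced Groebner basis exists, is unique and has lead
  monomials \<open>L\<close> (\<open>lead_monomials_determine\<close>).

  Divisibility. The lead monomials \<open>Y\<^sub>i\<^sub>i \<alpha>\<^sub>i\<close> of the \<open>f\<^sub>i\<close> are pairwise coprime, so the \<open>f\<^sub>i\<close> form a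
  Groebner basis of \<open>\<aa>\<close> (\<open>lead_in_coprime_ideal\<close>). If \<open>f \<in> J\<close> then \<open>f \<Delta> \<in> \<aa>\<close> for every maximal minor
  \<open>\<Delta>\<close>; hence the lead monomial of \<open>f\<close> times any maximal antidiagonal is divisible by some
  \<open>Y\<^sub>j\<^sub>j \<alpha>\<^sub>j\<close>. A monomial with this property is divisible by a member of \<open>L\<close>, which is pure
  combinatorics (\<open>dvd_gens\<close>): arrange the variables of the \<open>\<alpha>\<^sub>j\<close> as the columns of an \<open>m \<times> g\<close> grid.
  If no \<open>Y\<^sub>j\<^sub>j \<alpha>\<^sub>j\<close> divides the monomial, the variables that it misses form a chain in the grid, for
  otherwise a two-step antidiagonal would violate the hypothesis; a chain lies on a lattice path,
  and the lattice paths are the sets \<open>D\<^sub>A\<close>.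

  Existence. The monomial \<open>Y\<^sub>j\<^sub>j \<alpha>\<^sub>j\<close> is the lead monomial of \<open>f\<^sub>j\<close>. The other members of \<open>L\<close> come from
  explicit elements of \<open>J\<close>, modelled on a multiplication of the Eagon-Northcott complex. View
  \<open>\<phi>\<^sub>i = (Y\<^sub>i\<^sub>k)\<^sub>k\<close> as an element of degree \<open>m\<close> of the exterior algebra on \<open>n\<close> generators, so that
  \<open>f\<^sub>i\<close> is, up to sign, the contraction of \<open>\<phi>\<^sub>i\<close> by all rows of \<open>X\<close>. For a row index \<open>k\<close> let
  \<open>T\<^sub>k(\<phi>, u)\<close> be the wedge product of the contraction of \<open>\<phi>\<close> by the rows \<open>> k\<close> with the contraction of
  \<open>u\<close> by the rows \<open>< k\<close>. For row indices \<open>k\<^sub>2 \<ge> \<dots> \<ge> k\<^sub>g\<close> the form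
  \<open>T\<^sub>k\<^sub>g(\<phi>\<^sub>g, \<dots>, T\<^sub>k\<^sub>2(\<phi>\<^sub>2, \<phi>\<^sub>1))\<close> has degree \<open>n\<close>, so it is a single polynomial. Multiplication by one
  more form \<open>\<psi>\<close> acts as a contracting homotopy for multiplication by the contraction of \<open>\<psi>\<close>
  (\<open>boundary_link_elem\<close>); as forms of degree \<open>n + 1\<close> vanish, the polynomial multiplies every maximal
  minor into \<open>\<aa>\<close> (\<open>minor_form_mult_link_elem\<close>). It is linear in each row of \<open>Y\<close>, and the coefficient
  of \<open>Y\<^sub>1\<^sub>1 \<dots> Y\<^sub>g\<^sub>g\<close> is up to sign the product over \<open>s = 2, \<dots>, g\<close> of the minors without row \<open>k\<^sub>s\<close> on the
  columns \<open>s, \<dots>, s + m - 2\<close> (\<open>link_product_basis\<close>, \<open>link_elem_expansion\<close>). The lead monomial of this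
  coefficient is a product of antidiagonals, and it is \<open>\<beta>\<^sub>A\<close> if \<open>k\<^sub>s\<close> is the row in which the path
  \<open>D\<^sub>A\<close> enters column \<open>s\<close> of the grid (\<open>beta_eq_antidiagonals\<close>).
\<close>

section \<open>Exterior algebra on sets of column indices\<close>

text \<open>An element of the exterior algebra is encoded by its coefficients: \<open>u Z\<close> is the coefficient of the
  product of the basis vectors indexed by \<open>Z\<close> in increasing order. The sign that sorts such a product
  for \<open>A\<close> followed by one for \<open>B\<close> is written as a product of signs, one for each inversion, so that
  inserting an element into \<open>A\<close> or \<open>B\<close> multiplies it by one more factor.\<close>

definition inv_sign :: "nat set \<Rightarrow> nat set \<Rightarrow> 'a::comm_ring_1" where
  "inv_sign A B = (\<Prod>a\<in>A. \<Prod>b\<in>B. if b < a then -1 else 1)"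

text \<open>The coefficient at an infinite set is \<open>0\<close>, since such a set has infinitely many subsets. The
  operation \<open>interior\<close> returns \<open>0\<close> there by definition. So the identities below hold for every \<open>Z\<close>, and
  some can be used as equations between functions.\<close>

definition wedge :: "(nat set \<Rightarrow> 'a::comm_ring_1) \<Rightarrow> (nat set \<Rightarrow> 'a) \<Rightarrow> nat set \<Rightarrow> 'a" where
  "wedge u v Z = (\<Sum>A\<in>Pow Z. inv_sign A (Z - A) * u A * v (Z - A))"

text \<open>Removal of the basis vector \<open>j\<close> from the right, the interior product with a dual basis vector.\<close>

definition interior :: "nat \<Rightarrow> (nat set \<Rightarrow> 'a::comm_ring_1) \<Rightarrow> nat set \<Rightarrow> 'a" where
  "interior j u Z = (if j \<in> Z \<or> infinite Z then 0 else inv_sign Z {j} * u (insert j Z))"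

text \<open>The grade involution, which carries the sign in the antiderivation rule.\<close>

definition invol :: "(nat set \<Rightarrow> 'a::comm_ring_1) \<Rightarrow> nat set \<Rightarrow> 'a" where
  "invol u Z = (-1) ^ card Z * u Z"

definition contract :: "nat \<Rightarrow> (nat \<Rightarrow> 'a::comm_ring_1) \<Rightarrow> (nat set \<Rightarrow> 'a) \<Rightarrow> nat set \<Rightarrow> 'a" where
  "contract n x u Z = (\<Sum>j = 1..n. x j * interior j u Z)"

lemma inv_sign_insert_left:
  "finite A \<Longrightarrow> j \<notin> A \<Longrightarrow> inv_sign (insert j A) B = inv_sign {j} B * inv_sign A B"
  by (simp add: inv_sign_def)

lemma inv_sign_insert_right:
  "finite B \<Longrightarrow> j \<notin> B \<Longrightarrow> inv_sign A (insert j B) = inv_sign A {j} * inv_sign A B"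
  by (simp add: inv_sign_def prod.distrib)

lemma inv_sign_square:
  "inv_sign A B * inv_sign A B = (1 :: 'a::comm_ring_1)"
  "inv_sign A B * (inv_sign A B * c) = (c :: 'a)"
proof -
  show "inv_sign A B * inv_sign A B = (1 :: 'a)"
    by (simp add: inv_sign_def prod.distrib[symmetric] if_distrib cong: if_cong)
  then show "inv_sign A B * (inv_sign A B * c) = c" by (simp add: mult.assoc[symmetric])
qed

lemma inv_sign_swap:
  assumes "finite B" "j \<notin> B"
  shows "inv_sign {j} B = (-1) ^ card B * (inv_sign B {j} :: 'a::comm_ring_1)"
  using assms
proof (induction B)
  case (insert b B)
  have "b < j \<longleftrightarrow> \<not> j < b" using insert by auto
  then show ?case using insert by (auto simp: inv_sign_def)
qed (simp add: inv_sign_def)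

text \<open>Removal from the right is an antiderivation. If \<open>j \<notin> Z\<close>, the subsets of \<open>insert j Z\<close> are sorted
  according to whether \<open>j\<close> falls into the left or the right factor. If \<open>j \<in> Z\<close>, the left-hand side is
  \<open>0\<close>, and moving \<open>j\<close> from one factor to the other pairs off the terms on the right.\<close>

lemma interior_wedge:
  fixes u v :: "nat set \<Rightarrow> 'a::comm_ring_1"
  shows "interior j (wedge u v) Z = wedge u (interior j v) Z + wedge (interior j u) (invol v) Z"
proof (cases "finite Z")
  case False
  then have "infinite (Pow Z)" by simp
  then show ?thesis using False by (simp add: wedge_def interior_def)
next
  case fin: True
  have fs: "finite A" "finite (Z - A)" if "A \<in> Pow Z" for A
    using that fin by (auto intro: finite_subset)
  show ?thesis
  proof (cases "j \<in> Z")
    case False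
    have eq: "Pow (insert j Z) = Pow Z \<union> insert j ` Pow Z" by (rule Pow_insert)
    have inj: "inj_on (insert j) (Pow Z)" using False by (auto simp: inj_on_def)
    have *: "wedge u v (insert j Z) =
        (\<Sum>A\<in>Pow Z. inv_sign A (insert j (Z - A)) * u A * v (insert j (Z - A))) +
        (\<Sum>A\<in>Pow Z. inv_sign (insert j A) (Z - A) * u (insert j A) * v (Z - A))"
      unfolding wedge_def eq
    proof (subst sum.union_disjoint)
      show "Pow Z \<inter> insert j ` Pow Z = {}" using False by auto
      have "insert j Z - A = insert j (Z - A)" if "A \<in> Pow Z" for A using that False by auto
      moreover have "insert j Z - insert j A = Z - A" if "A \<in> Pow Z" for A
        using that False by auto
      ultimately show "(\<Sum>A\<in>Pow Z. inv_sign A (insert j Z - A) * u A * v (insert j Z - A)) +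
          (\<Sum>A\<in>insert j ` Pow Z. inv_sign A (insert j Z - A) * u A * v (insert j Z - A)) =
          (\<Sum>A\<in>Pow Z. inv_sign A (insert j (Z - A)) * u A * v (insert j (Z - A))) +
          (\<Sum>A\<in>Pow Z. inv_sign (insert j A) (Z - A) * u (insert j A) * v (Z - A))"
        unfolding sum.reindex[OF inj] o_def
        by (intro arg_cong2[where f = "(+)"] sum.cong refl) simp_all
    qed (use fin in auto)
    have split: "inv_sign Z {j} = (inv_sign A {j} * inv_sign (Z - A) {j} :: 'a)"
      if "A \<in> Pow Z" for A
    proof -
      have "Z = A \<union> (Z - A)" using that by auto
      then have "inv_sign Z {j} = (inv_sign (A \<union> (Z - A)) {j} :: 'a)" by simp
      also have "\<dots> = inv_sign A {j} * inv_sign (Z - A) {j}"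
        unfolding inv_sign_def using fs[OF that] by (subst prod.union_disjoint) auto
      finally show ?thesis .
    qed
    have 1: "inv_sign Z {j} * (inv_sign A (insert j (Z - A)) * u A * v (insert j (Z - A))) =
        inv_sign A (Z - A) * u A * interior j v (Z - A)" if "A \<in> Pow Z" for A
    proof -
      have j: "j \<notin> A" "j \<notin> Z - A" using that False by auto
      show ?thesis
        using fs[OF that] j unfolding interior_def split[OF that] inv_sign_insert_right[OF fs(2)[OF that] j(2)]
        by (simp add: inv_sign_square mult_ac)
    qed
    have 2: "inv_sign Z {j} * (inv_sign (insert j A) (Z - A) * u (insert j A) * v (Z - A)) =
        inv_sign A (Z - A) * interior j u A * invol v (Z - A)" if "A \<in> Pow Z" for A
    proof -
      have j: "j \<notin> A" "j \<notin> Z - A" using that False by auto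
      show ?thesis
        using fs[OF that] j unfolding interior_def split[OF that] invol_def
          inv_sign_insert_left[OF fs(1)[OF that] j(1)] inv_sign_swap[OF fs(2)[OF that] j(2)]
        by (simp add: inv_sign_square mult_ac)
    qed
    have "interior j (wedge u v) Z = inv_sign Z {j} * wedge u v (insert j Z)"
      using False fin by (simp add: interior_def)
    also have "\<dots> = wedge u (interior j v) Z + wedge (interior j u) (invol v) Z"
      unfolding * distrib_left sum_distrib_left unfolding wedge_def
      by (intro arg_cong2[where f = "(+)"] sum.cong refl 1 2)
    finally show ?thesis .
  next
    case True
    let ?P = "Pow (Z - {j})"
    have eq: "Pow Z = ?P \<union> insert j ` ?P"
      using True Pow_insert[of j "Z - {j}"] by (simp add: insert_absorb)
    have inj: "inj_on (insert j) ?P" by (auto simp: inj_on_def)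
    have split: "(\<Sum>A\<in>Pow Z. f A) = (\<Sum>A\<in>?P. f A) + (\<Sum>A\<in>?P. f (insert j A))"
      for f :: "nat set \<Rightarrow> 'a"
      unfolding eq by (subst sum.union_disjoint)
        (use fin in \<open>auto simp: sum.reindex[OF inj] o_def intro: finite_subset[OF _ fin]\<close>)
    have A: "inv_sign A (Z - A) * u A * interior j v (Z - A) = 0" if "A \<in> ?P" for A
      using that True by (auto simp: interior_def)
    have B: "inv_sign (insert j A) (Z - insert j A) * interior j u (insert j A)
        * invol v (Z - insert j A) = 0" for A
      by (auto simp: interior_def)
    have C: "inv_sign (insert j A) (Z - insert j A) * u (insert j A) * interior j v (Z - insert j A)
        = - (inv_sign A (Z - A) * interior j u A * invol v (Z - A))" if "A \<in> ?P" for A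
    proof -
      let ?D = "Z - insert j A"
      have ZA: "Z - A = insert j ?D" and j: "j \<notin> A" "j \<notin> ?D" and f: "finite A" "finite ?D"
        using that True fin by (auto intro: finite_subset)
      have D: "Z - insert j A = ?D" "insert j ?D - {j} = ?D" using j by auto
      show ?thesis unfolding ZA interior_def invol_def inv_sign_insert_left[OF f(1) j(1)]
          inv_sign_insert_right[OF f(2) j(2)] inv_sign_swap[OF f(2) j(2)]
        using j f by (simp add: inv_sign_square mult_ac)
    qed
    have "wedge u (interior j v) Z + wedge (interior j u) (invol v) Z = 0"
      unfolding wedge_def split by (simp add: A B C sum_negf)
    then show ?thesis using True by (simp add: interior_def)
  qed
qed

lemma wedge_sum_right: "wedge u (\<lambda>Z. \<Sum>i\<in>I. c i * v i Z) Z = (\<Sum>i\<in>I. c i * wedge u (v i) Z)"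
  unfolding wedge_def sum_distrib_left by (subst sum.swap) (simp add: mult_ac)

lemma wedge_sum_left: "wedge (\<lambda>Z. \<Sum>i\<in>I. c i * u i Z) v Z = (\<Sum>i\<in>I. c i * wedge (u i) v Z)"
  unfolding wedge_def sum_distrib_left sum_distrib_right by (subst sum.swap) (simp add: mult_ac)

lemma contract_wedge:
  "contract n x (wedge u v) Z = wedge u (contract n x v) Z + wedge (contract n x u) (invol v) Z"
proof -
  have "contract n x v = (\<lambda>Z. \<Sum>j = 1..n. x j * interior j v Z)" for v
    by (simp add: contract_def fun_eq_iff)
  then show ?thesis
    by (simp add: wedge_sum_left wedge_sum_right interior_wedge sum.distrib algebra_simps)
qed

lemma interior_interior: "interior j (interior j u) Z = 0"
  by (simp add: interior_def)

lemma interior_anticommute: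
  assumes "i \<noteq> j"
  shows "interior i (interior j u) Z = - (interior j (interior i u) Z :: 'a::comm_ring_1)"
proof (cases "i \<in> Z \<or> j \<in> Z \<or> infinite Z")
  case False
  then have 1: "inv_sign (insert i Z) {j} = inv_sign {i} {j} * (inv_sign Z {j} :: 'a)"
    and 2: "inv_sign (insert j Z) {i} = inv_sign {j} {i} * (inv_sign Z {i} :: 'a)"
    by (auto intro: inv_sign_insert_left)
  have 3: "inv_sign {i} {j} = - (inv_sign {j} {i} :: 'a)"
    using assms by (auto simp: inv_sign_def)
  show ?thesis using assms False unfolding interior_def 1 2 3
    by (simp add: insert_commute mult_ac)
qed (use assms in \<open>auto simp: interior_def\<close>)

lemma contract_anticommute_sum:
  "contract n x (contract n y u) Z = (\<Sum>i = 1..n. \<Sum>j = 1..n. x i * y j * interior i (interior j u) Z)"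
proof -
  have "interior i (contract n y u) Z = (\<Sum>j = 1..n. y j * interior i (interior j u) Z)" for i
    by (auto simp: interior_def contract_def sum_distrib_left mult_ac)
  then show ?thesis by (simp add: contract_def[of n x] sum_distrib_left mult_ac)
qed

lemma contract_anticommute: "contract n x (contract n y u) Z = - contract n y (contract n x u) Z"
proof -
  have "contract n x (contract n y u) Z = (\<Sum>j = 1..n. \<Sum>i = 1..n. x i * y j * interior i (interior j u) Z)"
    unfolding contract_anticommute_sum by (rule sum.swap)
  also have "\<dots> = (\<Sum>j = 1..n. \<Sum>i = 1..n. - (y j * x i * interior j (interior i u) Z))"
  proof (intro sum.cong refl)
    fix i j show "x i * y j * interior i (interior j u) Z = - (y j * x i * interior j (interior i u) Z)"
      by (cases "i = j") (simp_all add: interior_interior interior_anticommute[of i j] mult_ac)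
  qed
  also have "\<dots> = - contract n y (contract n x u) Z"
    unfolding contract_anticommute_sum by (simp add: sum_negf)
  finally show ?thesis .
qed

text \<open>In characteristic \<open>2\<close> this does not follow from anticommutativity; the terms with \<open>i < j\<close> and with
  \<open>j < i\<close> cancel, and those with \<open>i = j\<close> vanish.\<close>

lemma contract_contract_self: "contract n x (contract n x u) Z = 0"
proof -
  let ?f = "\<lambda>(i, j). x i * x j * interior i (interior j u) Z"
  let ?I = "{1..n} \<times> {1..n}"
  have "contract n x (contract n x u) Z = sum ?f ?I"
    unfolding contract_anticommute_sum by (simp add: sum.cartesian_product)
  also have "?I = {p \<in> ?I. fst p < snd p} \<union> {p \<in> ?I. snd p < fst p} \<union> {p \<in> ?I. fst p = snd p}"
    by auto
  also have "sum ?f \<dots> = sum ?f {p \<in> ?I. fst p < snd p} + sum ?f {p \<in> ?I. snd p < fst p}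
      + sum ?f {p \<in> ?I. fst p = snd p}"
    by (subst sum.union_disjoint; (subst sum.union_disjoint)?) auto
  also have "sum ?f {p \<in> ?I. fst p = snd p} = 0"
    by (rule sum.neutral) (auto simp: interior_interior)
  also have "sum ?f {p \<in> ?I. snd p < fst p} = sum (\<lambda>p. - ?f p) {p \<in> ?I. fst p < snd p}"
  proof (rule sum.reindex_bij_witness[of _ prod.swap prod.swap])
    fix p assume p: "p \<in> {p \<in> ?I. snd p < fst p}"
    then show "- ?f (prod.swap p) = ?f p"
      using interior_anticommute[of "fst p" "snd p" u Z] by (auto simp: split_beta mult_ac)
  qed auto
  finally show ?thesis by (simp add: sum_negf)
qed

section \<open>Products of alternating forms\<close>

text \<open>The exterior algebra on the first \<open>n\<close> basis vectors in degree \<open>d\<close>; in particular \<open>u\<close> vanishes for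
  \<open>d > n\<close>.\<close>

definition homog :: "nat \<Rightarrow> nat \<Rightarrow> (nat set \<Rightarrow> 'a::zero) \<Rightarrow> bool" where
  "homog n d u \<longleftrightarrow> (\<forall>Z. u Z \<noteq> 0 \<longrightarrow> Z \<subseteq> {1..n} \<and> card Z = d)"

text \<open>Up to a sign that depends only on the degree this is \<open>contract\<close>. The sign makes it commute with
  \<open>contract\<close> and makes the sum in \<open>contract_link_product_sum\<close> telescope.\<close>

definition lcontract :: "nat \<Rightarrow> (nat \<Rightarrow> 'a::comm_ring_1) \<Rightarrow> (nat set \<Rightarrow> 'a) \<Rightarrow> nat set \<Rightarrow> 'a" where
  "lcontract n x u Z = - invol (contract n x u) Z"

definition contracts where "contracts n x is u = fold (\<lambda>i. contract n (x i)) is u"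

definition lcontracts where "lcontracts n x is u = fold (\<lambda>i. lcontract n (x i)) is u"

text \<open>The rows after \<open>k\<close> are used up by \<open>\<phi>\<close> and the rows before \<open>k\<close> by \<open>u\<close>, so row \<open>k\<close> is the only one by
  which both factors can still be contracted.\<close>

definition link_product ::
  "nat \<Rightarrow> nat \<Rightarrow> (nat \<Rightarrow> nat \<Rightarrow> 'a::comm_ring_1) \<Rightarrow> nat \<Rightarrow> (nat set \<Rightarrow> 'a) \<Rightarrow> (nat set \<Rightarrow> 'a) \<Rightarrow> nat set \<Rightarrow> 'a"
  where "link_product m n x k \<phi> u =
    wedge (contracts n x (rev [Suc k..<Suc m]) \<phi>) (lcontracts n x [1..<k] u)"

text \<open>Both lists start with the outermost factor. Only lists with one more form than row indices matter.\<close>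

fun link_elem ::
  "nat \<Rightarrow> nat \<Rightarrow> (nat \<Rightarrow> nat \<Rightarrow> 'a::comm_ring_1) \<Rightarrow> nat list \<Rightarrow> (nat set \<Rightarrow> 'a) list \<Rightarrow> nat set \<Rightarrow> 'a"
  where
    "link_elem m n x (k # ks) (\<phi> # \<psi> # \<phi>s) = link_product m n x k \<phi> (link_elem m n x ks (\<psi> # \<phi>s))"
  | "link_elem m n x [] (\<phi> # \<phi>s) = \<phi>"
  | "link_elem m n x ks \<phi>s = (\<lambda>_. 0)"

text \<open>Up to sign, the linear combination of the maximal minors with coefficients \<open>\<phi>\<close>; see
  \<open>minor_form_eq\<close>.\<close>

definition minor_form where
  "minor_form m n x \<phi> = contracts n x (rev [1..<Suc m]) \<phi> {}"

lemma homog_contract: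
  assumes "homog a (Suc d) u" shows "homog a d (contract n x u)"
  unfolding homog_def
proof (intro allI impI)
  fix Z assume "contract n x u Z \<noteq> 0"
  then obtain j where "j \<in> {1..n}" "x j * interior j u Z \<noteq> 0"
    unfolding contract_def by (meson sum.not_neutral_contains_not_neutral)
  then have "j \<notin> Z" "finite Z" "u (insert j Z) \<noteq> 0" by (auto simp: interior_def split: if_splits)
  then show "Z \<subseteq> {1..a} \<and> card Z = d" using assms unfolding homog_def by fastforce
qed

lemma homog_lcontract: "homog a (Suc d) u \<Longrightarrow> homog a d (lcontract n x u)"
  using homog_contract[of a d u n x] unfolding homog_def lcontract_def invol_def
  by (metis minus_zero mult_zero_right)

lemma homog_contracts: "homog a (length is + d) u \<Longrightarrow> homog a d (contracts n x is u)"
  by (induction "is" arbitrary: u) (auto simp: contracts_def homog_contract)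

lemma homog_lcontracts: "homog a (length is + d) u \<Longrightarrow> homog a d (lcontracts n x is u)"
  by (induction "is" arbitrary: u) (auto simp: lcontracts_def homog_lcontract)

lemma homog_wedge:
  assumes "homog c d u" "homog c e v" shows "homog c (d + e) (wedge u v)"
  unfolding homog_def
proof (intro allI impI)
  fix Z assume "wedge u v Z \<noteq> 0"
  then obtain A where "A \<in> Pow Z" "inv_sign A (Z - A) * u A * v (Z - A) \<noteq> 0"
    unfolding wedge_def by (meson sum.not_neutral_contains_not_neutral)
  then have A: "A \<subseteq> Z" "u A \<noteq> 0" "v (Z - A) \<noteq> 0" by auto
  then have "A \<subseteq> {1..c}" "card A = d" "Z - A \<subseteq> {1..c}" "card (Z - A) = e"
    using assms unfolding homog_def by blast+
  moreover from this have "finite A" "finite (Z - A)" by (auto intro: finite_subset)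
  moreover have "Z = A \<union> (Z - A)" using A by auto
  ultimately show "Z \<subseteq> {1..c} \<and> card Z = d + e"
    by (metis Diff_disjoint Un_least card_Un_disjoint)
qed

lemma homog_link_product:
  assumes "homog n m \<phi>" "homog n d u" "1 \<le> k" "k \<le> m" "k \<le> Suc d"
  shows "homog n (Suc d) (link_product m n x k \<phi> u)"
proof -
  have "homog n k (contracts n x (rev [Suc k..<Suc m]) \<phi>)"
    using assms by (intro homog_contracts) (auto simp del: upt_Suc)
  moreover have "homog n (Suc d - k) (lcontracts n x [1..<k] u)"
    using assms by (intro homog_lcontracts) auto
  ultimately show ?thesis
    using homog_wedge assms(5) unfolding link_product_def by fastforce
qed

lemma homog_link_elem:
  assumes "set ks \<subseteq> {1..m}" "length \<phi>s = Suc (length ks)" "\<forall>\<phi>\<in>set \<phi>s. homog n m \<phi>"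
  shows "homog n (m + length ks) (link_elem m n x ks \<phi>s)"
  using assms
proof (induction m n x ks \<phi>s rule: link_elem.induct)
  case (1 m n x k ks \<phi> \<psi> \<phi>s)
  then show ?case using homog_link_product[of n m \<phi> "m + length ks" _ k x] by auto
qed auto

lemma contracts_Nil [simp]: "contracts n x [] u = u"
  and contracts_Cons [simp]: "contracts n x (i # is) u = contracts n x is (contract n (x i) u)"
  and contracts_append: "contracts n x (is @ js) u = contracts n x js (contracts n x is u)"
  and lcontracts_Nil [simp]: "lcontracts n x [] u = u"
  and lcontracts_Cons [simp]: "lcontracts n x (i # is) u = lcontracts n x is (lcontract n (x i) u)"
  and lcontracts_append: "lcontracts n x (is @ js) u = lcontracts n x js (lcontracts n x is u)"
  by (simp_all add: contracts_def lcontracts_def)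

lemma contract_add: "contract n x (\<lambda>Z. u Z + v Z) = (\<lambda>Z. contract n x u Z + contract n x v Z)"
  by (simp add: contract_def interior_def fun_eq_iff sum.distrib[symmetric] distrib_left)
    (auto intro!: sum.cong simp: algebra_simps)

lemma contract_uminus: "contract n x (\<lambda>Z. - u Z) = (\<lambda>Z. - contract n x u Z)"
  by (simp add: contract_def interior_def fun_eq_iff sum_negf[symmetric])
    (auto intro!: sum.cong simp: algebra_simps)

lemma contract_zero: "contract n x (\<lambda>Z. 0) = (\<lambda>Z. 0)"
  by (auto simp: contract_def interior_def fun_eq_iff intro!: sum.neutral)

lemma contract_sum: "contract n x (\<lambda>Z. \<Sum>l\<in>L. f l Z) = (\<lambda>Z. \<Sum>l\<in>L. contract n x (f l) Z)"
  by (induction L rule: infinite_finite_induct) (simp_all add: contract_zero contract_add)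

lemma lcontract_zero: "lcontract n x (\<lambda>Z. 0) = (\<lambda>Z. 0)"
  by (simp add: lcontract_def invol_def contract_zero fun_eq_iff)

lemma lcontract_sum: "lcontract n x (\<lambda>Z. \<Sum>l\<in>L. f l Z) = (\<lambda>Z. \<Sum>l\<in>L. lcontract n x (f l) Z)"
  by (simp add: lcontract_def fun_eq_iff invol_def contract_sum sum_distrib_left sum_negf)

lemma lcontracts_zero: "lcontracts n x is (\<lambda>Z. 0) = (\<lambda>Z. 0)"
  by (induction "is") (simp_all add: lcontract_zero)

lemma lcontracts_sum: "lcontracts n x is (\<lambda>Z. \<Sum>l\<in>L. f l Z) = (\<lambda>Z. \<Sum>l\<in>L. lcontracts n x is (f l) Z)"
  by (induction "is" arbitrary: f) (simp_all add: lcontract_sum)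

lemma contract_invol: "contract n x (invol u) = (\<lambda>Z. - invol (contract n x u) Z)"
proof
  fix Z
  have "interior j (invol u) Z = - ((-1) ^ card Z * interior j u Z)" for j
    by (simp add: interior_def invol_def algebra_simps)
  then show "contract n x (invol u) Z = - invol (contract n x u) Z"
    by (simp add: contract_def invol_def sum_negf sum_distrib_left mult_ac)
qed

lemma invol_invol: "invol (invol u) = u"
  by (simp add: invol_def fun_eq_iff power_mult_distrib[symmetric] mult.assoc[symmetric])

lemma contract_lcontract: "contract n x (lcontract n y u) = lcontract n y (contract n x u)"
proof
  fix Z
  have "contract n x (lcontract n y u) Z = contract n x (\<lambda>Z. - invol (contract n y u) Z) Z"
    by (simp add: lcontract_def[abs_def])
  also have "\<dots> = invol (contract n x (contract n y u)) Z"
    by (simp add: contract_uminus contract_invol)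
  also have "\<dots> = lcontract n y (contract n x u) Z"
    by (simp add: lcontract_def invol_def contract_anticommute[of n x y])
  finally show "contract n x (lcontract n y u) Z = lcontract n y (contract n x u) Z" .
qed

lemma contract_lcontracts: "contract n y (lcontracts n x is u) = lcontracts n x is (contract n y u)"
  by (induction "is" arbitrary: u) (simp_all add: contract_lcontract)

text \<open>A row cannot be used twice: this kills the terms in which a row before \<open>k\<close> hits the right factor
  of a product, and \<open>contract_contracts_mem\<close> those in which a row after \<open>k\<close> hits the left one.\<close>

lemma lcontracts_contract_mem:
  assumes "l \<in> set is" shows "lcontracts n x is (contract n (x l) u) = (\<lambda>Z. 0)"
proof -
  obtain as bs where "is": "is = as @ l # bs" using assms by (meson split_list)
  have "lcontract n (x l) (contract n (x l) v) = (\<lambda>Z. 0)" for v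
    by (simp add: lcontract_def invol_def contract_contract_self fun_eq_iff)
  then have "lcontracts n x (l # bs) (contract n (x l) v) = (\<lambda>Z. 0)" for v
    by (simp add: lcontracts_zero)
  then show ?thesis
    by (simp add: "is" lcontracts_append flip: contract_lcontracts)
qed

lemma contract_contracts_mem:
  assumes "l \<in> set is" shows "contract n (x l) (contracts n x is u) = (\<lambda>Z. 0)"
  using assms
proof (induction "is" arbitrary: u)
  case (Cons i "is")
  have anti: "contract n (x l) (contracts n x js v) Z
      = (-1) ^ length js * contracts n x js (contract n (x l) v) Z" for js v Z
  proof (induction js arbitrary: v)
    case (Cons j js)
    have "contract n (x j) (contract n (x l) v) = (\<lambda>Z. - contract n (x l) (contract n (x j) v) Z)"
      by (simp add: fun_eq_iff contract_anticommute[of n "x j" "x l"])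
    moreover have "contracts n x js (\<lambda>Z. - w Z) Z = - contracts n x js w Z" for w
      by (induction js arbitrary: w) (simp_all add: contract_uminus)
    ultimately show ?case using Cons by simp
  qed simp
  have z: "contracts n x js (\<lambda>Z. 0) = (\<lambda>Z. 0)" for js
    by (induction js) (simp_all add: contract_zero)
  show ?case
  proof (cases "l = i")
    case True
    have "contract n (x i) (contract n (x i) u) = (\<lambda>Z. 0)"
      by (simp add: fun_eq_iff contract_contract_self)
    then have "contracts n x is (contract n (x i) (contract n (x i) u)) = (\<lambda>Z. 0)" by (simp add: z)
    then show ?thesis using anti[of "is"] True by (simp add: fun_eq_iff)
  qed (use Cons in auto)
qed simp

lemma wedge_zero: "wedge (\<lambda>Z. 0) v = (\<lambda>Z. 0)" "wedge u (\<lambda>Z. 0) = (\<lambda>Z. 0)"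
  by (simp_all add: wedge_def fun_eq_iff)

lemma wedge_uminus_right: "wedge u (\<lambda>Z. - v Z) Z = - wedge u v Z"
  by (simp add: wedge_def sum_negf)

lemma wedge_sum: "wedge u (\<lambda>Z. \<Sum>l\<in>L. f l Z) Z = (\<Sum>l\<in>L. wedge u (f l) Z)"
  using wedge_sum_right[of u "\<lambda>_. 1" f L Z] by simp

lemma wedge_scalar:
  assumes "\<And>Z. Z \<noteq> {} \<Longrightarrow> a Z = 0" "finite Z"
  shows "wedge a v Z = a {} * v Z"
proof -
  have "wedge a v Z = (\<Sum>A\<in>{{}}. inv_sign A (Z - A) * a A * v (Z - A))"
    unfolding wedge_def using assms by (intro sum.mono_neutral_right) auto
  then show ?thesis by (simp add: inv_sign_def)
qed

text \<open>By the antiderivation rule row \<open>l\<close> hits either factor of the \<open>l\<close>-th product. Hitting the left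
  factor of the product with index \<open>l + 1\<close> gives, up to sign, what hitting the right factor of the
  product with index \<open>l\<close> gives, so the sum telescopes. What remains is the left end, where \<open>\<phi>\<close> is
  contracted by all rows and has become a scalar, and the right end.\<close>

lemma contract_link_product_sum:
  assumes "homog n m \<phi>" "homog n d u" "1 \<le> k" "k \<le> m"
  shows "(\<Sum>l = 1..k. contract n (x l) (link_product m n x l \<phi> u) Z) =
    minor_form m n x \<phi> * invol u Z +
    wedge (contracts n x (rev [Suc k..<Suc m]) \<phi>) (contract n (x k) (lcontracts n x [1..<k] u)) Z"
  using assms(3,4)
proof (induction k rule: nat_induct_at_least)
  case base
  let ?\<Phi> = "\<lambda>k. contracts n x (rev [Suc k..<Suc m]) \<phi>"
  have \<Phi>: "contract n (x 1) (?\<Phi> 1) = ?\<Phi> 0"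
  proof -
    have "rev [1..<Suc m] = rev [2..<Suc m] @ [1]"
      using upt_conv_Cons[of 1 "Suc m"] base by (simp add: numeral_2_eq_2 del: upt_Suc)
    then show ?thesis by (simp add: contracts_append numeral_2_eq_2 del: upt_Suc)
  qed
  have "homog n 0 (?\<Phi> 0)"
    using assms(1) by (intro homog_contracts) (simp del: upt_Suc)
  then have z: "?\<Phi> 0 Z = 0" if "Z \<noteq> {}" for Z
    using that finite_subset[of Z "{1..n}"] by (auto simp: homog_def)
  have "wedge (?\<Phi> 0) (invol u) Z = minor_form m n x \<phi> * invol u Z"
  proof (cases "finite Z")
    case True
    then show ?thesis using wedge_scalar[of "?\<Phi> 0", OF z] by (simp add: minor_form_def)
  next
    case False
    then have "u Z = 0" using assms(2) finite_subset[of Z "{1..n}"] by (auto simp: homog_def)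
    moreover have "infinite (Pow Z)" using False by simp
    ultimately show ?thesis by (simp add: wedge_def invol_def)
  qed
  then show ?case using \<Phi> by (simp add: link_product_def contract_wedge del: upt_Suc)
next
  case (Suc k)
  let ?\<Phi> = "\<lambda>k. contracts n x (rev [Suc k..<Suc m]) \<phi>"
  have \<Phi>: "contract n (x (Suc k)) (?\<Phi> (Suc k)) = ?\<Phi> k"
  proof -
    have "rev [Suc k..<Suc m] = rev [Suc (Suc k)..<Suc m] @ [Suc k]"
      using upt_conv_Cons[of "Suc k" "Suc m"] Suc by (simp del: upt_Suc)
    then show ?thesis by (simp add: contracts_append del: upt_Suc)
  qed
  have inv: "invol (lcontracts n x [1..<Suc k] u) = (\<lambda>Z. - contract n (x k) (lcontracts n x [1..<k] u) Z)"
  proof -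
    have "lcontracts n x [1..<Suc k] u = lcontract n (x k) (lcontracts n x [1..<k] u)"
      using Suc by (simp add: lcontracts_append)
    then show ?thesis
      by (simp add: lcontract_def invol_def fun_eq_iff mult.assoc[symmetric]
          power_mult_distrib[symmetric])
  qed
  have "contract n (x (Suc k)) (link_product m n x (Suc k) \<phi> u) Z =
      wedge (?\<Phi> (Suc k)) (contract n (x (Suc k)) (lcontracts n x [1..<Suc k] u)) Z
      - wedge (?\<Phi> k) (contract n (x k) (lcontracts n x [1..<k] u)) Z"
    unfolding link_product_def contract_wedge \<Phi> inv wedge_uminus_right by simp
  then show ?case using Suc by simp
qed

text \<open>Equality up to a sign that is allowed to alternate with the degree. This much uniformity in \<open>Z\<close> is
  what contractions preserve.\<close>

definition sign_eq :: "(nat set \<Rightarrow> 'a::comm_ring_1) \<Rightarrow> (nat set \<Rightarrow> 'a) \<Rightarrow> bool" where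
  "sign_eq u v \<longleftrightarrow> (\<exists>s\<in>{1, -1}. \<exists>t\<in>{1, -1}. \<forall>Z. u Z = s * t ^ card Z * v Z)"

lemma sign_eqI: "s \<in> {1, -1} \<Longrightarrow> t \<in> {1, -1} \<Longrightarrow> (\<And>Z. u Z = s * t ^ card Z * v Z) \<Longrightarrow> sign_eq u v"
  unfolding sign_eq_def by blast

lemma sign_eq_refl: "sign_eq u u"
  by (rule sign_eqI[of 1 1]) auto

lemma sign_eq_trans:
  assumes "sign_eq u v" "sign_eq v w" shows "sign_eq u w"
proof -
  obtain s t s' t' where st: "s \<in> {1, -1}" "t \<in> {1, -1}" "\<And>Z. u Z = s * t ^ card Z * v Z"
    "s' \<in> {1, -1}" "t' \<in> {1, -1}" "\<And>Z. v Z = s' * t' ^ card Z * w Z"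
    using assms unfolding sign_eq_def by metis
  show ?thesis by (rule sign_eqI[of "s * s'" "t * t'"]) (use st in \<open>auto simp: power_mult_distrib\<close>)
qed

lemma sign_eq_contract:
  assumes "sign_eq u v" shows "sign_eq (contract n y u) (contract n y v)"
proof -
  obtain s t where st: "s \<in> {1, -1}" "t \<in> {1, -1}" "\<And>Z. u Z = s * t ^ card Z * v Z"
    using assms unfolding sign_eq_def by metis
  have "interior j u Z = s * t * t ^ card Z * interior j v Z" for j Z
    by (simp add: interior_def st(3) mult_ac)
  then have "contract n y u Z = (s * t) * t ^ card Z * contract n y v Z" for Z
    by (simp add: contract_def sum_distrib_left mult_ac)
  then show ?thesis by (intro sign_eqI[of "s * t" t]) (use st in auto)
qed

lemma sign_eq_lcontract: "sign_eq (lcontract n y u) (contract n y u)"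
  by (rule sign_eqI[of "-1" "-1"]) (auto simp: lcontract_def invol_def)

lemma sign_eq_contracts: "sign_eq u v \<Longrightarrow> sign_eq (contracts n x is u) (contracts n x is v)"
  by (induction "is" arbitrary: u v) (auto intro: sign_eq_contract)

lemma sign_eq_lcontracts: "sign_eq (lcontracts n x is u) (contracts n x is u)"
proof (induction "is" arbitrary: u)
  case (Cons i "is")
  have "sign_eq (contracts n x is (lcontract n (x i) u)) (contracts n x is (contract n (x i) u))"
    by (intro sign_eq_contracts sign_eq_lcontract)
  then show ?case using Cons sign_eq_trans by fastforce
qed (simp add: sign_eq_refl)

lemma sign_eq_contract_contracts: "sign_eq (contract n y (contracts n x is u)) (contracts n x is (contract n y u))"
proof (induction "is" arbitrary: u)
  case (Cons i "is")
  have "sign_eq (contract n y (contract n (x i) u)) (contract n (x i) (contract n y u))"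
    by (rule sign_eqI[of "-1" 1]) (simp_all add: contract_anticommute[of n y])
  then have "sign_eq (contracts n x is (contract n y (contract n (x i) u)))
      (contracts n x is (contract n (x i) (contract n y u)))"
    by (rule sign_eq_contracts)
  then show ?case using Cons sign_eq_trans by fastforce
qed (simp add: sign_eq_refl)

lemma sign_eq_contracts_rev: "sign_eq (contracts n x (rev is) u) (contracts n x is u)"
proof (induction "is" arbitrary: u)
  case (Cons i "is")
  have "sign_eq (contract n (x i) (contracts n x (rev is) u)) (contract n (x i) (contracts n x is u))"
    by (intro sign_eq_contract Cons)
  then show ?case using sign_eq_contract_contracts sign_eq_trans by (fastforce simp: contracts_append)
qed (simp add: sign_eq_refl)

text \<open>Subrings and submodules as sets, since ideals of the polynomial ring in finitely many of the
  indeterminates are not ideals of the ambient type.\<close>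

definition subring_of :: "'a::comm_ring_1 set \<Rightarrow> bool" where
  "subring_of R \<longleftrightarrow> 1 \<in> R \<and> (\<forall>a\<in>R. - a \<in> R) \<and> (\<forall>a\<in>R. \<forall>b\<in>R. a + b \<in> R \<and> a * b \<in> R)"

definition submodule_of :: "'a::comm_ring_1 set \<Rightarrow> 'a set \<Rightarrow> bool" where
  "submodule_of R M \<longleftrightarrow> 0 \<in> M \<and> (\<forall>a\<in>M. \<forall>b\<in>M. a + b \<in> M) \<and> (\<forall>r\<in>R. \<forall>a\<in>M. r * a \<in> M)"

lemma subring_imp_submodule: "subring_of R \<Longrightarrow> submodule_of R R"
  unfolding subring_of_def submodule_of_def by (metis add.right_inverse)

lemma submodule_sum: "submodule_of R M \<Longrightarrow> (\<And>i. i \<in> I \<Longrightarrow> f i \<in> M) \<Longrightarrow> sum f I \<in> M"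
  by (induction I rule: infinite_finite_induct) (auto simp: submodule_of_def)

lemma sign_in_subring:
  assumes "subring_of R" shows "(-1) ^ k \<in> R" "inv_sign A B \<in> R"
proof -
  have 1: "1 \<in> R" "- 1 \<in> R" using assms by (auto simp: subring_of_def)
  show "(-1) ^ k \<in> R" using 1 by (cases "even k") auto
  have p: "prod f I \<in> R" if "\<And>i. i \<in> I \<Longrightarrow> f i \<in> R" for f :: "nat \<Rightarrow> 'a" and I
    using that by (induction I rule: infinite_finite_induct)
      (use assms in \<open>auto simp: subring_of_def\<close>)
  show "inv_sign A B \<in> R" unfolding inv_sign_def using 1 by (intro p) auto
qed

context
  fixes R :: "'a::comm_ring_1 set" and n :: nat and x :: "nat \<Rightarrow> nat \<Rightarrow> 'a"
  assumes R: "subring_of R" and x: "\<And>i j. j \<in> {1..n} \<Longrightarrow> x i j \<in> R"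
begin

lemma invol_in: "submodule_of R M \<Longrightarrow> (\<And>Z. u Z \<in> M) \<Longrightarrow> invol u Z \<in> M"
  using sign_in_subring[OF R] by (simp add: invol_def submodule_of_def)

lemma contract_in: "submodule_of R M \<Longrightarrow> (\<And>Z. u Z \<in> M) \<Longrightarrow> contract n (x i) u Z \<in> M"
  unfolding contract_def interior_def using x sign_in_subring[OF R]
  by (intro submodule_sum) (auto simp: submodule_of_def)

lemma lcontract_in: "submodule_of R M \<Longrightarrow> (\<And>Z. u Z \<in> M) \<Longrightarrow> lcontract n (x i) u Z \<in> M"
proof -
  assume M: "submodule_of R M" "\<And>Z. u Z \<in> M"
  have "invol (contract n (x i) u) Z \<in> M" by (intro invol_in M contract_in)
  moreover have "- 1 \<in> R" using R by (simp add: subring_of_def)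
  ultimately have "(-1) * invol (contract n (x i) u) Z \<in> M"
    using M unfolding submodule_of_def by blast
  then show ?thesis by (simp add: lcontract_def)
qed

lemma contracts_in: "submodule_of R M \<Longrightarrow> (\<And>Z. u Z \<in> M) \<Longrightarrow> contracts n x is u Z \<in> M"
  by (induction "is" arbitrary: u) (simp_all add: contract_in)

lemma lcontracts_in: "submodule_of R M \<Longrightarrow> (\<And>Z. u Z \<in> M) \<Longrightarrow> lcontracts n x is u Z \<in> M"
  by (induction "is" arbitrary: u) (simp_all add: lcontract_in)

lemma wedge_in:
  assumes "submodule_of R M" "\<And>Z. u Z \<in> P" "\<And>Z. v Z \<in> Q" "\<And>a b. a \<in> P \<Longrightarrow> b \<in> Q \<Longrightarrow> a * b \<in> M"
  shows "wedge u v Z \<in> M"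
  unfolding wedge_def
proof (rule submodule_sum[OF assms(1)])
  fix A
  have "inv_sign A (Z - A) * (u A * v (Z - A)) \<in> M"
    using assms sign_in_subring[OF R] by (simp add: submodule_of_def)
  then show "inv_sign A (Z - A) * u A * v (Z - A) \<in> M" by (simp add: mult.assoc)
qed

lemma link_product_in:
  assumes "submodule_of R M" "submodule_of R P" "submodule_of R Q"
    "\<And>Z. \<phi> Z \<in> P" "\<And>Z. u Z \<in> Q" "\<And>a b. a \<in> P \<Longrightarrow> b \<in> Q \<Longrightarrow> a * b \<in> M"
  shows "link_product m n x k \<phi> u Z \<in> M"
  unfolding link_product_def
  by (rule wedge_in[OF assms(1) contracts_in[OF assms(2,4)] lcontracts_in[OF assms(3,5)] assms(6)])

lemma link_elem_in:
  assumes "\<And>\<phi> Z. \<phi> \<in> set \<phi>s \<Longrightarrow> \<phi> Z \<in> R" shows "link_elem m n x ks \<phi>s Z \<in> R"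
  using assms
proof (induction ks arbitrary: \<phi>s Z)
  case Nil
  then show ?case using subring_imp_submodule[OF R]
    by (cases \<phi>s) (auto simp: submodule_of_def)
next
  case (Cons k ks)
  note RR = subring_imp_submodule[OF R]
  have mult: "a * b \<in> R" if "a \<in> R" "b \<in> R" for a b using that R by (simp add: subring_of_def)
  have 0: "0 \<in> R" using RR by (simp add: submodule_of_def)
  show ?case
  proof (cases "\<exists>\<phi> \<psi> \<psi>s. \<phi>s = \<phi> # \<psi> # \<psi>s")
    case True
    then obtain \<phi> \<psi> \<psi>s where \<phi>s: "\<phi>s = \<phi> # \<psi> # \<psi>s" by blast
    have "link_elem m n x ks (\<psi> # \<psi>s) Z \<in> R" for Z
      using Cons.prems unfolding \<phi>s by (intro Cons.IH) auto
    then show ?thesis using Cons.prems unfolding \<phi>s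
      by (simp, intro link_product_in[OF RR RR RR _ _ mult]) auto
  next
    case False
    then show ?thesis using 0 by (cases \<phi>s; cases "tl \<phi>s") auto
  qed
qed

text \<open>The sum over \<open>l\<close> is the component at \<open>ks\<close> of the boundary of the product of all the forms in the
  Eagon-Northcott complex; the components are indexed by multisets of row indices, here sorted
  lists. The claim says that the boundary of the product with \<open>\<phi>\<close> is the scalar \<open>minor_form \<phi>\<close> times
  the old product, up to the grade involution and terms that lie in \<open>M\<close>. In the inductive step with \<open>k\<close> the least row index,
  the summands with \<open>l \<le> k\<close> telescope and those with \<open>l > k\<close> contract only the right factor; together
  they are \<open>minor_form \<phi>\<close> times the old product plus a product whose right factor is the boundary for
  the shorter list, so that the induction hypothesis applies to it.\<close>

lemma boundary_link_elem:
  assumes M: "submodule_of R M"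
    and len: "length \<phi>s = Suc (length ks)" and ks: "sorted ks" "set ks \<subseteq> {1..m}" and m: "1 \<le> m"
    and \<phi>s: "\<forall>\<psi>\<in>set (\<phi> # \<phi>s). homog n m \<psi> \<and> (\<forall>Z. \<psi> Z \<in> R)"
    and f: "\<forall>\<psi>\<in>set \<phi>s. minor_form m n x \<psi> \<in> M"
  shows "(\<Sum>l = 1..m. contract n (x l) (link_elem m n x (insort l ks) (\<phi> # \<phi>s)) Z)
    - minor_form m n x \<phi> * invol (link_elem m n x ks \<phi>s) Z \<in> M"
  using len ks \<phi>s f
proof (induction ks arbitrary: \<phi> \<phi>s Z)
  case Nil
  then obtain \<psi> where \<phi>s: "\<phi>s = [\<psi>]" by (cases \<phi>s) auto
  let ?v = "contract n (x m) (lcontracts n x [1..<m] \<psi>)"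
  have \<psi>: "homog n m \<psi>" and \<phi>: "homog n m \<phi>" using Nil \<phi>s by auto
  have "homog n 1 (lcontracts n x [1..<m] \<psi>)" using \<psi> m by (intro homog_lcontracts) simp
  then have "homog n 0 ?v" by (intro homog_contract) simp
  then have v0: "?v Z = 0" if "Z \<noteq> {}" for Z
    using that finite_subset[of Z "{1..n}"] by (auto simp: homog_def)
  have up: "[1..<Suc m] = [1..<m] @ [m]" using m by simp
  have "sign_eq ?v (contract n (x m) (contracts n x [1..<m] \<psi>))"
    by (intro sign_eq_contract sign_eq_lcontracts)
  also have "contract n (x m) (contracts n x [1..<m] \<psi>) = contracts n x [1..<Suc m] \<psi>"
    unfolding up by (simp add: contracts_append)
  finally have "sign_eq ?v (contracts n x [1..<Suc m] \<psi>)" .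
  moreover have "sign_eq (contracts n x [1..<Suc m] \<psi>) (contracts n x (rev [1..<Suc m]) \<psi>)"
    using sign_eq_contracts_rev[of n x "rev [1..<Suc m]" \<psi>] by (simp del: upt_Suc)
  ultimately have "sign_eq ?v (contracts n x (rev [1..<Suc m]) \<psi>)" by (rule sign_eq_trans)
  then obtain s t where "s \<in> {1, -1}" "?v {} = s * t ^ card ({} :: nat set) * minor_form m n x \<psi>"
    unfolding sign_eq_def minor_form_def by meson
  moreover have "s \<in> R" if "s \<in> {1, -1}" for s using that R by (auto simp: subring_of_def)
  ultimately have "?v {} \<in> M" using Nil \<phi>s M by (simp add: submodule_of_def)
  then have v: "?v Z \<in> M" for Z using v0 M by (cases "Z = {}") (auto simp: submodule_of_def)
  have eq: "(\<Sum>l = 1..m. contract n (x l) (link_elem m n x (insort l []) (\<phi> # \<phi>s)) Z)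
      = minor_form m n x \<phi> * invol (link_elem m n x [] \<phi>s) Z + wedge \<phi> ?v Z"
    using contract_link_product_sum[OF \<phi> \<psi> m order_refl, of x Z] by (simp add: \<phi>s)
  have "wedge \<phi> ?v Z \<in> M"
    using Nil.prems v M by (intro wedge_in[OF M, where P = R and Q = M]) (auto simp: submodule_of_def)
  then show ?case unfolding eq by simp
next
  case (Cons k ks)
  then obtain \<psi> \<chi> \<psi>s where \<phi>s: "\<phi>s = \<psi> # \<chi> # \<psi>s"
    by (metis length_Suc_conv length_Cons)
  have k: "1 \<le> k" "k \<le> m" using Cons.prems by auto
  let ?\<Phi> = "contracts n x (rev [Suc k..<Suc m]) \<phi>"
  let ?W = "\<lambda>l. link_elem m n x (insort l ks) \<phi>s"
  let ?t = "\<lambda>l. wedge ?\<Phi> (contract n (x l) (lcontracts n x [1..<k] (?W l))) Z"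
  have Wk: "?W k = link_elem m n x (k # ks) \<phi>s"
    using Cons.prems by (simp add: insort_is_Cons)
  have \<phi>: "homog n m \<phi>" using Cons.prems by auto
  have hW: "homog n (m + length (k # ks)) (?W k)"
    unfolding Wk using Cons.prems by (intro homog_link_elem) auto
  have "(\<Sum>l = 1..m. contract n (x l) (link_elem m n x (insort l (k # ks)) (\<phi> # \<phi>s)) Z)
      = (\<Sum>l = 1..k. contract n (x l) (link_elem m n x (insort l (k # ks)) (\<phi> # \<phi>s)) Z)
        + (\<Sum>l = Suc k..m. contract n (x l) (link_elem m n x (insort l (k # ks)) (\<phi> # \<phi>s)) Z)"
  proof -
    have "{1..m} = {1..k} \<union> {Suc k..m}" using k by auto
    then show ?thesis by (simp add: sum.union_disjoint)
  qed
  also have "(\<Sum>l = 1..k. contract n (x l) (link_elem m n x (insort l (k # ks)) (\<phi> # \<phi>s)) Z)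
      = (\<Sum>l = 1..k. contract n (x l) (link_product m n x l \<phi> (?W k)) Z)"
    unfolding Wk by (intro sum.cong refl) (simp add: \<phi>s)
  also have "\<dots> = minor_form m n x \<phi> * invol (?W k) Z + ?t k"
    by (rule contract_link_product_sum[OF \<phi> hW k])
  also have "(\<Sum>l = Suc k..m. contract n (x l) (link_elem m n x (insort l (k # ks)) (\<phi> # \<phi>s)) Z)
      = (\<Sum>l = Suc k..m. ?t l)"
  proof (intro sum.cong refl)
    fix l assume l: "l \<in> {Suc k..m}"
    then have "contract n (x l) ?\<Phi> = (\<lambda>Z. 0)" by (intro contract_contracts_mem) auto
    then show "contract n (x l) (link_elem m n x (insort l (k # ks)) (\<phi> # \<phi>s)) Z = ?t l"
      using l by (simp add: \<phi>s link_product_def contract_wedge wedge_zero del: upt_Suc)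
  qed
  also have "minor_form m n x \<phi> * invol (?W k) Z + ?t k + (\<Sum>l = Suc k..m. ?t l)
      = minor_form m n x \<phi> * invol (?W k) Z + (\<Sum>l = k..m. ?t l)"
    using k by (simp add: sum.atLeast_Suc_atMost)
  also have "(\<Sum>l = k..m. ?t l) = (\<Sum>l = 1..m. ?t l)"
    using k by (intro sum.mono_neutral_left) (auto simp: contract_lcontracts lcontracts_contract_mem wedge_zero)
  also have "\<dots> = wedge ?\<Phi> (lcontracts n x [1..<k] (\<lambda>Z. \<Sum>l = 1..m. contract n (x l) (?W l) Z)) Z"
    unfolding lcontracts_sum wedge_sum contract_lcontracts ..
  finally have eq: "(\<Sum>l = 1..m. contract n (x l) (link_elem m n x (insort l (k # ks)) (\<phi> # \<phi>s)) Z)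
      - minor_form m n x \<phi> * invol (link_elem m n x (k # ks) \<phi>s) Z
      = wedge ?\<Phi> (lcontracts n x [1..<k] (\<lambda>Z. \<Sum>l = 1..m. contract n (x l) (?W l) Z)) Z"
    by (simp add: Wk)
  have D: "(\<Sum>l = 1..m. contract n (x l) (?W l) Z) \<in> M" for Z
  proof -
    have "(\<Sum>l = 1..m. contract n (x l) (?W l) Z)
        - minor_form m n x \<psi> * invol (link_elem m n x ks (\<chi> # \<psi>s)) Z \<in> M"
      unfolding \<phi>s using Cons.prems \<phi>s by (intro Cons.IH) auto
    moreover have "invol (link_elem m n x ks (\<chi> # \<psi>s)) Z * minor_form m n x \<psi> \<in> M"
    proof -
      have "invol (link_elem m n x ks (\<chi> # \<psi>s)) Z \<in> R"
        using Cons.prems \<phi>s by (intro invol_in subring_imp_submodule[OF R] link_elem_in) auto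
      then show ?thesis using Cons.prems \<phi>s M by (auto simp: submodule_of_def)
    qed
    ultimately have "(\<Sum>l = 1..m. contract n (x l) (?W l) Z)
        - minor_form m n x \<psi> * invol (link_elem m n x ks (\<chi> # \<psi>s)) Z
        + invol (link_elem m n x ks (\<chi> # \<psi>s)) Z * minor_form m n x \<psi> \<in> M"
      using M unfolding submodule_of_def by blast
    then show ?thesis by (simp add: mult.commute)
  qed
  have "?\<Phi> Z \<in> R" for Z
    using Cons.prems by (intro contracts_in subring_imp_submodule[OF R]) auto
  then show ?case unfolding eq
    using M by (intro wedge_in[OF M, where P = R and Q = M] lcontracts_in[OF M] D)
      (auto simp: submodule_of_def)
qed

text \<open>Multiplying by \<open>\<phi>\<close> once more leads to forms of degree \<open>n + 1\<close>, which vanish. Hence the boundary in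
  \<open>boundary_link_elem\<close> is \<open>0\<close>, and the scalar multiple itself lies in \<open>M\<close>.\<close>

lemma minor_form_mult_link_elem:
  assumes M: "submodule_of R M"
    and len: "length \<phi>s = Suc (length ks)" and ks: "sorted ks" "set ks \<subseteq> {1..m}" and m: "1 \<le> m"
    and \<phi>s: "\<forall>\<psi>\<in>set (\<phi> # \<phi>s). homog n m \<psi> \<and> (\<forall>Z. \<psi> Z \<in> R)"
    and f: "\<forall>\<psi>\<in>set \<phi>s. minor_form m n x \<psi> \<in> M"
    and n: "m + length ks = n"
  shows "link_elem m n x ks \<phi>s Z * minor_form m n x \<phi> \<in> M"
proof -
  have "link_elem m n x (insort l ks) (\<phi> # \<phi>s) = (\<lambda>Z. 0)" if "l \<in> {1..m}" for l
  proof -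
    have h: "homog n (m + length (insort l ks)) (link_elem m n x (insort l ks) (\<phi> # \<phi>s))"
      using that ks len \<phi>s by (intro homog_link_elem) (auto simp: set_insort_key)
    have "card Y \<noteq> Suc n" if "Y \<subseteq> {1..n}" for Y
      using card_mono[OF _ that] by auto
    then show ?thesis using h n by (auto simp: homog_def fun_eq_iff)
  qed
  then have "(\<Sum>l = 1..m. contract n (x l) (link_elem m n x (insort l ks) (\<phi> # \<phi>s)) Z) = 0"
    by (intro sum.neutral) (simp add: contract_zero)
  then have "- (minor_form m n x \<phi> * invol (link_elem m n x ks \<phi>s) Z) \<in> M"
    using boundary_link_elem[OF M len ks m \<phi>s f, of Z] by simp
  moreover have "- ((-1) ^ card Z) \<in> R"
    using sign_in_subring(1)[OF R, of "Suc (card Z)"] by simp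
  ultimately have "- ((-1) ^ card Z) * - (minor_form m n x \<phi> * invol (link_elem m n x ks \<phi>s) Z) \<in> M"
    using M unfolding submodule_of_def by blast
  moreover have "(-1) ^ card Z * ((-1) ^ card Z * c) = c" for c :: 'a
    by (simp add: mult.assoc[symmetric] power_mult_distrib[symmetric])
  ultimately show ?thesis by (simp add: invol_def mult_ac)
qed

end

section \<open>Contractions and minors\<close>

definition row_minor :: "(nat \<Rightarrow> nat \<Rightarrow> 'a::comm_ring_1) \<Rightarrow> nat list \<Rightarrow> nat set \<Rightarrow> 'a" where
  "row_minor x is B = det (mat (length is) (card B)
     (\<lambda>(r, c). x (is ! r) (sorted_list_of_set B ! c)))"

text \<open>Laplace expansion along the first row. The sign of the entry in column \<open>j\<close> counts the columns after
  \<open>j\<close> instead of those before \<open>j\<close>, which costs the factor on the left.\<close>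

lemma row_minor_Cons:
  fixes x :: "nat \<Rightarrow> nat \<Rightarrow> 'a::comm_ring_1"
  assumes B: "finite B" "card B = Suc (length is)"
  shows "(-1) ^ length is * row_minor x (i # is) B =
    (\<Sum>j\<in>B. x i j * inv_sign (B - {j}) {j} * row_minor x is (B - {j}))"
proof -
  let ?k = "length is" and ?l = "sorted_list_of_set B"
  let ?M = "mat (Suc ?k) (Suc ?k) (\<lambda>(r, c). x ((i # is) ! r) (?l ! c))"
  have l: "length ?l = Suc ?k" "distinct ?l" "set ?l = B" "sorted ?l" using B by simp_all
  have bij: "bij_betw (\<lambda>c. ?l ! c) {..<Suc ?k} B"
    using bij_betw_nth[of ?l "{..<Suc ?k}" B] l by simp
  have "row_minor x (i # is) B = det ?M" using B by (simp add: row_minor_def)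
  also have "\<dots> = (\<Sum>c<Suc ?k. ?M $$ (0, c) * cofactor ?M 0 c)"
    by (rule laplace_expansion_row) auto
  finally have "(-1) ^ ?k * row_minor x (i # is) B
      = (\<Sum>c<Suc ?k. (-1) ^ ?k * (?M $$ (0, c) * cofactor ?M 0 c))"
    by (simp only: sum_distrib_left)
  also have "\<dots> = (\<Sum>c<Suc ?k. x i (?l ! c) * inv_sign (B - {?l ! c}) {?l ! c}
      * row_minor x is (B - {?l ! c}))"
  proof (intro sum.cong refl)
    fix c assume "c \<in> {..<Suc ?k}"
    then have c: "c < length ?l" and ck: "c \<le> ?k" using l by auto
    let ?j = "?l ! c"
    have split: "?l = take c ?l @ ?j # drop (Suc c) ?l" using c by (rule id_take_nth_drop)
    have j: "?j \<in> B" using c l nth_mem by blast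
    have "?j \<notin> set (take c ?l)"
      using l(2) c by (metis split distinct_append distinct.simps(2) not_distinct_conv_prefix)
    then have rem: "sorted_list_of_set (B - {?j}) = take c ?l @ drop (Suc c) ?l"
      using B(1) split by (metis remove1.simps(2) remove1_append sorted_list_of_set_remove)
    have "set (take c ?l @ drop (Suc c) ?l) = B - {?j}" and disj: "distinct (take c ?l @ drop (Suc c) ?l)"
      using B(1) by (simp_all flip: rem)
    then have set: "B - {?j} = set (take c ?l) \<union> set (drop (Suc c) ?l)" by simp
    have lo: "a < ?j" if "a \<in> set (take c ?l)" for a
    proof -
      from that obtain p where "p < c" "a = ?l ! p" using c by (auto simp: in_set_conv_nth)
      then show ?thesis using l c by (metis less_le less_trans nth_eq_iff_index_eq
          sorted_nth_mono less_imp_le_nat nat_neq_iff)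
    qed
    have hi: "?j < a" if "a \<in> set (drop (Suc c) ?l)" for a
    proof -
      from that obtain p where "p < length (drop (Suc c) ?l)" "a = ?l ! (Suc c + p)"
        by (auto simp: in_set_conv_nth)
      moreover from this have "Suc c + p < length ?l" by simp
      ultimately show ?thesis using l c
        by (metis add_Suc less_add_Suc1 less_imp_le_nat nat_neq_iff nth_eq_iff_index_eq
            order_le_imp_less_or_eq sorted_nth_mono)
    qed
    have "inv_sign (B - {?j}) {?j}
        = (\<Prod>a\<in>set (take c ?l). if ?j < a then -1 else 1) * (\<Prod>a\<in>set (drop (Suc c) ?l). if ?j < a then -1 else (1::'a))"
      unfolding set inv_sign_def using disj by (subst prod.union_disjoint) auto
    also have "(\<Prod>a\<in>set (take c ?l). if ?j < a then -1 else 1) = (1::'a)"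
      using lo by (intro prod.neutral) fastforce
    also have "(\<Prod>a\<in>set (drop (Suc c) ?l). if ?j < a then -1 else (1::'a))
        = (\<Prod>a\<in>set (drop (Suc c) ?l). -1)"
      using hi by (intro prod.cong) auto
    also have "\<dots> = (-1) ^ (?k - c)"
      using distinct_card[of "drop (Suc c) ?l"] l by simp
    finally have sign: "inv_sign (B - {?j}) {?j} = (-1 :: 'a) ^ (?k - c)" by simp
    have "(-1 :: 'a) ^ ?k * (-1) ^ c = (-1) ^ (?k - c) * ((-1) ^ c * (-1) ^ c)"
      using ck by (metis le_add_diff_inverse2 mult.assoc power_add)
    then have pow: "(-1 :: 'a) ^ ?k * (-1) ^ c = (-1) ^ (?k - c)"
      by (simp flip: power_mult_distrib)
    have "mat_delete ?M 0 c = mat ?k (card (B - {?j}))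
        (\<lambda>(r, c'). x (is ! r) (sorted_list_of_set (B - {?j}) ! c'))"
      using j B l c by (intro eq_matI) (auto simp: mat_delete_def rem nth_append)
    then have cof: "cofactor ?M 0 c = (-1) ^ c * row_minor x is (B - {?j})"
      by (simp add: cofactor_def row_minor_def)
    have "(-1) ^ ?k * (?M $$ (0, c) * cofactor ?M 0 c)
        = ((-1) ^ ?k * (-1) ^ c) * (x i ?j * row_minor x is (B - {?j}))"
      using ck by (simp add: cof mult_ac)
    then show "(-1) ^ ?k * (?M $$ (0, c) * cofactor ?M 0 c)
        = x i ?j * inv_sign (B - {?j}) {?j} * row_minor x is (B - {?j})"
      unfolding pow sign by (simp add: mult_ac)
  qed
  also have "\<dots> = (\<Sum>j\<in>B. x i j * inv_sign (B - {j}) {j} * row_minor x is (B - {j}))"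
    by (rule sum.reindex_bij_betw[OF bij])
  finally show ?thesis .
qed

text \<open>Contracting by one row at a time expands a minor along its rows. The remaining index set is an
  initial segment, so removing later columns from the right creates no sign that depends on it; this
  covers both uses, \<open>s = 1\<close> for the maximal minors and general \<open>s\<close> for \<open>link_product_basis\<close>.\<close>

lemma contracts_eq_minors:
  fixes x :: "nat \<Rightarrow> nat \<Rightarrow> 'a::comm_ring_1"
  assumes "1 \<le> s"
  shows "contracts n x is u {1..<s} = (-1) ^ (\<Sum>k<length is. k) *
    (\<Sum>B | B \<subseteq> {s..n} \<and> card B = length is. u ({1..<s} \<union> B) * row_minor x is B)"
proof (induction "is" arbitrary: u)
  case Nil
  have "{B. B \<subseteq> {s..n} \<and> card B = 0} = {{}}"
    using finite_subset[of _ "{s..n}"] by auto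
  then show ?case by (simp add: row_minor_def)
next
  case (Cons i "is")
  let ?k = "length is" and ?Z = "{1..<s}"
  let ?P = "\<lambda>k. {B. B \<subseteq> {s..n} \<and> card B = k}"
  have fin: "finite (?P k)" for k by simp
  have finB: "finite B" if "B \<in> ?P k" for B k using that finite_subset[of B "{s..n}"] by auto
  have "(\<Sum>B\<in>?P ?k. contract n (x i) u (?Z \<union> B) * row_minor x is B)
      = (\<Sum>B\<in>?P ?k. \<Sum>j\<in>{s..n} - B.
          x i j * inv_sign B {j} * u (?Z \<union> insert j B) * row_minor x is B)"
  proof (intro sum.cong refl)
    fix B assume B: "B \<in> ?P ?k"
    have sg: "inv_sign (?Z \<union> B) {j} = (inv_sign B {j} :: 'a)" if "j \<in> {s..n} - B" for j
    proof -
      have "inv_sign (?Z \<union> B) {j} = inv_sign ?Z {j} * (inv_sign B {j} :: 'a)"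
        unfolding inv_sign_def using finB[OF B] B by (intro prod.union_disjoint) auto
      moreover have "inv_sign ?Z {j} = (1 :: 'a)"
        unfolding inv_sign_def using that by (intro prod.neutral) auto
      ultimately show ?thesis by simp
    qed
    have "contract n (x i) u (?Z \<union> B) = (\<Sum>j\<in>{s..n} - B. x i j * interior j u (?Z \<union> B))"
      unfolding contract_def using assms B by (intro sum.mono_neutral_right) (auto simp: interior_def)
    also have "\<dots> = (\<Sum>j\<in>{s..n} - B. x i j * inv_sign B {j} * u (?Z \<union> insert j B))"
    proof (intro sum.cong refl)
      fix j assume j: "j \<in> {s..n} - B"
      then show "x i j * interior j u (?Z \<union> B) = x i j * inv_sign B {j} * u (?Z \<union> insert j B)"
        using finB[OF B] unfolding interior_def sg[OF j] by (auto simp: mult_ac)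
    qed
    finally show "contract n (x i) u (?Z \<union> B) * row_minor x is B = (\<Sum>j\<in>{s..n} - B.
          x i j * inv_sign B {j} * u (?Z \<union> insert j B) * row_minor x is B)"
      by (simp add: sum_distrib_right)
  qed
  also have "\<dots> = (\<Sum>p\<in>Sigma (?P ?k) (\<lambda>B. {s..n} - B). x i (snd p) * inv_sign (fst p) {snd p} *
      u (?Z \<union> insert (snd p) (fst p)) * row_minor x is (fst p))"
    using fin by (subst sum.Sigma) (auto simp: split_beta)
  also have "\<dots> = (\<Sum>p\<in>Sigma (?P (Suc ?k)) (\<lambda>B. B). x i (snd p) * inv_sign (fst p - {snd p}) {snd p} *
      u (?Z \<union> fst p) * row_minor x is (fst p - {snd p}))"
  proof (rule sum.reindex_bij_witness[of _ "\<lambda>(B, j). (B - {j}, j)" "\<lambda>(B, j). (insert j B, j)"])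
    fix p assume "p \<in> Sigma (?P ?k) (\<lambda>B. {s..n} - B)"
    then obtain B j where p: "p = (B, j)" "B \<in> ?P ?k" "j \<in> {s..n}" "j \<notin> B" by (cases p) auto
    have del: "insert j B - {j} = B" using p by auto
    show "(\<lambda>(B, j). (B - {j}, j)) ((\<lambda>(B, j). (insert j B, j)) p) = p"
      using p del by simp
    show "(\<lambda>(B, j). (insert j B, j)) p \<in> Sigma (?P (Suc ?k)) (\<lambda>B. B)"
      using p finB[of B] by auto
    show "x i (snd ((\<lambda>(B, j). (insert j B, j)) p)) *
        inv_sign (fst ((\<lambda>(B, j). (insert j B, j)) p) - {snd ((\<lambda>(B, j). (insert j B, j)) p)})
          {snd ((\<lambda>(B, j). (insert j B, j)) p)} *
        u (?Z \<union> fst ((\<lambda>(B, j). (insert j B, j)) p)) *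
        row_minor x is (fst ((\<lambda>(B, j). (insert j B, j)) p) - {snd ((\<lambda>(B, j). (insert j B, j)) p)})
        = x i (snd p) * inv_sign (fst p) {snd p} *
        u (?Z \<union> insert (snd p) (fst p)) * row_minor x is (fst p)"
      unfolding p(1) by (simp only: split_conv fst_conv snd_conv del)
  next
    fix p assume "p \<in> Sigma (?P (Suc ?k)) (\<lambda>B. B)"
    then obtain B j where p: "p = (B, j)" "B \<in> ?P (Suc ?k)" "j \<in> B" by (cases p) auto
    show "(\<lambda>(B, j). (insert j B, j)) ((\<lambda>(B, j). (B - {j}, j)) p) = p"
      using p by auto
    show "(\<lambda>(B, j). (B - {j}, j)) p \<in> Sigma (?P ?k) (\<lambda>B. {s..n} - B)"
      using p finB[of B] by auto
  qed
  also have "\<dots> = (\<Sum>B\<in>?P (Suc ?k). \<Sum>j\<in>B. x i j * inv_sign (B - {j}) {j} *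
      u (?Z \<union> B) * row_minor x is (B - {j}))"
  proof -
    have "\<forall>B\<in>?P (Suc ?k). finite B" using finB by blast
    then show ?thesis by (subst sum.Sigma[OF fin]) (simp_all only: case_prod_unfold)
  qed
  also have "\<dots> = (\<Sum>B\<in>?P (Suc ?k). u (?Z \<union> B) * ((-1) ^ ?k * row_minor x (i # is) B))"
  proof (intro sum.cong refl)
    fix B assume B: "B \<in> ?P (Suc ?k)"
    then show "(\<Sum>j\<in>B. x i j * inv_sign (B - {j}) {j} * u (?Z \<union> B) * row_minor x is (B - {j}))
        = u (?Z \<union> B) * ((-1) ^ ?k * row_minor x (i # is) B)"
      using row_minor_Cons[OF finB[OF B], of "is" x i] by (simp add: sum_distrib_left mult_ac)
  qed
  also have "\<dots> = (-1) ^ ?k * (\<Sum>B\<in>?P (Suc ?k). u (?Z \<union> B) * row_minor x (i # is) B)"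
    by (simp add: sum_distrib_left mult_ac)
  finally show ?case using Cons by (simp add: power_add mult_ac)
qed


lemma minor_form_eq:
  fixes x :: "nat \<Rightarrow> nat \<Rightarrow> 'a::comm_ring_1"
  shows "\<exists>s\<in>{1, -1}. minor_form m n x \<phi> =
    s * (\<Sum>B | B \<subseteq> {1..n} \<and> card B = m. \<phi> B * row_minor x [1..<Suc m] B)"
proof -
  obtain s t where st: "s \<in> {1, -1 :: 'a}" "t \<in> {1, -1 :: 'a}"
    "\<And>Z. contracts n x (rev [1..<Suc m]) \<phi> Z = s * t ^ card Z * contracts n x [1..<Suc m] \<phi> Z"
    using sign_eq_contracts_rev[of n x "[1..<Suc m]" \<phi>] unfolding sign_eq_def by metis
  let ?e = "(-1 :: 'a) ^ (\<Sum>k<length [1..<Suc m]. k)"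
  have "minor_form m n x \<phi> = s * contracts n x [1..<Suc m] \<phi> {1..<1}"
    using st(3)[of "{}"] by (simp add: minor_form_def del: upt_Suc)
  also have "\<dots> = s * ?e * (\<Sum>B | B \<subseteq> {1..n} \<and> card B = m. \<phi> B * row_minor x [1..<Suc m] B)"
    by (subst contracts_eq_minors) (simp_all add: mult_ac del: upt_Suc)
  finally have "minor_form m n x \<phi> = s * ?e *
    (\<Sum>B | B \<subseteq> {1..n} \<and> card B = m. \<phi> B * row_minor x [1..<Suc m] B)" .
  moreover have "?e \<in> {1, -1}"
    by (cases "even (\<Sum>k<length [1..<Suc m]. k)") (simp_all del: upt_Suc)
  ultimately show ?thesis using st(1) by (intro bexI[of _ "s * ?e"]) auto
qed

lemma homog_sign_eq:
  fixes u v :: "nat set \<Rightarrow> 'a::comm_ring_1"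
  assumes "sign_eq u v" "homog a d v"
  shows "\<exists>s\<in>{1, -1}. \<forall>Z. u Z = s * v Z"
proof -
  obtain s t where st: "s \<in> {1, -1}" "t \<in> {1, -1}" "\<And>Z. u Z = s * t ^ card Z * v Z"
    using assms unfolding sign_eq_def by metis
  have "u Z = (s * t ^ d) * v Z" for Z
    using assms(2) st(3)[of Z] by (cases "v Z = 0") (auto simp: homog_def)
  moreover have "s * t ^ d \<in> {1, -1}"
    using st(1,2) by (cases "even d") auto
  ultimately show ?thesis by blast
qed

text \<open>Contractions can be moved from one factor to the other if the degrees are large: before the last
  contraction the product has degree greater than \<open>a\<close>, so it vanishes, and the antiderivation rule
  applied to this zero exchanges the factor that is contracted.\<close>

lemma wedge_contracts_transfer:
  fixes \<phi> v :: "nat set \<Rightarrow> 'a::comm_ring_1"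
  assumes "homog a p \<phi>" "homog a q v" "p + q = a + length is"
    "length is \<le> p" "length is \<le> q"
  shows "\<exists>s\<in>{1, -1}. \<forall>Z. wedge (contracts n x is \<phi>) v Z = s * wedge \<phi> (contracts n x (rev is) v) Z"
  using assms
proof (induction "is" arbitrary: \<phi> p)
  case (Cons i "is")
  let ?w = "contracts n x (rev is) v"
  obtain p' where p: "p = Suc p'" using Cons.prems by (cases p) auto
  have "homog a p' (contract n (x i) \<phi>)" using Cons.prems p by (intro homog_contract) simp
  then have "\<exists>s\<in>{1, -1}. \<forall>Z. wedge (contracts n x is (contract n (x i) \<phi>)) v Z
      = s * wedge (contract n (x i) \<phi>) ?w Z"
    using Cons.prems p by (intro Cons.IH[of p']) auto
  then obtain s where s: "s \<in> {1, -1 :: 'a}"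
    "\<forall>Z. wedge (contracts n x is (contract n (x i) \<phi>)) v Z = s * wedge (contract n (x i) \<phi>) ?w Z"
    by blast
  have w: "homog a (Suc (q - length (i # is))) ?w"
    using Cons.prems by (intro homog_contracts) (simp add: Suc_diff_Suc)
  then have iw: "homog a (Suc (q - length (i # is))) (invol ?w)"
    unfolding homog_def invol_def by (metis mult_zero_right)
  have deg: "p + Suc (q - length (i # is)) = Suc a" using Cons.prems by simp
  have "homog a (Suc a) (wedge \<phi> (invol ?w))"
    using homog_wedge[OF Cons.prems(1) iw] unfolding deg .
  moreover have "card Z \<noteq> Suc a" if "Z \<subseteq> {1..a}" for Z
    using card_mono[OF _ that] by auto
  ultimately have "wedge \<phi> (invol ?w) = (\<lambda>Z. 0)" by (auto simp: homog_def fun_eq_iff)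
  then have "wedge (contract n (x i) \<phi>) ?w Z = - wedge \<phi> (contract n (x i) (invol ?w)) Z" for Z
    using contract_wedge[of n "x i" \<phi> "invol ?w" Z]
    by (simp add: contract_zero invol_invol eq_neg_iff_add_eq_0 add.commute)
  also have "- wedge \<phi> (contract n (x i) (invol ?w)) Z
      = (-1) ^ (q - length (i # is)) * wedge \<phi> (contract n (x i) ?w) Z" for Z
  proof -
    have "contract n (x i) (invol ?w) Z = - ((-1) ^ (q - length (i # is)) * contract n (x i) ?w Z)" for Z
      using homog_contract[OF w, of n "x i"] unfolding contract_invol invol_def homog_def
      by (cases "contract n (x i) ?w Z = 0") auto
    then show ?thesis by (simp add: wedge_def sum_negf sum_distrib_left mult_ac)
  qed
  finally have "wedge (contracts n x (i # is) \<phi>) v Z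
      = (s * (-1) ^ (q - length (i # is))) * wedge \<phi> (contracts n x (rev (i # is)) v) Z" for Z
    using s(2) by (simp add: contracts_append mult_ac)
  moreover have "s * (-1) ^ (q - length (i # is)) \<in> {1, -1}"
    using s(1) by (cases "even (q - length (i # is))") auto
  ultimately show ?case by blast
qed (auto intro: bexI[of _ 1])

definition basis_ext :: "'a::comm_ring_1 \<Rightarrow> nat set \<Rightarrow> nat set \<Rightarrow> 'a" where
  "basis_ext c A Z = (if Z = A then c else 0)"

lemma homog_basis_ext: "A \<subseteq> {1..n} \<Longrightarrow> card A = d \<Longrightarrow> homog n d (basis_ext c A)"
  by (simp add: homog_def basis_ext_def)

text \<open>All contractions are transferred to the right factor. In degree \<open>a\<close> only the coefficient at
  \<open>{1..a}\<close> survives; there the left factor takes the indices from \<open>s\<close> on, and contracting the right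
  factor down to \<open>{1..<s}\<close> by all rows other than \<open>k\<close> gives the minor.\<close>

lemma link_product_basis:
  fixes x :: "nat \<Rightarrow> nat \<Rightarrow> 'a::comm_ring_1"
  assumes "1 \<le> s" "1 \<le> k" "k \<le> m" "Suc a = s + m" "a \<le> n"
  shows "\<exists>t\<in>{1, -1}. link_product m n x k (basis_ext d {s..a}) (basis_ext c {1..<a}) =
    basis_ext (t * d * c * row_minor x ([1..<k] @ [Suc k..<Suc m]) {s..<a}) {1..a}"
proof -
  let ?\<phi> = "basis_ext d {s..a}" and ?u = "basis_ext c {1..<a}"
  let ?U = "lcontracts n x [1..<k] ?u" and ?js = "[Suc k..<Suc m]"
  let ?w = "contracts n x ?js ?U" and ?w' = "contracts n x ([1..<k] @ ?js) ?u"
  have \<phi>: "homog a m ?\<phi>" using assms by (intro homog_basis_ext) auto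
  have u: "homog a (length [1..<k] + (a - k)) ?u" using assms by (intro homog_basis_ext) auto
  then have U: "homog a (a - k) ?U" by (rule homog_lcontracts)
  have "m + (a - k) = a + length (rev ?js)" "length (rev ?js) \<le> m" "length (rev ?js) \<le> a - k"
    using assms by (simp_all del: upt_Suc)
  from wedge_contracts_transfer[OF \<phi> U this, of n x] obtain t1 where t1: "t1 \<in> {1, -1 :: 'a}"
    "\<And>Z. link_product m n x k ?\<phi> ?u Z = t1 * wedge ?\<phi> ?w Z"
    unfolding link_product_def rev_rev_ident by blast
  have "sign_eq ?w ?w'"
    unfolding contracts_append by (intro sign_eq_contracts sign_eq_lcontracts)
  moreover have "homog a (a - m) ?w'"
    using assms by (intro homog_contracts homog_basis_ext) (auto simp del: upt_Suc)
  ultimately obtain t2 where t2: "t2 \<in> {1, -1}" "\<And>Z. ?w Z = t2 * ?w' Z"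
    using homog_sign_eq by metis
  define t3 :: 'a where "t3 = (-1) ^ (\<Sum>k<length ([1..<k] @ ?js). k)"
  have len: "length ([1..<k] @ ?js) = m - 1" using assms by (simp del: upt_Suc)
  have "?w' {1..<s} = t3 * (\<Sum>B | B \<subseteq> {s..n} \<and> card B = m - 1.
      ?u ({1..<s} \<union> B) * row_minor x ([1..<k] @ ?js) B)"
    unfolding contracts_eq_minors[OF assms(1)] len t3_def ..
  also have "(\<Sum>B | B \<subseteq> {s..n} \<and> card B = m - 1.
      ?u ({1..<s} \<union> B) * row_minor x ([1..<k] @ ?js) B)
      = (\<Sum>B\<in>{{s..<a}}. ?u ({1..<s} \<union> B) * row_minor x ([1..<k] @ ?js) B)"
  proof (intro sum.mono_neutral_right ballI)
    show "{{s..<a}} \<subseteq> {B. B \<subseteq> {s..n} \<and> card B = m - 1}" using assms by auto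
    fix B assume B: "B \<in> {B. B \<subseteq> {s..n} \<and> card B = m - 1} - {{s..<a}}"
    have "{1..<s} \<union> B \<noteq> {1..<a}"
    proof
      assume eq: "{1..<s} \<union> B = {1..<a}"
      have "B = ({1..<s} \<union> B) - {1..<s}" using B by auto
      also have "\<dots> = {s..<a}" unfolding eq using assms by auto
      finally show False using B by simp
    qed
    then show "?u ({1..<s} \<union> B) * row_minor x ([1..<k] @ ?js) B = 0" by (simp add: basis_ext_def)
  qed simp
  also have "\<dots> = c * row_minor x ([1..<k] @ ?js) {s..<a}"
  proof -
    have "{1..<s} \<union> {s..<a} = {1..<a}" using assms by auto
    then show ?thesis by (simp add: basis_ext_def)
  qed
  finally have w': "?w' {1..<s} = t3 * (c * row_minor x ([1..<k] @ ?js) {s..<a})" .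
  have comp: "{1..a} - {s..a} = {1..<s}" using assms by auto
  have "wedge ?\<phi> ?w {1..a} = (\<Sum>A\<in>{{s..a}}. inv_sign A ({1..a} - A) * ?\<phi> A * ?w ({1..a} - A))"
    unfolding wedge_def using assms
    by (intro sum.mono_neutral_right) (auto simp: basis_ext_def)
  then have top: "wedge ?\<phi> ?w {1..a} = inv_sign {s..a} {1..<s} * d * ?w {1..<s}"
    using comp by (simp add: basis_ext_def del: upt_Suc)
  have inv: "inv_sign {s..a} {1..<s} \<in> {1, -1 :: 'a}"
  proof -
    have P: "(\<Prod>a\<in>A. f a) \<in> {1, -1 :: 'a}" if "\<And>a. a \<in> A \<Longrightarrow> f a \<in> {1, -1}" for A :: "nat set" and f
      using that by (induction A rule: infinite_finite_induct) fastforce+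
    show ?thesis unfolding inv_sign_def by (intro P) simp
  qed
  let ?t = "t1 * inv_sign {s..a} {1..<s} * t2 * t3"
  have "t3 \<in> {1, -1}"
    unfolding t3_def by (cases "even (\<Sum>k<length ([1..<k] @ ?js). k)") (simp_all del: upt_Suc)
  then have t: "?t \<in> {1, -1}" using t1(1) t2(1) inv by auto
  have h: "homog a a (link_product m n x k ?\<phi> ?u)"
  proof -
    have "homog a k (contracts n x (rev ?js) ?\<phi>)"
      using \<phi> assms by (intro homog_contracts) (simp del: upt_Suc)
    then show ?thesis using homog_wedge[OF _ U] assms unfolding link_product_def by fastforce
  qed
  have "link_product m n x k ?\<phi> ?u Z
      = basis_ext (?t * d * c * row_minor x ([1..<k] @ ?js) {s..<a}) {1..a} Z" for Z
  proof (cases "Z = {1..a}")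
    case True
    then show ?thesis using t1(2) t2(2) w' top by (simp add: basis_ext_def mult_ac del: upt_Suc)
  next
    case False
    have "\<not> (Z \<subseteq> {1..a} \<and> card Z = a)"
      using False card_subset_eq[of "{1..a}" Z] by auto
    then show ?thesis using h False unfolding homog_def by (auto simp: basis_ext_def)
  qed
  then show ?thesis using t by blast
qed

lemma wedge_add_left: "wedge (\<lambda>Z. u Z + v Z) w = (\<lambda>Z. wedge u w Z + wedge v w Z)"
  by (simp add: wedge_def fun_eq_iff sum.distrib algebra_simps)

lemma wedge_add_right: "wedge w (\<lambda>Z. u Z + v Z) = (\<lambda>Z. wedge w u Z + wedge w v Z)"
  by (simp add: wedge_def fun_eq_iff sum.distrib algebra_simps)

lemma lcontract_add: "lcontract n x (\<lambda>Z. u Z + v Z) = (\<lambda>Z. lcontract n x u Z + lcontract n x v Z)"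
  by (simp add: lcontract_def invol_def contract_add fun_eq_iff algebra_simps)

lemma contracts_add: "contracts n x is (\<lambda>Z. u Z + v Z) = (\<lambda>Z. contracts n x is u Z + contracts n x is v Z)"
  by (induction "is" arbitrary: u v) (simp_all add: contract_add)

lemma lcontracts_add: "lcontracts n x is (\<lambda>Z. u Z + v Z) = (\<lambda>Z. lcontracts n x is u Z + lcontracts n x is v Z)"
  by (induction "is" arbitrary: u v) (simp_all add: lcontract_add)

lemma link_product_add_left:
  "link_product m n x k (\<lambda>Z. \<phi> Z + \<psi> Z) u = (\<lambda>Z. link_product m n x k \<phi> u Z + link_product m n x k \<psi> u Z)"
  by (simp add: link_product_def contracts_add wedge_add_left)

lemma link_product_add_right:
  "link_product m n x k \<phi> (\<lambda>Z. u Z + v Z) = (\<lambda>Z. link_product m n x k \<phi> u Z + link_product m n x k \<phi> v Z)"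
  by (simp add: link_product_def lcontracts_add wedge_add_right)


section \<open>Polynomial rings and lead monomials\<close>

abbreviation (input) lookup :: "('a \<Rightarrow>\<^sub>0 'b::zero) \<Rightarrow> 'a \<Rightarrow> 'b" where
  "lookup \<equiv> Poly_Mapping.lookup"

abbreviation (input) keys :: "('a \<Rightarrow>\<^sub>0 'b::zero) \<Rightarrow> 'a set" where
  "keys \<equiv> Poly_Mapping.keys"

abbreviation (input) single :: "'a \<Rightarrow> 'b::zero \<Rightarrow> 'a \<Rightarrow>\<^sub>0 'b" where
  "single \<equiv> Poly_Mapping.single"

abbreviation (input) polys :: "indet set \<Rightarrow> 'k::field mpoly set" where
  "polys V \<equiv> carrier (poly_ring V)"

lemma carrier_poly_ring: "p \<in> polys V \<longleftrightarrow> keys p \<subseteq> monomials V"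
  by (simp add: poly_ring_def)

lemma poly_ring_simps [simp]:
  "x \<otimes>\<^bsub>poly_ring V\<^esub> y = x * y" "x \<oplus>\<^bsub>poly_ring V\<^esub> y = x + y"
  "\<zero>\<^bsub>poly_ring V\<^esub> = 0" "\<one>\<^bsub>poly_ring V\<^esub> = 1"
  by (simp_all add: poly_ring_def)

lemma poly_ring_uminus [simp]:
  "p \<in> polys V \<Longrightarrow> - p \<in> polys V"
  by (simp add: carrier_poly_ring)

lemma poly_ring_closed [simp]:
  fixes p q :: "'k::field mpoly"
  assumes "p \<in> polys V" "q \<in> polys V"
  shows "p + q \<in> polys V" "p * q \<in> polys V"
    "p - q \<in> polys V"
proof -
  interpret cring "poly_ring V :: 'k mpoly ring" by (rule cring_poly_ring)
  show "p + q \<in> polys V" "p * q \<in> polys V"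
    using a_closed[OF assms] m_closed[OF assms] by simp_all
  show "p - q \<in> polys V"
    using a_closed[OF assms(1) poly_ring_uminus[OF assms(2)]] by simp
qed

lemma poly_ring_zero_one [simp]:
  "0 \<in> polys V" "1 \<in> polys V"
  by (simp_all add: carrier_poly_ring zero_in_monomials)

lemma single_in_poly_ring [simp]: "u \<in> monomials V \<Longrightarrow> single u c \<in> polys V"
  by (simp add: carrier_poly_ring)

lemma sum_in_poly_ring:
  fixes f :: "'a \<Rightarrow> 'k::field mpoly"
  shows "(\<And>i. i \<in> A \<Longrightarrow> f i \<in> polys V) \<Longrightarrow> sum f A \<in> polys V"
  by (induction A rule: infinite_finite_induct) auto

text \<open>Multiplication by the scalar \<open>- 1\<close> provides closure under negation.\<close>

lemma ideal_poly_ring_iff: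
  "ideal I (poly_ring V :: 'k::field mpoly ring) \<longleftrightarrow> I \<subseteq> polys V \<and> 0 \<in> I \<and>
    (\<forall>p\<in>I. \<forall>q\<in>I. p + q \<in> I) \<and> (\<forall>p\<in>I. \<forall>q\<in>polys V. q * p \<in> I)"
  (is "?L \<longleftrightarrow> ?R")
proof
  assume ?L
  then interpret ideal I "poly_ring V :: 'k mpoly ring" .
  show ?R
    using a_subset I_l_closed additive_subgroup.zero_closed[OF is_additive_subgroup]
      additive_subgroup.a_closed[OF is_additive_subgroup] by auto
next
  assume R: ?R
  interpret cring "poly_ring V :: 'k mpoly ring" by (rule cring_poly_ring)
  have neg: "- p \<in> I" if "p \<in> I" for p
    using R that poly_ring_uminus[OF poly_ring_zero_one(2), of V] by (metis mult_minus1)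
  show ?L
  proof (rule idealI)
    show "ring (poly_ring V :: 'k mpoly ring)" by (rule ring_axioms)
    show "subgroup I (add_monoid (poly_ring V :: 'k mpoly ring))"
    proof (rule add.subgroupI)
      fix a assume a: "a \<in> I"
      then have "a \<in> polys V" using R by auto
      then have "\<ominus>\<^bsub>poly_ring V\<^esub> a = - a"
        by (intro minus_equality) auto
      then show "\<ominus>\<^bsub>poly_ring V\<^esub> a \<in> I" using neg[OF a] by simp
    qed (use R in auto)
  qed (use R in \<open>auto simp: mult.commute\<close>)
qed

lemma ideal_poly_ringD:
  fixes I :: "'k::field mpoly set"
  assumes "ideal I (poly_ring V)"
  shows "I \<subseteq> polys V" "0 \<in> I" "p \<in> I \<Longrightarrow> q \<in> I \<Longrightarrow> p + q \<in> I"
    "p \<in> I \<Longrightarrow> q \<in> polys V \<Longrightarrow> q * p \<in> I" "p \<in> I \<Longrightarrow> q \<in> I \<Longrightarrow> p - q \<in> I"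
proof -
  show *: "I \<subseteq> polys V" "0 \<in> I" "p \<in> I \<Longrightarrow> q \<in> I \<Longrightarrow> p + q \<in> I" 
    "p \<in> I \<Longrightarrow> q \<in> polys V \<Longrightarrow> q * p \<in> I" for p q
    using assms unfolding ideal_poly_ring_iff by blast+
  have "- 1 \<in> carrier (poly_ring V :: 'k mpoly ring)" by simp
  then show "p - q \<in> I" if "p \<in> I" "q \<in> I"
    using *(3)[OF that(1) *(4)[OF that(2), of "-1"]] by simp
qed

lemma
  fixes S :: "'k::field mpoly set"
  assumes "S \<subseteq> polys V"
  shows ideal_Idl: "ideal (Idl\<^bsub>poly_ring V\<^esub> S) (poly_ring V)"
    and subset_Idl: "S \<subseteq> Idl\<^bsub>poly_ring V\<^esub> S"
proof -
  interpret cring "poly_ring V :: 'k mpoly ring" by (rule cring_poly_ring)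
  show "ideal (Idl\<^bsub>poly_ring V\<^esub> S) (poly_ring V)" "S \<subseteq> Idl\<^bsub>poly_ring V\<^esub> S"
    by (rule genideal_ideal[OF assms] genideal_self[OF assms])+
qed

lemma Idl_minimal:
  fixes S :: "'k::field mpoly set"
  shows "ideal I (poly_ring V) \<Longrightarrow> S \<subseteq> I \<Longrightarrow> Idl\<^bsub>poly_ring V\<^esub> S \<subseteq> I"
  unfolding genideal_def by blast

lemma mon_dvd_iff: "mon_dvd u v \<longleftrightarrow> (\<forall>x. lookup u x \<le> lookup v x)"
proof
  assume "\<forall>x. lookup u x \<le> lookup v x"
  then have "v = u + (v - u)" by (intro poly_mapping_eqI) (simp add: lookup_add lookup_minus)
  then show "mon_dvd u v" unfolding mon_dvd_def by blast
qed (auto simp: mon_dvd_def lookup_add)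

lemma mon_dvd_add_left: "mon_dvd v (u + v)"
  by (simp add: mon_dvd_iff lookup_add)

lemma mon_dvd_refl: "mon_dvd u u"
  and mon_dvd_trans: "mon_dvd u v \<Longrightarrow> mon_dvd v w \<Longrightarrow> mon_dvd u w"
  and mon_dvd_antisym: "mon_dvd u v \<Longrightarrow> mon_dvd v u \<Longrightarrow> u = v"
  by (auto simp: mon_dvd_iff intro: order_trans intro!: poly_mapping_eqI antisym)

lemma add_in_monomials_iff: "u + v \<in> monomials V \<longleftrightarrow> u \<in> monomials V \<and> v \<in> monomials V"
proof -
  have "keys (u + v) = keys u \<union> keys v"
    by (auto simp: in_keys_iff lookup_add)
  then show ?thesis by (simp add: monomials_def)
qed

text \<open>An ideal generated by nonzero multiples of monomials contains a polynomial iff each of its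
  monomials is divisible by a generator. The coefficients are arbitrary, so that the lemma covers
  both initial terms and monic monomials.\<close>

lemma Idl_monomials:
  fixes S :: "'k::field mpoly set"
  assumes "\<And>p. p \<in> S \<Longrightarrow> \<exists>u\<in>monomials V. \<exists>c. c \<noteq> 0 \<and> p = single u c"
  shows "Idl\<^bsub>poly_ring V\<^esub> S =
    {p \<in> polys V. \<forall>u\<in>keys p. \<exists>v c. c \<noteq> 0 \<and> single v c \<in> S \<and> mon_dvd v u}"
    (is "_ = ?I")
proof
  have S: "S \<subseteq> polys V" using assms single_in_poly_ring by fast
  have "ideal ?I (poly_ring V)"
    unfolding ideal_poly_ring_iff
  proof (intro conjI ballI)
    fix p q assume "p \<in> ?I" "q \<in> ?I"
    then show "p + q \<in> ?I" using keys_add[of p q] by auto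
  next
    fix p q :: "'k mpoly" assume p: "p \<in> ?I" and q: "q \<in> polys V"
    have "\<exists>v c. c \<noteq> 0 \<and> single v c \<in> S \<and> mon_dvd v u"
      if u: "u \<in> keys (q * p)" for u
    proof -
      obtain a b where "u = a + b" "b \<in> keys p" using keys_mult[of q p] u by blast
      then obtain v c where v: "c \<noteq> 0" "single v c \<in> S" "mon_dvd v b"
        using p by blast
      have "mon_dvd v u" using v(3) unfolding \<open>u = a + b\<close> mon_dvd_iff lookup_add
        by (simp add: trans_le_add2)
      then show ?thesis using v by blast
    qed
    then show "q * p \<in> ?I" using p q by auto
  qed auto
  moreover have "S \<subseteq> ?I"
  proof
    fix p assume p: "p \<in> S"
    then obtain u c where "u \<in> monomials V" "c \<noteq> 0" "p = single u c"
      using assms by blast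
    then show "p \<in> ?I" using p S mon_dvd_refl by auto
  qed
  ultimately show "Idl\<^bsub>poly_ring V\<^esub> S \<subseteq> ?I" by (rule Idl_minimal)
  note Idl = ideal_poly_ringD[OF ideal_Idl[OF S]]
  have "single u d \<in> Idl\<^bsub>poly_ring V\<^esub> S"
    if uv: "u \<in> monomials V" "c \<noteq> 0" "single v c \<in> S" "mon_dvd v u" for u v d c
  proof -
    obtain w where w: "u = v + w" using uv(4) by (auto simp: mon_dvd_def)
    then have "single w (d / c) \<in> polys V"
      using uv(1) by (simp add: add_in_monomials_iff)
    then have "single w (d / c) * single v c \<in> Idl\<^bsub>poly_ring V\<^esub> S"
      using uv subset_Idl[OF S] by (intro Idl(4)) auto
    then show ?thesis using uv(2) by (simp add: mult_single w add.commute)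
  qed
  moreover have "(\<Sum>u\<in>A. f u) \<in> Idl\<^bsub>poly_ring V\<^esub> S"
    if "\<And>u. u \<in> A \<Longrightarrow> f u \<in> Idl\<^bsub>poly_ring V\<^esub> S" for A :: "mon set" and f
    using that by (induction A rule: infinite_finite_induct) (auto intro: Idl)
  moreover have "p = (\<Sum>u\<in>keys p. single u (lookup p u))"
    for p :: "'k mpoly"
    by (intro poly_mapping_eqI)
      (simp add: lookup_sum lookup_single when_def in_keys_iff sum.delta' if_distrib cong: if_cong)
  ultimately show "?I \<subseteq> Idl\<^bsub>poly_ring V\<^esub> S"
    by (smt (verit, best) carrier_poly_ring mem_Collect_eq subset_iff)
qed

lemma ex_mono_subseq: "\<exists>r :: nat \<Rightarrow> nat. strict_mono r \<and> mono (\<lambda>i. f (r i) :: nat)"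
proof -
  obtain g :: "nat \<Rightarrow> nat" where g: "strict_mono g" "monoseq (\<lambda>i. f (g i))"
    using seq_monosub by blast
  show ?thesis
  proof (cases "incseq (\<lambda>i. f (g i))")
    case False
    then have dec: "decseq (\<lambda>i. f (g i))" using g monoseq_iff by blast
    obtain N where N: "\<And>i. f (g N) \<le> f (g i)"
      using ex_has_least_nat[of "\<lambda>_. True" 0 "\<lambda>i. f (g i)"] by auto
    have "f (g (N + i)) = f (g N)" for i
      using N decseqD[OF dec, of N "N + i"] by (simp add: antisym)
    then have "mono (\<lambda>i. f (g (N + i)))" by (simp add: mono_def)
    moreover have "strict_mono (\<lambda>i. g (N + i))" using g(1) by (simp add: strict_mono_def)
    ultimately show ?thesis by blast
  qed (use g in blast)
qed

text \<open>One variable at a time, each sequence of exponents has a monotone subsequence.\<close>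

lemma Dickson:
  fixes s :: "nat \<Rightarrow> mon"
  assumes "finite V"
  shows "\<exists>r :: nat \<Rightarrow> nat. strict_mono r \<and> (\<forall>x\<in>V. mono (\<lambda>i. lookup (s (r i)) x))"
  using assms
proof (induction V)
  case empty
  then show ?case by (intro exI[of _ id]) (auto simp: strict_mono_def)
next
  case (insert x V)
  then obtain r :: "nat \<Rightarrow> nat" where r: "strict_mono r" "\<forall>x\<in>V. mono (\<lambda>i. lookup (s (r i)) x)" by blast
  obtain t :: "nat \<Rightarrow> nat" where t: "strict_mono t" "mono (\<lambda>i. lookup (s (r (t i))) x)"
    using ex_mono_subseq[of "\<lambda>i. lookup (s (r i)) x"] by blast
  have "mono (\<lambda>i. lookup (s (r (t i))) y)" if "y \<in> V" for y
    using r(2) that strict_mono_mono[OF t(1)] by (simp add: mono_def)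
  moreover have "strict_mono (\<lambda>i. r (t i))" using r t by (simp add: strict_mono_def)
  ultimately show ?case using t(2) by (intro exI[of _ "\<lambda>i. r (t i)"]) auto
qed

context
  fixes V :: "indet set" and lt :: "mon \<Rightarrow> mon \<Rightarrow> bool"
  assumes lt: "term_order_on V lt"
begin

lemma lt_irrefl: "u \<in> monomials V \<Longrightarrow> \<not> lt u u"
  and lt_trans: "\<lbrakk>lt u v; lt v w; u \<in> monomials V; v \<in> monomials V; w \<in> monomials V\<rbrakk> \<Longrightarrow> lt u w"
  and lt_total: "\<lbrakk>u \<in> monomials V; v \<in> monomials V; u \<noteq> v\<rbrakk> \<Longrightarrow> lt u v \<or> lt v u"
  and lt_pos: "\<lbrakk>u \<in> monomials V; u \<noteq> 0\<rbrakk> \<Longrightarrow> lt 0 u"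
  and lt_add: "\<lbrakk>lt u v; u \<in> monomials V; v \<in> monomials V; w \<in> monomials V\<rbrakk> \<Longrightarrow> lt (u + w) (v + w)"
  using lt unfolding term_order_on_def irreflp_on_def transp_on_def totalp_on_def by blast+

lemma mon_dvd_imp_le:
  assumes "mon_dvd u v" "v \<in> monomials V" shows "u = v \<or> lt u v"
proof -
  obtain w where w: "v = u + w" using assms by (auto simp: mon_dvd_def)
  then have "u \<in> monomials V" "w \<in> monomials V" using assms by (auto simp: add_in_monomials_iff)
  then show ?thesis
    using lt_add[OF lt_pos, of w u] w zero_in_monomials by (cases "w = 0") (auto simp: add.commute)
qed

text \<open>In an infinite descending chain some member divides a later one and is therefore not greater.\<close>

lemma wf_term_order:
  assumes "finite V"
  shows "wf {(u, v). u \<in> monomials V \<and> v \<in> monomials V \<and> lt u v}"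
  unfolding wf_iff_no_infinite_down_chain
proof
  assume "\<exists>s. \<forall>i. (s (Suc i), s i) \<in> {(u, v). u \<in> monomials V \<and> v \<in> monomials V \<and> lt u v}"
  then obtain s where s: "\<And>i. s i \<in> monomials V" "\<And>i. lt (s (Suc i)) (s i)" by auto
  have dec: "lt (s j) (s i)" if "i < j" for i j
    using that by (induction rule: strict_inc_induct) (use s lt_trans in blast)+
  obtain r :: "nat \<Rightarrow> nat" where r: "strict_mono r" "\<forall>x\<in>V. mono (\<lambda>i. lookup (s (r i)) x)"
    using Dickson[OF assms] by blast
  have "lookup (s (r 0)) x \<le> lookup (s (r 1)) x" for x
  proof (cases "x \<in> V")
    case True
    then show ?thesis using r(2) by (auto simp: mono_def)
  next
    case False
    then have "lookup (s (r 0)) x = 0"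
      using s(1)[of "r 0"] by (auto simp: monomials_def in_keys_iff)
    then show ?thesis by simp
  qed
  then have "mon_dvd (s (r 0)) (s (r 1))" by (simp add: mon_dvd_iff)
  then have "s (r 0) = s (r 1) \<or> lt (s (r 0)) (s (r 1))"
    using s by (intro mon_dvd_imp_le)
  moreover have "lt (s (r 1)) (s (r 0))" using r by (intro dec) (simp add: strict_mono_def)
  ultimately show False using s lt_irrefl lt_trans by metis
qed

lemma lead_mon_eqI:
  assumes "p \<in> polys V" "u \<in> keys p"
    "\<And>v. v \<in> keys p \<Longrightarrow> v \<noteq> u \<Longrightarrow> lt v u"
  shows "lead_mon lt p = u"
  unfolding lead_mon_def
proof (rule the_equality)
  fix v assume v: "v \<in> keys p \<and> (\<forall>w\<in>keys p. w \<noteq> v \<longrightarrow> lt w v)"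
  have "u \<in> monomials V" "v \<in> monomials V" using assms(1,2) v by (auto simp: carrier_poly_ring)
  then show "v = u" using v assms(2,3) lt_irrefl lt_trans by metis
qed (use assms in auto)

lemma lead_mon:
  assumes "p \<in> polys V" "p \<noteq> 0"
  shows lead_mon_in_keys: "lead_mon lt p \<in> keys p"
    and lt_lead_mon: "v \<in> keys p \<Longrightarrow> v \<noteq> lead_mon lt p \<Longrightarrow> lt v (lead_mon lt p)"
proof -
  have "\<exists>u\<in>A. \<forall>v\<in>A. v \<noteq> u \<longrightarrow> lt v u" if "finite A" "A \<noteq> {}" "A \<subseteq> monomials V" for A
    using that
  proof (induction A rule: finite_ne_induct)
    case (insert a A)
    then obtain u where u: "u \<in> A" "\<forall>v\<in>A. v \<noteq> u \<longrightarrow> lt v u" by auto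
    have mon: "a \<in> monomials V" "u \<in> monomials V" using insert u by auto
    show ?case
    proof (cases "lt a u")
      case True
      then show ?thesis using u by (intro bexI[of _ u]) auto
    next
      case False
      then have "lt u a" using lt_total mon insert u by metis
      moreover have "lt v a" if "v \<in> A" for v
        using \<open>lt u a\<close> u that insert.prems lt_trans[of v u a] mon by (cases "v = u") auto
      ultimately show ?thesis by (intro bexI[of _ a]) auto
    qed
  qed auto
  then obtain u where u: "u \<in> keys p" "\<forall>v\<in>keys p. v \<noteq> u \<longrightarrow> lt v u"
    using assms by (meson carrier_poly_ring finite_keys keys_eq_empty)
  then have "lead_mon lt p = u" using assms by (intro lead_mon_eqI) auto
  then show "lead_mon lt p \<in> keys p"
    "v \<in> keys p \<Longrightarrow> v \<noteq> lead_mon lt p \<Longrightarrow> lt v (lead_mon lt p)"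
    using u by auto
qed

lemma lead_mon_in_monomials:
  "p \<in> polys V \<Longrightarrow> p \<noteq> 0 \<Longrightarrow> lead_mon lt p \<in> monomials V"
  using lead_mon_in_keys by (auto simp: carrier_poly_ring)

lemma lead_coeff_nonzero: "p \<in> polys V \<Longrightarrow> p \<noteq> 0 \<Longrightarrow> lead_coeff_of lt p \<noteq> 0"
  using lead_mon_in_keys by (auto simp: lead_coeff_of_def in_keys_iff)

lemma lead_mon_single_add:
  fixes r :: "'k::field mpoly"
  assumes "u \<in> monomials V" "c \<noteq> 0" "r \<in> polys V" "\<forall>v\<in>keys r. lt v u"
  shows "lead_mon lt (single u c + r) = u"
    "lead_coeff_of lt (single u c + r) = c"
    "single u c + r \<noteq> 0"
proof -
  have "u \<notin> keys r" using assms lt_irrefl by blast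
  then have l: "lookup (single u c + r) u = c"
    by (simp add: lookup_add in_keys_iff)
  then have k: "u \<in> keys (single u c + r)" using assms by (simp add: in_keys_iff)
  have "keys (single u c + r) \<subseteq> insert u (keys r)"
    using keys_add[of "single u c" r] by (auto split: if_splits)
  then show 1: "lead_mon lt (single u c + r) = u"
    using assms k by (intro lead_mon_eqI) auto
  show "lead_coeff_of lt (single u c + r) = c" using l by (simp add: lead_coeff_of_def 1)
  show "single u c + r \<noteq> 0" using k by auto
qed

lemma lead_decomp:
  fixes p :: "'k::field mpoly"
  assumes "p \<in> polys V" "p \<noteq> 0"
  obtains r where "p = single (lead_mon lt p) (lead_coeff_of lt p) + r"
    "r \<in> polys V" "\<forall>v\<in>keys r. lt v (lead_mon lt p)"
    "keys r = keys p - {lead_mon lt p}"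
proof
  let ?r = "p - single (lead_mon lt p) (lead_coeff_of lt p)"
  show "p = single (lead_mon lt p) (lead_coeff_of lt p) + ?r" by simp
  show k: "keys ?r = keys p - {lead_mon lt p}"
    by (auto simp: in_keys_iff lookup_minus lookup_single when_def lead_coeff_of_def split: if_splits)
  show "?r \<in> polys V" using assms k by (auto simp: carrier_poly_ring)
  show "\<forall>v\<in>keys ?r. lt v (lead_mon lt p)"
    unfolding k using lt_lead_mon[OF assms] by blast
qed

lemma lead_mon_mult:
  fixes p q :: "'k::field mpoly"
  assumes "p \<in> polys V" "p \<noteq> 0" "q \<in> polys V" "q \<noteq> 0"
  shows "lead_mon lt (p * q) = lead_mon lt p + lead_mon lt q" "p * q \<noteq> 0"
    "lead_coeff_of lt (p * q) = lead_coeff_of lt p * lead_coeff_of lt q"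
proof -
  let ?u = "lead_mon lt p" and ?v = "lead_mon lt q" and ?a = "lead_coeff_of lt p" and ?b = "lead_coeff_of lt q"
  obtain r where r: "p = single ?u ?a + r" "r \<in> polys V"
    "\<forall>v\<in>keys r. lt v ?u" using lead_decomp[OF assms(1,2)] by metis
  obtain s where s: "q = single ?v ?b + s" "s \<in> polys V"
    "\<forall>v\<in>keys s. lt v ?v" using lead_decomp[OF assms(3,4)] by metis
  let ?t = "single ?u ?a * s + r * q"
  have uv: "?u \<in> monomials V" "?v \<in> monomials V" using lead_mon_in_monomials assms by auto
  have eq: "p * q = single (?u + ?v) (?a * ?b) + ?t"
  proof -
    have "p * q = single ?u ?a * q + r * q" by (subst r(1)) (simp add: distrib_right)
    also have "single ?u ?a * q
        = single (?u + ?v) (?a * ?b) + single ?u ?a * s"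
      by (subst s(1)) (simp add: distrib_left mult_single)
    finally show ?thesis by (simp add: add.assoc)
  qed
  have t: "?t \<in> polys V" using assms r(2) s(2) uv by simp
  have small: "\<forall>w\<in>keys ?t. lt w (?u + ?v)"
  proof
    fix w assume "w \<in> keys ?t"
    then have "w \<in> keys (single ?u ?a * s) \<union> keys (r * q)"
      by (rule subsetD[OF keys_add])
    then consider "w \<in> keys (single ?u ?a * s)" | "w \<in> keys (r * q)"
      by blast
    then show "lt w (?u + ?v)"
    proof cases
      case 1
      then obtain b where b: "w = ?u + b" "b \<in> keys s"
        using keys_mult[of "single ?u ?a" s] by (auto split: if_splits)
      then have "b \<in> monomials V" using s(2) by (auto simp: carrier_poly_ring)
      then show ?thesis using lt_add[of b ?v ?u] s(3) b uv by (simp add: add.commute)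
    next
      case 2
      then obtain a b where ab: "w = a + b" "a \<in> keys r" "b \<in> keys q"
        using keys_mult[of r q] by auto
      have mon: "a \<in> monomials V" "b \<in> monomials V" using ab r(2) assms by (auto simp: carrier_poly_ring)
      have 1: "lt (a + b) (?u + b)" using r(3) ab mon uv by (intro lt_add) auto
      show ?thesis
      proof (cases "b = ?v")
        case False
        then have "lt (b + ?u) (?v + ?u)" using lt_lead_mon[OF assms(3,4)] ab mon uv by (intro lt_add) auto
        then show ?thesis using 1 lt_trans[of "a + b" "?u + b" "?u + ?v"] ab mon uv
          by (simp add: add.commute add_in_monomials)
      qed (use 1 ab in simp)
    qed
  qed
  have c: "?a * ?b \<noteq> 0"
    using lead_coeff_nonzero[OF assms(1,2)] lead_coeff_nonzero[OF assms(3,4)] by simp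
  note L = lead_mon_single_add[OF add_in_monomials[OF uv] c t small]
  show "lead_mon lt (p * q) = ?u + ?v" "p * q \<noteq> 0" "lead_coeff_of lt (p * q) = ?a * ?b"
    unfolding eq using L by simp_all
qed

end

section \<open>Division and coprime lead monomials\<close>

lemma keys_minus: "keys (p - q) \<subseteq> keys p \<union> keys q"
  by (auto simp: in_keys_iff lookup_minus)

lemma dominant_summand:
  fixes p r :: "'k::field mpoly"
  assumes lt: "term_order_on V lt" and p: "p \<in> polys V" "p \<noteq> 0"
    and r: "r \<in> polys V" "\<And>v. v \<in> keys r \<Longrightarrow> lt v (lead_mon lt p)"
  shows "lead_mon lt (p + r) = lead_mon lt p" "p + r \<noteq> 0"
proof -
  obtain s where s: "p = single (lead_mon lt p) (lead_coeff_of lt p) + s"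
    "s \<in> polys V" "\<forall>v\<in>keys s. lt v (lead_mon lt p)"
    using lead_decomp[OF lt p] by metis
  have "\<forall>v\<in>keys (s + r). lt v (lead_mon lt p)"
    using keys_add[of s r] s(3) r(2) by blast
  note * = lead_mon_single_add[OF lt lead_mon_in_monomials[OF lt p] lead_coeff_nonzero[OF lt p]
      poly_ring_closed(1)[OF s(2) r(1)] this]
  have eq: "p + r = single (lead_mon lt p) (lead_coeff_of lt p) + (s + r)"
    by (subst s(1)) (simp add: add.assoc)
  show "lead_mon lt (p + r) = lead_mon lt p" "p + r \<noteq> 0"
    unfolding eq by (rule *(1)) (rule *(3))
qed

context
  fixes V :: "indet set" and lt :: "mon \<Rightarrow> mon \<Rightarrow> bool"
  assumes lt: "term_order_on V lt" and V: "finite V"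
begin

text \<open>The bound \<open>w\<close> on the monomials of \<open>h\<close> serves as the induction variable. It is inherited by the
  remainder, which is needed for reducing the tail of a polynomial without changing its lead monomial.\<close>

lemma division:
  fixes h :: "'k::field mpoly"
  assumes I: "ideal I (poly_ring V)" and F: "F \<subseteq> I" "0 \<notin> F"
    and w: "w \<in> monomials V"
    and h: "h \<in> polys V" "\<forall>v\<in>keys h. v = w \<or> lt v w"
  shows "\<exists>q\<in>I. \<exists>r\<in>polys V. h = q + r \<and>
    (\<forall>v\<in>keys r. v = w \<or> lt v w) \<and>
    (\<forall>v\<in>keys r. \<forall>f\<in>F. \<not> mon_dvd (lead_mon lt f) v)"
  using w h
proof (induction w arbitrary: h rule: wf_induct_rule[OF wf_term_order[OF lt V]])
  case (1 w)
  note I' = ideal_poly_ringD[OF I]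
  have below: "\<exists>q\<in>I. \<exists>r\<in>polys V. h = q + r \<and> (\<forall>v\<in>keys r. lt v w) \<and>
      (\<forall>v\<in>keys r. \<forall>f\<in>F. \<not> mon_dvd (lead_mon lt f) v)"
    if h: "h \<in> polys V" "\<forall>v\<in>keys h. lt v w" for h :: "'k mpoly"
  proof (cases "h = 0")
    case True
    then show ?thesis using I' by (intro bexI[of _ 0]) auto
  next
    case False
    let ?u = "lead_mon lt h"
    have u: "?u \<in> monomials V" "lt ?u w"
      using lead_mon_in_monomials[OF lt h(1) False] lead_mon_in_keys[OF lt h(1) False] h(2) by auto
    have "\<forall>v\<in>keys h. v = ?u \<or> lt v ?u"
      using lt_lead_mon[OF lt h(1) False] by blast
    then obtain q r where qr: "q \<in> I" "r \<in> polys V" "h = q + r"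
      "\<forall>v\<in>keys r. v = ?u \<or> lt v ?u"
      "\<forall>v\<in>keys r. \<forall>f\<in>F. \<not> mon_dvd (lead_mon lt f) v"
      using "1.IH"[of ?u h] u 1 h by blast
    moreover have "lt v w" if "v \<in> keys r" for v
    proof -
      have "v \<in> monomials V" using qr(2) that by (auto simp: carrier_poly_ring)
      then show ?thesis using qr(4) that u lt_trans[OF lt, of v ?u w] "1.prems"(1) by metis
    qed
    ultimately show ?thesis by blast
  qed
  let ?c = "lookup h w"
  show ?case
  proof (cases "?c = 0")
    case True
    then have "\<forall>v\<in>keys h. lt v w" using 1 by (auto simp: in_keys_iff)
    then show ?thesis using below[OF "1.prems"(2)] by blast
  next
    case False
    define h' where "h' = h - single w ?c"
    have h'k: "keys h' \<subseteq> keys h - {w}"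
      by (auto simp: h'_def in_keys_iff lookup_minus lookup_single when_def split: if_splits)
    have h': "h' \<in> polys V" "\<forall>v\<in>keys h'. lt v w"
      using h'k 1 by (auto simp: carrier_poly_ring)
    show ?thesis
    proof (cases "\<exists>f\<in>F. mon_dvd (lead_mon lt f) w")
      case True
      then obtain f where f: "f \<in> F" "mon_dvd (lead_mon lt f) w" by blast
      have fP: "f \<in> polys V" "f \<noteq> 0" using f F I' by auto
      obtain t where t: "w = lead_mon lt f + t" using f by (auto simp: mon_dvd_def)
      then have tm: "t \<in> monomials V" using 1 by (simp add: add_in_monomials_iff)
      obtain s where s: "f = single (lead_mon lt f) (lead_coeff_of lt f) + s"
        "s \<in> polys V" "\<forall>v\<in>keys s. lt v (lead_mon lt f)"
        using lead_decomp[OF lt fP] by metis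
      let ?m = "single t (?c / lead_coeff_of lt f)"
      have "?m * f = single w ?c + ?m * s"
        by (subst s(1)) (simp add: distrib_left mult_single t lead_coeff_nonzero[OF lt fP] add.commute)
      then have eq: "h = ?m * f + (h' - ?m * s)" by (simp add: h'_def)
      have "lt v w" if v: "v \<in> keys (?m * s)" for v
      proof -
        obtain b where b: "v = t + b" "b \<in> keys s"
          using keys_mult[of ?m s] v by (auto split: if_splits)
        then have "b \<in> monomials V" using s(2) by (auto simp: carrier_poly_ring)
        then show ?thesis
          using b s(3) lt_add[OF lt, of b "lead_mon lt f" t] tm lead_mon_in_monomials[OF lt fP] t
          by (simp add: add.commute)
      qed
      then have "\<forall>v\<in>keys (h' - ?m * s). lt v w"
        using h'(2) keys_minus[of h' "?m * s"] by blast
      then obtain q r where qr: "q \<in> I" "r \<in> polys V" "h' - ?m * s = q + r"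
        "\<forall>v\<in>keys r. lt v w"
        "\<forall>v\<in>keys r. \<forall>f\<in>F. \<not> mon_dvd (lead_mon lt f) v"
        using below[of "h' - ?m * s"] h'(1) s(2) tm by auto
      have "?m * f + q \<in> I" using f F qr(1) tm by (intro I'(3) I'(4)) auto
      moreover have "h = (?m * f + q) + r" using eq qr(3) by (simp add: add.assoc)
      ultimately show ?thesis using qr by blast
    next
      case False
      obtain q r where qr: "q \<in> I" "r \<in> polys V" "h' = q + r"
        "\<forall>v\<in>keys r. lt v w"
        "\<forall>v\<in>keys r. \<forall>f\<in>F. \<not> mon_dvd (lead_mon lt f) v"
        using below[OF h'] by blast
      let ?r = "r + single w ?c"
      have "keys ?r \<subseteq> insert w (keys r)"
        using keys_add[of r "single w ?c"] by (auto split: if_splits)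
      moreover have "h = q + ?r" using qr(3) by (simp add: h'_def algebra_simps)
      moreover have "?r \<in> polys V" using qr 1 by simp
      ultimately show ?thesis using qr False by (intro bexI[of _ q] bexI[of _ ?r]) blast+
    qed
  qed
qed

text \<open>Polynomials with pairwise coprime lead monomials form a Groebner basis. Induct on
  the number of generators: an element of the larger ideal is \<open>p' + r * f i\<close> with \<open>p'\<close> in
  the smaller ideal and no monomial of \<open>r\<close> divisible by a lead monomial of the other generators. By
  coprimality the lead monomials of the two summands differ, so the larger one is not cancelled.\<close>

lemma lead_in_coprime_ideal:
  fixes f :: "'i \<Rightarrow> 'k::field mpoly"
  assumes "finite A" "\<And>i. i \<in> A \<Longrightarrow> f i \<in> polys V \<and> f i \<noteq> 0"
    and coprime: "\<And>i j. i \<in> A \<Longrightarrow> j \<in> A \<Longrightarrow> i \<noteq> j \<Longrightarrow>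
      keys (lead_mon lt (f i)) \<inter> keys (lead_mon lt (f j)) = {}"
    and p: "p \<in> Idl\<^bsub>poly_ring V\<^esub> (f ` A)" "p \<noteq> 0"
  shows "\<exists>i\<in>A. mon_dvd (lead_mon lt (f i)) (lead_mon lt p)"
  using assms
proof (induction A arbitrary: p)
  case empty
  have "ideal {0 :: 'k mpoly} (poly_ring V)" by (simp add: ideal_poly_ring_iff)
  then have "Idl\<^bsub>poly_ring V\<^esub> (f ` {}) \<subseteq> {0}" by (intro Idl_minimal) auto
  then show ?case using empty by auto
next
  case (insert i A)
  let ?I = "Idl\<^bsub>poly_ring V\<^esub> (f ` A)"
  have FP: "f ` A \<subseteq> polys V" using insert by auto
  note I = ideal_poly_ringD[OF ideal_Idl[OF FP]]
  have fi: "f i \<in> polys V" "f i \<noteq> 0" using insert by auto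
  have "ideal {q + h * f i | q h. q \<in> ?I \<and> h \<in> polys V} (poly_ring V)" (is "ideal ?K _")
    unfolding ideal_poly_ring_iff
  proof (intro conjI ballI subsetI)
    fix x assume "x \<in> ?K"
    then show "x \<in> polys V" using I fi by auto
  next
    have "0 = 0 + 0 * f i" by simp
    then show "0 \<in> ?K" using I by (blast intro: poly_ring_zero_one)
  next
    fix x y assume "x \<in> ?K" "y \<in> ?K"
    then obtain q h q' h' where "x = q + h * f i" "y = q' + h' * f i" "q \<in> ?I" "q' \<in> ?I"
      "h \<in> polys V" "h' \<in> polys V" by blast
    then have "x + y = (q + q') + (h + h') * f i" "q + q' \<in> ?I" "h + h' \<in> polys V"
      using I(3) by (auto simp: algebra_simps)
    then show "x + y \<in> ?K" by blast
  next
    fix x y :: "'k mpoly" assume "x \<in> ?K" and y: "y \<in> polys V"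
    then obtain q h where "x = q + h * f i" "q \<in> ?I" "h \<in> polys V" by blast
    then have "y * x = y * q + (y * h) * f i" "y * q \<in> ?I" "y * h \<in> polys V"
      using I(4) y by (auto simp: algebra_simps)
    then show "y * x \<in> ?K" by blast
  qed
  moreover have "f ` insert i A \<subseteq> ?K"
  proof
    fix x assume "x \<in> f ` insert i A"
    then consider "x = f i" | "x \<in> ?I" using subset_Idl[OF FP] by auto
    then show "x \<in> ?K"
    proof cases
      case 1
      then have "x = 0 + 1 * f i" by simp
      then show ?thesis using I(2) poly_ring_zero_one(2) by blast
    next
      case 2
      have "x = x + 0 * f i" by simp
      then show ?thesis using 2 poly_ring_zero_one(1) by blast
    qed
  qed
  ultimately have "Idl\<^bsub>poly_ring V\<^esub> (f ` insert i A) \<subseteq> ?K" by (rule Idl_minimal)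
  then obtain q h where qh: "p = q + h * f i" "q \<in> ?I" "h \<in> polys V"
    using insert.prems by blast
  obtain q' r where r: "q' \<in> ?I" "r \<in> polys V" "h = q' + r"
    "\<forall>v\<in>keys r. \<forall>g\<in>f ` A. \<not> mon_dvd (lead_mon lt g) v"
  proof (cases "h = 0")
    case True
    then show ?thesis using that[of 0 0] I by auto
  next
    case False
    have "\<exists>q\<in>?I. \<exists>r\<in>polys V. h = q + r \<and>
        (\<forall>v\<in>keys r. v = lead_mon lt h \<or> lt v (lead_mon lt h)) \<and>
        (\<forall>v\<in>keys r. \<forall>g\<in>f ` A. \<not> mon_dvd (lead_mon lt g) v)"
      using insert.prems(1) lead_mon_in_monomials[OF lt qh(3) False] lt_lead_mon[OF lt qh(3) False] qh
      by (intro division ideal_Idl subset_Idl FP) auto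
    then show ?thesis using that by blast
  qed
  define p' where "p' = q + q' * f i"
  have "p' \<in> ?I"
    unfolding p'_def using I(4)[OF r(1) fi(1)] by (intro I(3) qh) (simp add: mult.commute)
  then have p': "p' \<in> ?I" "p' \<in> polys V" using I by auto
  have p_eq: "p = p' + r * f i" using qh r by (simp add: p'_def algebra_simps)
  have IH: "\<exists>j\<in>A. mon_dvd (lead_mon lt (f j)) (lead_mon lt p')" if "p' \<noteq> 0"
    using insert.prems p' that by (intro insert.IH) auto
  consider "r = 0" | "r \<noteq> 0" "p' = 0" | "r \<noteq> 0" "p' \<noteq> 0" by blast
  then show ?case
  proof cases
    case 1
    then have "p = p'" using p_eq by simp
    then show ?thesis using IH insert.prems by auto
  next
    case 2
    then have "lead_mon lt p = lead_mon lt r + lead_mon lt (f i)"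
      using p_eq lead_mon_mult[OF lt r(2) _ fi] by simp
    then show ?thesis using mon_dvd_add_left by auto
  next
    case 3
    let ?u = "lead_mon lt r + lead_mon lt (f i)" and ?v = "lead_mon lt p'"
    have prod: "lead_mon lt (r * f i) = ?u" "r * f i \<noteq> 0" using lead_mon_mult[OF lt r(2) 3(1) fi] by auto
    have rP: "r * f i \<in> polys V" using r fi by simp
    have mon: "?u \<in> monomials V" "?v \<in> monomials V"
      using lead_mon_in_monomials[OF lt rP prod(2)] lead_mon_in_monomials[OF lt p'(2) 3(2)] prod by auto
    obtain j where j: "j \<in> A" "mon_dvd (lead_mon lt (f j)) ?v" using IH 3 by blast
    have "?u \<noteq> ?v"
    proof
      assume eq: "?u = ?v"
      have "keys (lead_mon lt (f j)) \<inter> keys (lead_mon lt (f i)) = {}"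
        using insert j by (intro insert.prems) auto
      then have "mon_dvd (lead_mon lt (f j)) (lead_mon lt r)"
        using j(2) unfolding eq[symmetric] mon_dvd_iff lookup_add
        by (metis (no_types, lifting) add.right_neutral disjoint_iff in_keys_iff le0)
      then show False using r(4) j(1) lead_mon_in_keys[OF lt r(2) 3(1)] by blast
    qed
    have lead_sum: "lead_mon lt (a + b) = lead_mon lt a"
      if ab: "a \<in> polys V" "b \<in> polys V" "a \<noteq> 0" "b \<noteq> 0"
        "lt (lead_mon lt b) (lead_mon lt a)" for a b :: "'k mpoly"
    proof (rule dominant_summand(1)[OF lt ab(1,3,2)])
      fix v assume v: "v \<in> keys b"
      then have "v \<in> monomials V" using ab(2) by (auto simp: carrier_poly_ring)
      then show "lt v (lead_mon lt a)"
        using lt_lead_mon[OF lt ab(2,4) v] ab(5) lead_mon_in_monomials[OF lt ab(1,3)]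
          lead_mon_in_monomials[OF lt ab(2,4)] lt_trans[OF lt, of v "lead_mon lt b"] by metis
    qed
    from lt_total[OF lt mon \<open>?u \<noteq> ?v\<close>] show ?thesis
    proof
      assume "lt ?u ?v"
      then have "lead_mon lt p = ?v" unfolding p_eq using p' rP prod 3 by (intro lead_sum) auto
      then show ?thesis using j by auto
    next
      assume "lt ?v ?u"
      then have "lead_mon lt (r * f i + p') = ?u" using p' rP prod 3 by (simp add: lead_sum)
      then have "lead_mon lt p = ?u" unfolding p_eq by (simp only: add.commute)
      then show ?thesis using mon_dvd_add_left by auto
    qed
  qed
qed

end

section \<open>Ideals with prescribed lead monomials\<close>

context
  fixes V :: "indet set" and lt :: "mon \<Rightarrow> mon \<Rightarrow> bool"
  assumes lt: "term_order_on V lt" and V: "finite V"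
begin

lemma initial_term_Idl:
  fixes G :: "'k::field mpoly set"
  assumes "G \<subseteq> polys V" "0 \<notin> G"
  shows "Idl\<^bsub>poly_ring V\<^esub> (initial_term lt ` G) =
    {p \<in> polys V. \<forall>u\<in>keys p. \<exists>g\<in>G. mon_dvd (lead_mon lt g) u}"
proof -
  have lead: "lead_mon lt g \<in> monomials V \<and> lead_coeff_of lt g \<noteq> 0" if "g \<in> G" for g
  proof -
    have g: "g \<in> polys V" "g \<noteq> 0" using that assms by auto
    show ?thesis using lead_mon_in_monomials[OF lt g] lead_coeff_nonzero[OF lt g] by simp
  qed
  have "\<exists>u\<in>monomials V. \<exists>c. c \<noteq> 0 \<and> p = single u c"
    if "p \<in> initial_term lt ` G" for p
    using that lead unfolding initial_term_def by blast
  then have *: "Idl\<^bsub>poly_ring V\<^esub> (initial_term lt ` G) =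
      {p \<in> polys V. \<forall>u\<in>keys p. \<exists>v c. c \<noteq> 0 \<and>
        single v c \<in> initial_term lt ` G \<and> mon_dvd v u}"
    by (rule Idl_monomials)
  have eq: "(\<exists>v c. c \<noteq> 0 \<and> single v c \<in> initial_term lt ` G \<and> mon_dvd v u)
      \<longleftrightarrow> (\<exists>g\<in>G. mon_dvd (lead_mon lt g) u)" for u
  proof
    assume "\<exists>v c. c \<noteq> 0 \<and> single v c \<in> initial_term lt ` G \<and> mon_dvd v u"
    then obtain v c g where "c \<noteq> 0" "g \<in> G" "mon_dvd v u"
      "single v c = single (lead_mon lt g) (lead_coeff_of lt g)"
      unfolding initial_term_def by blast
    moreover from this have "v = lead_mon lt g"
      by (metis keys_single lead singleton_inject)
    ultimately show "\<exists>g\<in>G. mon_dvd (lead_mon lt g) u" by blast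
  next
    assume "\<exists>g\<in>G. mon_dvd (lead_mon lt g) u"
    then obtain g where "g \<in> G" "mon_dvd (lead_mon lt g) u" by blast
    then show "\<exists>v c. c \<noteq> 0 \<and> single v c \<in> initial_term lt ` G \<and> mon_dvd v u"
      using lead unfolding initial_term_def
      by (intro exI[of _ "lead_mon lt g"] exI[of _ "lead_coeff_of lt g"]) simp
  qed
  show ?thesis unfolding * eq by simp
qed

lemma mono_poly_Idl:
  assumes "M \<subseteq> monomials V"
  shows "Idl\<^bsub>poly_ring V\<^esub> (mono_poly ` M :: 'k::field mpoly set) =
    {p \<in> polys V. \<forall>u\<in>keys p. \<exists>v\<in>M. mon_dvd v u}"
proof -
  have "\<exists>u\<in>monomials V. \<exists>c. c \<noteq> 0 \<and> p = single u c"
    if "p \<in> (mono_poly ` M :: 'k mpoly set)" for p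
    using that assms by (auto intro!: exI[of _ 1])
  then have *: "Idl\<^bsub>poly_ring V\<^esub> (mono_poly ` M :: 'k mpoly set) =
      {p \<in> polys V. \<forall>u\<in>keys p. \<exists>v c. c \<noteq> 0 \<and>
        single v c \<in> (mono_poly ` M :: 'k mpoly set) \<and> mon_dvd v u}"
    by (rule Idl_monomials)
  have eq: "(\<exists>v c. c \<noteq> 0 \<and> single v c \<in> (mono_poly ` M :: 'k mpoly set) \<and> mon_dvd v u)
      \<longleftrightarrow> (\<exists>v\<in>M. mon_dvd v u)" for u
  proof
    assume "\<exists>v c. c \<noteq> 0 \<and> single v c \<in> (mono_poly ` M :: 'k mpoly set) \<and> mon_dvd v u"
    then obtain v c w where "c \<noteq> 0" "w \<in> M" "mon_dvd v u"
      "single v c = (mono_poly w :: 'k mpoly)" by blast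
    moreover from this have "v = w" by (metis keys_single singleton_inject zero_neq_one)
    ultimately show "\<exists>v\<in>M. mon_dvd v u" by blast
  next
    assume "\<exists>v\<in>M. mon_dvd v u"
    then obtain v where "v \<in> M" "mon_dvd v u" by blast
    then show "\<exists>v c. c \<noteq> 0 \<and> single v c \<in> (mono_poly ` M :: 'k mpoly set) \<and> mon_dvd v u"
      by (intro exI[of _ v] exI[of _ 1]) simp
  qed
  show ?thesis unfolding * eq by simp
qed

context
  fixes J :: "'k::field mpoly set" and M :: "mon set"
  assumes J: "ideal J (poly_ring V)"
    and M: "finite M" "M \<subseteq> monomials V"
    and antichain: "\<And>u v. u \<in> M \<Longrightarrow> v \<in> M \<Longrightarrow> mon_dvd u v \<Longrightarrow> u = v"
    and upper: "\<And>f. f \<in> J \<Longrightarrow> f \<noteq> 0 \<Longrightarrow> \<exists>u\<in>M. mon_dvd u (lead_mon lt f)"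
    and lower: "\<And>u. u \<in> M \<Longrightarrow> \<exists>f\<in>J. f \<noteq> 0 \<and> lead_mon lt f = u"
begin

lemma initial_ideal_eq:
  "initial_ideal V lt J =
    {p \<in> polys V. \<forall>u\<in>keys p. \<exists>v\<in>M. mon_dvd v u}"
proof -
  have "initial_ideal V lt J = Idl\<^bsub>poly_ring V\<^esub> (initial_term lt ` (J - {0}))"
    unfolding initial_ideal_def by (rule arg_cong[where f = "genideal _"]) auto
  also have "\<dots> = {p \<in> polys V. \<forall>u\<in>keys p. \<exists>g\<in>J - {0}. mon_dvd (lead_mon lt g) u}"
    using ideal_poly_ringD(1)[OF J] by (intro initial_term_Idl) auto
  also have "(\<exists>g\<in>J - {0}. mon_dvd (lead_mon lt g) u) \<longleftrightarrow> (\<exists>v\<in>M. mon_dvd v u)" for u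
    using upper lower mon_dvd_trans by blast
  then have "{p \<in> polys V. \<forall>u\<in>keys p. \<exists>g\<in>J - {0}. mon_dvd (lead_mon lt g) u}
     = {p \<in> polys V. \<forall>u\<in>keys p. \<exists>v\<in>M. mon_dvd v u}" by simp
  finally show ?thesis .
qed

lemma minimal_generators: "minimal_monomial_generators V (initial_ideal V lt J) M"
  unfolding minimal_monomial_generators_def
proof (intro conjI allI impI notI)
  show "Idl\<^bsub>poly_ring V\<^esub> (mono_poly ` M) = initial_ideal V lt J"
    unfolding initial_ideal_eq by (rule mono_poly_Idl[OF M(2)])
  fix N assume N: "N \<subset> M" "Idl\<^bsub>poly_ring V\<^esub> (mono_poly ` N) = initial_ideal V lt J"
  then obtain u where u: "u \<in> M" "u \<notin> N" by blast
  have "N \<subseteq> monomials V" using N M by auto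
  from mono_poly_Idl[OF this, where 'k = 'k] N(2) have eq:
    "{p \<in> carrier (poly_ring V :: 'k mpoly ring). \<forall>u\<in>keys p. \<exists>v\<in>N. mon_dvd v u}
     = {p \<in> polys V. \<forall>u\<in>keys p. \<exists>v\<in>M. mon_dvd v u}"
    unfolding initial_ideal_eq by simp
  have "(mono_poly u :: 'k mpoly) \<in> {p \<in> polys V. \<forall>u\<in>keys p. \<exists>v\<in>M. mon_dvd v u}"
    using u M mon_dvd_refl by auto
  then have "\<exists>v\<in>N. mon_dvd v u" unfolding eq[symmetric] by simp
  then show False using antichain u N(1) by blast
qed (rule M)

lemma lead_mon_reduced:
  assumes G: "reduced_groebner_basis V lt J G"
  shows "lead_mon lt ` G = M"
proof -
  have GJ: "G \<subseteq> J" "0 \<notin> G" "G \<subseteq> polys V"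
    and gb: "Idl\<^bsub>poly_ring V\<^esub> (initial_term lt ` G) = initial_ideal V lt J"
    and red: "\<And>g h u. g \<in> G \<Longrightarrow> h \<in> G \<Longrightarrow> g \<noteq> h \<Longrightarrow> u \<in> keys g \<Longrightarrow> \<not> mon_dvd (lead_mon lt h) u"
    using G ideal_poly_ringD(1)[OF J] unfolding reduced_groebner_basis_def groebner_basis_def by blast+
  have lk: "lead_mon lt g \<in> keys g" if "g \<in> G" for g
  proof -
    have "g \<in> polys V" "g \<noteq> 0" using that GJ by auto
    then show ?thesis by (rule lead_mon_in_keys[OF lt])
  qed
  have 1: "\<exists>v\<in>M. mon_dvd v (lead_mon lt g)" if "g \<in> G" for g
  proof -
    have "g \<in> J" "g \<noteq> 0" using that GJ by auto
    then show ?thesis by (rule upper)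
  qed
  have 2: "\<exists>g\<in>G. mon_dvd (lead_mon lt g) u" if "u \<in> M" for u
  proof -
    have "(mono_poly u :: 'k mpoly) \<in> initial_ideal V lt J"
      unfolding initial_ideal_eq using that M mon_dvd_refl by auto
    then show ?thesis unfolding gb[symmetric] initial_term_Idl[OF GJ(3,2)] by simp
  qed
  have 3: "u \<in> lead_mon lt ` G" if u: "u \<in> M" for u
  proof -
    obtain g where g: "g \<in> G" "mon_dvd (lead_mon lt g) u" using 2[OF u] by blast
    obtain v where v: "v \<in> M" "mon_dvd v (lead_mon lt g)" using 1[OF g(1)] by blast
    have "v = u" using antichain[OF v(1) u] mon_dvd_trans[OF v(2) g(2)] by blast
    then have "u = lead_mon lt g" using v(2) g(2) mon_dvd_antisym by blast
    then show ?thesis using g(1) by blast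
  qed
  have "lead_mon lt g \<in> M" if g: "g \<in> G" for g
  proof -
    obtain v where v: "v \<in> M" "mon_dvd v (lead_mon lt g)" using 1[OF g] by blast
    obtain h where h: "h \<in> G" "v = lead_mon lt h" using 3[OF v(1)] by blast
    have "g = h" using red[OF g h(1) _ lk[OF g]] v(2) h(2) by blast
    then show ?thesis using h v by simp
  qed
  then show ?thesis using 3 by blast
qed

text \<open>The difference of two basis elements with the same lead monomial \<open>u\<close> lies in \<open>J\<close>, so its lead
  monomial is divisible by some member of \<open>M\<close>. It occurs in one of the two elements, and reducedness
  leaves only \<open>u\<close> itself as the divisor; but it is smaller than \<open>u\<close>.\<close>

lemma reduced_unique:
  assumes G: "reduced_groebner_basis V lt J G" and H: "reduced_groebner_basis V lt J H"
  shows "G \<subseteq> H"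
proof
  have props: "G \<subseteq> J" "0 \<notin> G" "\<forall>g\<in>G. lead_coeff_of lt g = 1"
    "\<forall>g\<in>G. \<forall>h\<in>G. g \<noteq> h \<longrightarrow> (\<forall>u\<in>keys g. \<not> mon_dvd (lead_mon lt h) u)"
    if "reduced_groebner_basis V lt J G" for G
    using that unfolding reduced_groebner_basis_def groebner_basis_def by blast+
  note JP = ideal_poly_ringD(1)[OF J]
  fix g assume g: "g \<in> G"
  have "lead_mon lt g \<in> lead_mon lt ` H" using lead_mon_reduced[OF G] lead_mon_reduced[OF H] g by blast
  then obtain h where h: "h \<in> H" "lead_mon lt h = lead_mon lt g" by auto
  let ?u = "lead_mon lt g" and ?d = "g - h"
  have gP: "g \<in> polys V" "g \<noteq> 0" using props[OF G] g JP by auto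
  have hP: "h \<in> polys V" "h \<noteq> 0" using props[OF H] h JP by auto
  have "?d = 0"
  proof (rule ccontr)
    assume d: "?d \<noteq> 0"
    have dJ: "?d \<in> J" using ideal_poly_ringD(5)[OF J] props[OF G] props[OF H] g h by blast
    then have dP: "?d \<in> polys V" using JP by blast
    let ?w = "lead_mon lt ?d"
    have wk: "?w \<in> keys ?d" by (rule lead_mon_in_keys[OF lt dP d])
    have "lookup ?d ?u = 0"
      using props(3)[OF G] props(3)[OF H] g h unfolding lead_coeff_of_def
      by (simp add: lookup_minus) metis
    then have wu: "?w \<noteq> ?u" using wk by (auto simp: in_keys_iff)
    obtain v where v: "v \<in> M" "mon_dvd v ?w" using upper[OF dJ d] by blast
    have um: "?u \<in> monomials V" using lead_mon_in_monomials[OF lt gP] .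
    \<comment> \<open>the situation is symmetric in the two bases, so one argument serves both\<close>
    have no: False if f: "?w \<in> keys f" "f \<in> F" "lead_mon lt f = ?u" "f \<in> polys V"
      "f \<noteq> 0" "reduced_groebner_basis V lt J F" for f F
    proof -
      obtain f' where f': "f' \<in> F" "lead_mon lt f' = v" using lead_mon_reduced[OF f(6)] v by blast
      have "f = f'" using props(4)[OF f(6)] f(1,2) f' v(2) by blast
      then have "mon_dvd ?u ?w" using f' v f by simp
      moreover have "lt ?w ?u" using lt_lead_mon[OF lt f(4,5,1)] f(3) wu by simp
      moreover have "?w \<in> monomials V" by (rule lead_mon_in_monomials[OF lt dP d])
      ultimately show False
        using mon_dvd_imp_le[OF lt, of ?u ?w] um lt_irrefl[OF lt um] lt_trans[OF lt, of ?u ?w ?u] wu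
        by metis
    qed
    from wk keys_minus[of g h] consider "?w \<in> keys g" | "?w \<in> keys h"
      by blast
    then show False
    proof cases
      case 1
      then show ?thesis by (rule no[OF _ g refl gP G])
    next
      case 2
      then show ?thesis by (rule no[OF _ h hP H])
    qed
  qed
  then show "g \<in> H" using h by simp
qed

text \<open>Choose monic elements with lead monomials in \<open>M\<close> and replace their tails by remainders.\<close>

lemma ex_reduced: "\<exists>G. reduced_groebner_basis V lt J G"
proof -
  note JP = ideal_poly_ringD(1)[OF J] and J' = ideal_poly_ringD[OF J]
  define f where "f u = (SOME f. f \<in> J \<and> f \<noteq> 0 \<and> lead_mon lt f = u)" for u
  have f: "f u \<in> J" "f u \<noteq> 0" "lead_mon lt (f u) = u" if "u \<in> M" for u
    using someI_ex[of "\<lambda>f. f \<in> J \<and> f \<noteq> 0 \<and> lead_mon lt f = u"] lower[OF that]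
    unfolding f_def by blast+
  have "\<exists>r\<in>polys V. single u 1 + r \<in> J \<and>
      (\<forall>v\<in>keys r. lt v u \<and> (\<forall>w\<in>M. \<not> mon_dvd w v))" if u: "u \<in> M" for u
  proof -
    have fu: "f u \<in> polys V" "f u \<noteq> 0" using f[OF u] JP by auto
    obtain t where t: "f u = single u (lead_coeff_of lt (f u)) + t"
      "t \<in> polys V" "\<forall>v\<in>keys t. lt v u"
      using lead_decomp[OF lt fu] f(3)[OF u] by metis
    have um: "u \<in> monomials V" using u M by blast
    let ?c = "lead_coeff_of lt (f u)"
    define s where "s = single 0 (inverse ?c) * t"
    have c: "?c \<noteq> 0" by (rule lead_coeff_nonzero[OF lt fu])
    have "single 0 (inverse ?c) * f u = single u 1 + s"
      by (subst t(1)) (simp add: distrib_left mult_single s_def c)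
    then have sJ: "single u 1 + s \<in> J"
      using J'(4)[OF f(1)[OF u], of "single 0 (inverse ?c)"] by (simp add: zero_in_monomials)
    have s: "s \<in> polys V" using t unfolding s_def by (simp add: zero_in_monomials)
    have sk: "lt v u" if v: "v \<in> keys s" for v
    proof -
      have "v \<in> keys t"
        using keys_mult[of "single 0 (inverse ?c)" t] v unfolding s_def
        by (auto split: if_splits)
      then show ?thesis using t by blast
    qed
    have "f ` M \<subseteq> J" "0 \<notin> f ` M" using f by force+
    moreover have "\<forall>v\<in>keys s. v = u \<or> lt v u" using sk by blast
    ultimately obtain q r where qr: "q \<in> J" "r \<in> polys V" "s = q + r"
      "\<forall>v\<in>keys r. v = u \<or> lt v u"
      "\<forall>v\<in>keys r. \<forall>g\<in>f ` M. \<not> mon_dvd (lead_mon lt g) v"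
      using division[OF lt V J _ _ um s, of "f ` M"] by blast
    have red: "\<not> mon_dvd w v" if "v \<in> keys r" "w \<in> M" for v w
      using qr(5) that f(3) by fastforce
    have "lt v u" if "v \<in> keys r" for v
      using qr(4) that red[OF that u] mon_dvd_refl[of u] by metis
    moreover have "single u 1 + r \<in> J"
      using J'(5)[OF sJ qr(1)] qr(3) by (simp add: algebra_simps)
    ultimately show ?thesis using qr(2) red by blast
  qed
  then obtain r where r: "\<And>u. u \<in> M \<Longrightarrow> r u \<in> polys V"
    "\<And>u. u \<in> M \<Longrightarrow> single u 1 + r u \<in> J"
    "\<And>u v. u \<in> M \<Longrightarrow> v \<in> keys (r u) \<Longrightarrow> lt v u"
    "\<And>u v w. u \<in> M \<Longrightarrow> v \<in> keys (r u) \<Longrightarrow> w \<in> M \<Longrightarrow> \<not> mon_dvd w v"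
    by metis
  define g where "g u = single u 1 + r u" for u
  have g: "lead_mon lt (g u) = u" "lead_coeff_of lt (g u) = 1" "g u \<noteq> 0" "g u \<in> J"
    "keys (g u) \<subseteq> insert u (keys (r u))" if u: "u \<in> M" for u
  proof -
    have um: "u \<in> monomials V" using u M by blast
    have small: "\<forall>v\<in>keys (r u). lt v u" using r(3)[OF u] by blast
    show "lead_mon lt (g u) = u" "lead_coeff_of lt (g u) = 1" "g u \<noteq> 0"
      unfolding g_def using lead_mon_single_add[OF lt um one_neq_zero r(1)[OF u] small] by auto
    show "g u \<in> J" unfolding g_def by (rule r(2)[OF u])
    show "keys (g u) \<subseteq> insert u (keys (r u))"
      unfolding g_def using keys_add[of "single u 1" "r u"] by auto
  qed
  have gM: "g ` M \<subseteq> polys V" "0 \<notin> g ` M" using g(3,4) JP by force+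
  have "reduced_groebner_basis V lt J (g ` M)"
    unfolding reduced_groebner_basis_def groebner_basis_def
  proof (intro conjI ballI impI)
    show "Idl\<^bsub>poly_ring V\<^esub> (initial_term lt ` g ` M) = initial_ideal V lt J"
      unfolding initial_term_Idl[OF gM] initial_ideal_eq using g(1) by simp
  next
    fix x y v assume "x \<in> g ` M" "y \<in> g ` M" and xy: "x \<noteq> y" and v: "v \<in> keys x"
    then obtain a b where ab: "a \<in> M" "b \<in> M" "x = g a" "y = g b" by blast
    then have "a \<noteq> b" using xy by blast
    then have "\<not> mon_dvd b a" using antichain ab by blast
    moreover have "v = a \<or> v \<in> keys (r a)" using g(5)[OF ab(1)] v ab(3) by blast
    ultimately have "\<not> mon_dvd b v" using r(4)[OF ab(1) _ ab(2)] by blast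
    then show "\<not> mon_dvd (lead_mon lt y) v" using g(1) ab by simp
  qed (use M g gM in auto)
  then show ?thesis by blast
qed

text \<open>The initial ideal consists of the polynomials all of whose monomials are divisible by members of
  \<open>M\<close>, and \<open>M\<close> can be recovered from it as the set of its minimal monomials.\<close>

theorem lead_monomials_determine:
  shows "minimal_monomial_generators V (initial_ideal V lt J) M"
    "\<exists>!G. reduced_groebner_basis V lt J G"
    "reduced_groebner_basis V lt J G \<Longrightarrow> lead_mon lt ` G = M"
  using minimal_generators ex_reduced reduced_unique lead_mon_reduced
  by (blast, meson subset_antisym, blast)

end

end

section \<open>Antidiagonals and lattice paths\<close>

lemma lookup_sum_var:
  assumes "finite A" "inj_on f A"
  shows "lookup (\<Sum>i\<in>A. var (f i)) v = (if v \<in> f ` A then 1 else 0)"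
proof (cases "v \<in> f ` A")
  case True
  then obtain a where a: "a \<in> A" "v = f a" by blast
  have "(\<Sum>i\<in>A. lookup (var (f i)) v) = (\<Sum>i\<in>{a}. lookup (var (f i)) v)"
    using a assms by (intro sum.mono_neutral_right) (auto simp: lookup_single when_def inj_on_def)
  then show ?thesis using True a by (simp add: lookup_sum)
next
  case False
  then show ?thesis
    by (auto simp: lookup_sum lookup_single when_def intro!: sum.neutral)
qed

lemma mdegree_superset:
  "finite S \<Longrightarrow> keys u \<subseteq> S \<Longrightarrow> mdegree u = (\<Sum>v\<in>S. lookup u v)"
  unfolding mdegree_def by (rule sum.mono_neutral_left) (auto simp: in_keys_iff)

lemma mdegree_add: "mdegree (u + v) = mdegree u + mdegree v"
proof -
  let ?S = "keys u \<union> keys v"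
  have "mdegree (u + v) = (\<Sum>x\<in>?S. lookup (u + v) x)"
    by (intro mdegree_superset keys_add) simp
  also have "\<dots> = (\<Sum>x\<in>?S. lookup u x) + (\<Sum>x\<in>?S. lookup v x)"
    by (simp add: lookup_add sum.distrib)
  also have "\<dots> = mdegree u + mdegree v"
    using mdegree_superset[of ?S u] mdegree_superset[of ?S v] by simp
  finally show ?thesis .
qed

lemma mdegree_sum_var: "finite A \<Longrightarrow> mdegree (\<Sum>i\<in>A. var (f i)) = card A"
  by (induction A rule: finite_induct) (simp_all add: mdegree_add, simp_all add: mdegree_def)

lemma mdegree_var: "mdegree (var v) = 1"
  by (simp add: mdegree_def)

lemma mon_dvd_same_degree:
  assumes "mon_dvd u v" "mdegree u = mdegree v" shows "u = v"
proof -
  obtain w where w: "v = u + w" using assms by (auto simp: mon_dvd_def)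
  then have "mdegree w = 0" using assms by (simp add: mdegree_add)
  then have "w = 0" unfolding mdegree_def by (intro poly_mapping_eqI) (auto simp: in_keys_iff)
  then show ?thesis using w by simp
qed

text \<open>Coordinates in which the combinatorics is visible: \<open>\<rho>\<close> counts the rows of \<open>X\<close> from below, and
  column \<open>t\<close> of the grid is the antidiagonal of the consecutive minor \<open>\<Delta>\<^sub>t\<close>.\<close>

definition cell :: "nat \<Rightarrow> nat \<Rightarrow> nat \<Rightarrow> indet" where
  "cell m \<rho> t = X (m + 1 - \<rho>) (t + \<rho> - 1)"

lemma cell_eq_iff:
  assumes "\<rho> \<in> {1..m}" "\<rho>' \<in> {1..m}"
  shows "cell m \<rho> t = cell m \<rho>' t' \<longleftrightarrow> \<rho> = \<rho>' \<and> t = t'"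
  using assms by (auto simp: cell_def)

lemma alpha_eq: "alpha m t = (\<Sum>\<rho>\<in>{1..m}. var (cell m \<rho> t))"
  unfolding alpha_def cell_def by (intro sum.cong) (auto simp: Suc_diff_le)

lemma lookup_alpha_cell:
  "\<rho> \<in> {1..m} \<Longrightarrow> lookup (alpha m t) (cell m \<rho> t') = (if t = t' then 1 else 0)"
  unfolding alpha_eq
  by (subst lookup_sum_var) (auto simp: cell_eq_iff inj_on_def)

lemma lookup_alpha: "lookup (alpha m t) v = (if v \<in> (\<lambda>\<rho>. cell m \<rho> t) ` {1..m} then 1 else 0)"
  unfolding alpha_eq by (rule lookup_sum_var) (auto simp: cell_eq_iff inj_on_def)

text \<open>In grid coordinates the antidiagonals of maximal minors are the graphs of weakly increasing
  functions of \<open>\<rho>\<close>.\<close>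

lemma antidiagonal_increasing:
  assumes "\<And>i j. i \<in> {1..m} \<Longrightarrow> j \<in> {1..m} \<Longrightarrow> i \<le> j \<Longrightarrow> \<tau> i \<le> \<tau> j"
  shows "antidiagonal {1..m} ((\<lambda>\<rho>. \<tau> \<rho> + \<rho> - 1) ` {1..m}) = (\<Sum>\<rho>\<in>{1..m}. var (cell m \<rho> (\<tau> \<rho>)))"
    and "card ((\<lambda>\<rho>. \<tau> \<rho> + \<rho> - 1) ` {1..m}) = m"
proof -
  let ?h = "\<lambda>\<rho>. \<tau> \<rho> + \<rho> - 1"
  have mono: "?h i < ?h j" if "i \<in> {1..m}" "j \<in> {1..m}" "i < j" for i j
    using assms[of i j] that by auto
  have inj: "inj_on ?h {1..m}"
    by (rule inj_onI) (metis mono less_irrefl nat_neq_iff)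
  then show "card (?h ` {1..m}) = m" by (simp add: card_image)
  have "sorted_wrt (<) (map ?h [1..<Suc m])"
    unfolding sorted_wrt_map
    by (rule sorted_wrt_mono_rel[OF _ sorted_wrt_upt]) (use mono in auto)
  then have sl: "sorted_list_of_set (?h ` {1..m}) = map ?h [1..<Suc m]"
    by (metis atLeastLessThanSuc_atLeastAtMost set_map set_upt sorted_list_of_set.idem_if_sorted_distinct
        strict_sorted_iff)
  have s1: "sorted_list_of_set {1..m} = [1..<Suc m]"
    by (metis atLeastLessThanSuc_atLeastAtMost sorted_list_of_set_range)
  have "antidiagonal {1..m} (?h ` {1..m}) = (\<Sum>r<m. var (cell m (m - r) (\<tau> (m - r))))"
    unfolding antidiagonal_def sl s1
    by (intro sum.cong) (auto simp: cell_def Suc_diff_Suc simp del: upt_Suc)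
  also have "\<dots> = (\<Sum>\<rho>\<in>{1..m}. var (cell m \<rho> (\<tau> \<rho>)))"
    by (rule sum.reindex_bij_witness[of _ "\<lambda>\<rho>. m - \<rho>" "\<lambda>r. m - r"]) auto
  finally show "antidiagonal {1..m} (?h ` {1..m}) = (\<Sum>\<rho>\<in>{1..m}. var (cell m \<rho> (\<tau> \<rho>)))" .
qed

lemma antidiagonal_consecutive:
  assumes "1 \<le> j" shows "antidiagonal {1..m} {j..j + m - 1} = alpha m j"
proof -
  have "{j..j + m - 1} = (\<lambda>\<rho>. j + \<rho> - 1) ` {1..m}"
  proof (intro Set.set_eqI iffI)
    fix x assume "x \<in> {j..j + m - 1}"
    then show "x \<in> (\<lambda>\<rho>. j + \<rho> - 1) ` {1..m}"
      using assms by (intro image_eqI[of _ _ "x - j + 1"]) auto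
  qed auto
  then show ?thesis using antidiagonal_increasing(1)[of m "\<lambda>_. j"] by (simp add: alpha_eq)
qed

text \<open>Deleting row \<open>\<kappa>\<close>, counted from below, leaves column \<open>s\<close> of the grid below that row and column
  \<open>s - 1\<close> above it.\<close>

lemma antidiagonal_delete_row:
  assumes "\<kappa> \<in> {1..m}" "2 \<le> s"
  shows "antidiagonal ({1..m} - {m + 1 - \<kappa>}) {s..<s + m - 1} =
    (\<Sum>\<rho>\<in>{1..<\<kappa>}. var (cell m \<rho> s)) + (\<Sum>\<rho>\<in>{\<kappa><..m}. var (cell m \<rho> (s - 1)))"
proof -
  let ?k = "m + 1 - \<kappa>"
  let ?rows = "[1..<?k] @ [Suc ?k..<Suc m]"
  have rows: "sorted_list_of_set ({1..m} - {?k}) = ?rows"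
  proof -
    have "{1..m} - {?k} = set ?rows" using assms by auto
    moreover have "sorted ?rows" "distinct ?rows"
      by (auto simp: sorted_append simp del: upt_Suc)
    ultimately show ?thesis
      by (metis sorted_list_of_set.idem_if_sorted_distinct)
  qed
  have card: "card ({1..m} - {?k}) = m - 1" using assms by (subst card_Diff_singleton) auto
  have "antidiagonal ({1..m} - {?k}) {s..<s + m - 1}
      = (\<Sum>r<m - 1. var (X (?rows ! r) ([s..<s + m - 1] ! (m - 1 - 1 - r))))"
    unfolding antidiagonal_def rows card by simp
  also have "\<dots> = (\<Sum>r<m - 1. if r < ?k - 1 then var (cell m (m - r) (s - 1)) else var (cell m (m - 1 - r) s))"
    using assms by (intro sum.cong) (auto simp: cell_def nth_append simp del: upt_Suc intro!: arg_cong[where f = var])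
  also have "{..<m - 1} = {..<?k - 1} \<union> {?k - 1..<m - 1}" using assms by auto
  also have "(\<Sum>r\<in>\<dots>. if r < ?k - 1 then var (cell m (m - r) (s - 1)) else var (cell m (m - 1 - r) s))
      = (\<Sum>r<?k - 1. var (cell m (m - r) (s - 1))) + (\<Sum>r = ?k - 1..<m - 1. var (cell m (m - 1 - r) s))"
    by (subst sum.union_disjoint) (auto intro!: arg_cong2[where f = "(+)"] sum.cong)
  also have "(\<Sum>r<?k - 1. var (cell m (m - r) (s - 1))) = (\<Sum>\<rho>\<in>{\<kappa><..m}. var (cell m \<rho> (s - 1)))"
    using assms by (intro sum.reindex_bij_witness[of _ "\<lambda>\<rho>. m - \<rho>" "\<lambda>r. m - r"]) auto
  also have "(\<Sum>r = ?k - 1..<m - 1. var (cell m (m - 1 - r) s)) = (\<Sum>\<rho>\<in>{1..<\<kappa>}. var (cell m \<rho> s))"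
    using assms by (intro sum.reindex_bij_witness[of _ "\<lambda>\<rho>. m - 1 - \<rho>" "\<lambda>r. m - 1 - r"]) auto
  finally show ?thesis by (simp add: add.commute)
qed

context
  fixes m n :: nat
  assumes mn: "1 \<le> m" "m < n"
  notes [simp del] = sum.cl_ivl_Suc
begin

lemma strip_cells: "bij_betw (\<lambda>(\<rho>, t). (m + 1 - \<rho>, t + \<rho> - 1)) ({1..m} \<times> {1..n - m + 1}) (strip m n)"
  by (rule bij_betw_byWitness[of _ "\<lambda>(i, j). (m + 1 - i, j + i - m)"])
    (use mn in \<open>auto simp: strip_def\<close>)

context
  fixes A :: "nat set"
  assumes A: "A \<subseteq> {2..n}" "card A = m - 1"
begin

lemma bound_0: "bound n A 0 = 1" by (simp add: bound_def)

lemma length_list_A: "length (sorted_list_of_set A) = m - 1" using A by simp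

lemma finite_A: "finite A" using A(1) finite_subset by blast

lemma bound_m: "bound n A m = n + 1"
  using mn length_list_A by (simp add: bound_def nth_append nth_Cons split: nat.split)

lemma bound_mid: "\<rho> \<in> {1..<m} \<Longrightarrow> bound n A \<rho> = sorted_list_of_set A ! (\<rho> - 1)"
  using length_list_A by (auto simp: bound_def nth_append nth_Cons split: nat.split)

lemma bound_less: assumes "\<rho> < m" shows "bound n A \<rho> < bound n A (Suc \<rho>)"
proof -
  have range: "sorted_list_of_set A ! i \<in> {2..n}" if "i < m - 1" for i
    using nth_mem[of i "sorted_list_of_set A"] that length_list_A A(1) finite_A by auto
  have mono: "sorted_list_of_set A ! i < sorted_list_of_set A ! Suc i" if "Suc i < m - 1" for i
    using sorted_wrt_nth_less[OF strict_sorted_list_of_set[of A], of i "Suc i"] that length_list_A by simp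
  consider "\<rho> = 0" "m = 1" | "\<rho> = 0" "1 < m" | "1 \<le> \<rho>" "Suc \<rho> = m" | "1 \<le> \<rho>" "Suc \<rho> < m"
    using assms by linarith
  then show ?thesis
  proof cases
    case 1
    then show ?thesis using bound_m bound_0 mn by simp
  next
    case 2
    then show ?thesis using bound_0 bound_mid[of 1] range[of 0] by simp
  next
    case 3
    then have "bound n A \<rho> \<le> n" using bound_mid[of \<rho>] range[of "\<rho> - 1"] by simp
    then show ?thesis using bound_m 3 by simp
  next
    case 4
    then show ?thesis using bound_mid[of \<rho>] bound_mid[of "Suc \<rho>"] mono[of "\<rho> - 1"] by simp
  qed
qed

lemma bound_grow: "\<rho> \<le> \<rho>' \<Longrightarrow> \<rho>' \<le> m \<Longrightarrow> bound n A \<rho> + \<rho>' \<le> bound n A \<rho>' + \<rho>"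
proof (induction \<rho>' rule: nat_induct_at_least)
  case (Suc \<rho>')
  then show ?case using bound_less[of \<rho>'] by simp
qed simp

lemma bound_lower: "\<rho> \<le> m \<Longrightarrow> Suc \<rho> \<le> bound n A \<rho>"
  using bound_grow[of 0 \<rho>] bound_0 by simp

lemma bound_upper: "\<rho> \<le> m \<Longrightarrow> bound n A \<rho> + m \<le> n + 1 + \<rho>"
  using bound_grow[of \<rho> m] bound_m by simp

text \<open>Membership in \<open>D\<^sub>A\<close> in grid coordinates. Row \<open>\<rho>\<close> of the path is an interval, and it starts in the
  column in which row \<open>\<rho> - 1\<close> ends.\<close>

definition on_path :: "nat \<Rightarrow> nat \<Rightarrow> bool" where
  "on_path \<rho> t \<longleftrightarrow> bound n A (\<rho> - 1) < t + \<rho> \<and> t + \<rho> \<le> bound n A \<rho>"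

lemma beta_eq: "beta m n A =
  (\<Sum>p\<in>{p \<in> {1..m} \<times> {1..n - m + 1}. \<not> on_path (fst p) (snd p)}. var (cell m (fst p) (snd p)))"
proof -
  let ?f = "\<lambda>(\<rho>, t). (m + 1 - \<rho>, t + \<rho> - 1)"
  let ?P = "{p \<in> {1..m} \<times> {1..n - m + 1}. \<not> on_path (fst p) (snd p)}"
  have mem: "?f p \<in> staircase m n A \<longleftrightarrow> on_path (fst p) (snd p)" if p: "p \<in> {1..m} \<times> {1..n - m + 1}" for p
  proof -
    obtain \<rho> t where pt: "p = (\<rho>, t)" "\<rho> \<in> {1..m}" "t \<in> {1..n - m + 1}" using p by auto
    have "?f p \<in> strip m n" using bij_betwE[OF strip_cells] p by blast
    moreover have "m - (m + 1 - \<rho>) = \<rho> - 1" "\<rho> - 1 + 1 = \<rho>" using pt by auto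
    ultimately show ?thesis using pt by (auto simp: staircase_def on_path_def)
  qed
  have bij: "bij_betw ?f ?P (strip m n - staircase m n A)"
    unfolding bij_betw_def
  proof
    show "inj_on ?f ?P" using strip_cells by (auto simp: bij_betw_def intro: inj_on_subset)
    have strip: "?f ` ({1..m} \<times> {1..n - m + 1}) = strip m n"
      using strip_cells by (simp add: bij_betw_def)
    show "?f ` ?P = strip m n - staircase m n A"
    proof (intro Set.set_eqI iffI)
      fix y assume "y \<in> ?f ` ?P"
      then obtain p where p: "p \<in> {1..m} \<times> {1..n - m + 1}" "\<not> on_path (fst p) (snd p)" "y = ?f p"
        by blast
      then show "y \<in> strip m n - staircase m n A" unfolding strip[symmetric] using mem[OF p(1)] by blast
    next
      fix y assume y: "y \<in> strip m n - staircase m n A"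
      then obtain p where p: "p \<in> {1..m} \<times> {1..n - m + 1}" "y = ?f p"
        unfolding strip[symmetric] by blast
      then show "y \<in> ?f ` ?P" using mem[OF p(1)] y by blast
    qed
  qed
  have "beta m n A = (\<Sum>p\<in>?P. (\<lambda>(i, j). var (X i j)) (?f p))"
    unfolding beta_def by (rule sum.reindex_bij_betw[OF bij, symmetric])
  also have "\<dots> = (\<Sum>p\<in>?P. var (cell m (fst p) (snd p)))"
    by (intro sum.cong) (auto simp: cell_def)
  finally show ?thesis .
qed

lemma lookup_beta:
  "lookup (beta m n A) v = (if v \<in> (\<lambda>p. cell m (fst p) (snd p)) `
    {p \<in> {1..m} \<times> {1..n - m + 1}. \<not> on_path (fst p) (snd p)} then 1 else 0)"
  unfolding beta_eq by (rule lookup_sum_var) (auto simp: inj_on_def cell_eq_iff)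

lemma lookup_beta_cell:
  "\<rho> \<in> {1..m} \<Longrightarrow> t \<in> {1..n - m + 1} \<Longrightarrow>
    lookup (beta m n A) (cell m \<rho> t) = (if on_path \<rho> t then 0 else 1)"
  unfolding lookup_beta
  using image_eqI[of "cell m \<rho> t" "\<lambda>p. cell m (fst p) (snd p)" "(\<rho>, t)"]
  by (auto simp: cell_eq_iff)

text \<open>The row in which the path enters column \<open>t\<close>, for \<open>t \<ge> 2\<close>. For \<open>t = 1\<close> the value is \<open>0\<close>, since
  \<open>a\<^sub>0 = 1\<close>.\<close>

definition step :: "nat \<Rightarrow> nat" where
  "step t = (LEAST \<rho>. t + \<rho> \<le> bound n A \<rho>)"

lemma step_le_iff:
  assumes "\<rho> \<le> m" "t \<le> n - m + 1" shows "step t \<le> \<rho> \<longleftrightarrow> t + \<rho> \<le> bound n A \<rho>"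
proof
  assume le: "step t \<le> \<rho>"
  have "t + m \<le> bound n A m" using bound_m assms mn by simp
  then have "t + step t \<le> bound n A (step t)" unfolding step_def by (rule LeastI)
  then show "t + \<rho> \<le> bound n A \<rho>" using bound_grow[OF le assms(1)] by linarith
next
  assume "t + \<rho> \<le> bound n A \<rho>"
  then show "step t \<le> \<rho>" unfolding step_def by (rule Least_le)
qed

lemma step_range: "t \<in> {2..n - m + 1} \<Longrightarrow> step t \<in> {1..m}"
  using step_le_iff[of m t] step_le_iff[of 0 t] bound_m bound_0 mn by auto

lemma step_mono: "t \<le> t' \<Longrightarrow> t' \<le> n - m + 1 \<Longrightarrow> step t \<le> step t'"
  using step_le_iff[of "step t'" t] step_le_iff[of "step t'" t'] step_le_iff[of m t'] bound_m mn by auto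

lemma on_path_iff:
  assumes "\<rho> \<in> {1..m}" "t \<in> {1..n - m + 1}"
  shows "on_path \<rho> t \<longleftrightarrow> (2 \<le> t \<longrightarrow> step t \<le> \<rho>) \<and> (t \<le> n - m \<longrightarrow> \<rho> \<le> step (t + 1))"
proof -
  have "t + \<rho> \<le> bound n A \<rho> \<longleftrightarrow> (2 \<le> t \<longrightarrow> step t \<le> \<rho>)"
    using step_le_iff[of \<rho> t] bound_lower[of \<rho>] assms by (cases "2 \<le> t") auto
  moreover have "bound n A (\<rho> - 1) < t + \<rho> \<longleftrightarrow> (t \<le> n - m \<longrightarrow> \<rho> \<le> step (t + 1))"
  proof -
    obtain \<rho>' where "\<rho> = Suc \<rho>'" using assms(1) by (cases \<rho>) auto
    then show ?thesis
      using step_le_iff[of \<rho>' "t + 1"] bound_upper[of \<rho>'] assms mn by (cases "t \<le> n - m") auto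
  qed
  ultimately show ?thesis unfolding on_path_def by blast
qed

lemma ex_on_path: assumes t: "t \<in> {1..n - m + 1}" shows "\<exists>\<rho>\<in>{1..m}. on_path \<rho> t"
proof (cases "2 \<le> t")
  case True
  then show ?thesis using on_path_iff[of "step t" t] step_range[of t] step_mono[of t "t + 1"] t
    by (intro bexI[of _ "step t"]) auto
next
  case False
  then show ?thesis using on_path_iff[of 1 t] step_range[of "t + 1"] t mn
    by (intro bexI[of _ 1]) auto
qed

text \<open>A cell of column \<open>t\<close> is off the path iff it is below the row where the path enters column \<open>t\<close> or
  above the row where the path leaves it for column \<open>t + 1\<close>. Collecting the cells by these steps
  instead of by columns gives the antidiagonals of minors without one row.\<close>

lemma beta_eq_antidiagonals:
  "beta m n A = (\<Sum>s\<in>{2..n - m + 1}. antidiagonal ({1..m} - {m + 1 - step s}) {s..<s + m - 1})"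
proof (rule poly_mapping_eqI)
  fix v
  let ?g = "n - m + 1"
  let ?a = "\<lambda>s. antidiagonal ({1..m} - {m + 1 - step s}) {s..<s + m - 1}"
  have a: "lookup (?a s) v =
      (if v \<in> (\<lambda>\<rho>. cell m \<rho> s) ` {1..<step s} then 1 else 0) +
      (if v \<in> (\<lambda>\<rho>. cell m \<rho> (s - 1)) ` {step s<..m} then 1 else 0)" if s: "s \<in> {2..?g}" for s
  proof -
    have st: "step s \<in> {1..m}" and s2: "2 \<le> s" using step_range[OF s] s by auto
    have inj: "inj_on (\<lambda>\<rho>. cell m \<rho> t) {1..<step s}" "inj_on (\<lambda>\<rho>. cell m \<rho> t) {step s<..m}" for t
      using st by (auto simp: inj_on_def cell_eq_iff)
    show ?thesis
      unfolding antidiagonal_delete_row[OF st s2] lookup_add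
      using lookup_sum_var[OF _ inj(1)] lookup_sum_var[OF _ inj(2)] by simp
  qed
  show "lookup (beta m n A) v = lookup (\<Sum>s\<in>{2..?g}. ?a s) v"
  proof (cases "\<exists>\<rho>\<in>{1..m}. \<exists>t\<in>{1..?g}. v = cell m \<rho> t")
    case True
    then obtain \<rho> t where rt: "\<rho> \<in> {1..m}" "t \<in> {1..?g}" "v = cell m \<rho> t" by blast
    have "lookup (?a s) v = (if s = t \<and> \<rho> < step t then 1 else 0) +
        (if s = t + 1 \<and> step (t + 1) < \<rho> then 1 else 0)" if s: "s \<in> {2..?g}" for s
      unfolding a[OF s] using rt s step_range[OF s] by (auto simp: image_iff cell_eq_iff)
    then have "lookup (\<Sum>s\<in>{2..?g}. ?a s) v =
        (\<Sum>s\<in>{2..?g}. if s = t then (if \<rho> < step t then 1 else 0) else 0) +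
        (\<Sum>s\<in>{2..?g}. if s = t + 1 then (if step (t + 1) < \<rho> then 1 else 0) else 0)"
      unfolding lookup_sum sum.distrib[symmetric] by (intro sum.cong) auto
    also have "\<dots> = (if 2 \<le> t \<and> \<rho> < step t then 1 else 0) + (if t \<le> n - m \<and> step (t + 1) < \<rho> then 1 else 0)"
      using rt by (subst (1 2) sum.delta) auto
    also have "\<dots> = (if on_path \<rho> t then 0 else 1)"
      unfolding on_path_iff[OF rt(1,2)] using step_mono[of t "t + 1"] rt(2) by auto
    finally show ?thesis using lookup_beta_cell[OF rt(1,2)] rt(3) by simp
  next
    case False
    have az: "lookup (?a s) v = 0" if s: "s \<in> {2..?g}" for s
    proof -
      have "s \<in> {1..?g}" "s - 1 \<in> {1..?g}" "step s \<in> {1..m}" using s step_range[OF s] by auto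
      then show ?thesis unfolding a[OF s] using False by (auto simp: image_iff)
    qed
    moreover have "lookup (beta m n A) v = 0"
      unfolding lookup_beta using False by fastforce
    moreover have "lookup (\<Sum>s\<in>{2..?g}. ?a s) v = 0"
      unfolding lookup_sum by (intro sum.neutral ballI az)
    ultimately show ?thesis by simp
  qed
qed

lemma mdegree_beta: "mdegree (beta m n A) = (n - m) * (m - 1)"
proof -
  have M: "mdegree (\<Sum>s\<in>S. antidiagonal ({1..m} - {m + 1 - step s}) {s..<s + m - 1}) = card S * (m - 1)"
    if "finite S" "S \<subseteq> {2..n - m + 1}" for S
    using that
  proof (induction S rule: finite_induct)
    case (insert s S)
    have "card ({1..m} - {m + 1 - step s}) = m - 1"
      using step_range[of s] insert by (subst card_Diff_singleton) auto
    then have "mdegree (antidiagonal ({1..m} - {m + 1 - step s}) {s..<s + m - 1}) = m - 1"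
      unfolding antidiagonal_def by (simp add: mdegree_sum_var del: One_nat_def)
    then show ?case using insert by (simp add: mdegree_add)
  qed (simp add: mdegree_def)
  have "card {2..n - m + 1} = n - m" by simp
  with M[OF finite_atLeastAtMost subset_refl] show ?thesis unfolding beta_eq_antidiagonals by metis
qed

end

lemma beta_inj:
  assumes A: "A \<subseteq> {2..n}" "card A = m - 1" and B: "B \<subseteq> {2..n}" "card B = m - 1"
    and eq: "beta m n A = beta m n B"
  shows "A = B"
proof -
  have path: "on_path A \<rho> t \<longleftrightarrow> on_path B \<rho> t" if "\<rho> \<in> {1..m}" "t \<in> {1..n - m + 1}" for \<rho> t
    using lookup_beta_cell[OF A that] lookup_beta_cell[OF B that] unfolding eq
    by (metis zero_neq_one)
  have le: "bound n D \<rho> \<le> bound n E \<rho>"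
    if D: "D \<subseteq> {2..n}" "card D = m - 1" and E: "E \<subseteq> {2..n}" "card E = m - 1"
      and path: "\<And>\<rho> t. \<rho> \<in> {1..m} \<Longrightarrow> t \<in> {1..n - m + 1} \<Longrightarrow> on_path D \<rho> t \<longleftrightarrow> on_path E \<rho> t"
      and \<rho>: "\<rho> \<in> {1..m}" for D E \<rho>
  proof -
    \<comment> \<open>the last cell of the row lies on the first path, hence on the second\<close>
    let ?t = "bound n D \<rho> - \<rho>"
    have lo: "Suc \<rho> \<le> bound n D \<rho>" and hi: "bound n D \<rho> + m \<le> n + 1 + \<rho>"
      using bound_lower[OF D, of \<rho>] bound_upper[OF D, of \<rho>] \<rho> by auto
    have t: "?t \<in> {1..n - m + 1}" "?t + \<rho> = bound n D \<rho>" using lo hi mn by auto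
    have "on_path D \<rho> ?t"
      using bound_less[OF D, of "\<rho> - 1"] \<rho> t(2) unfolding on_path_def[OF D] by auto
    then show ?thesis using path[OF \<rho> t(1)] t(2) unfolding on_path_def[OF E] by simp
  qed
  have "bound n A \<rho> = bound n B \<rho>" if "\<rho> \<in> {1..m}" for \<rho>
    using le[OF A B path that] le[OF B A _ that] path by (simp add: antisym)
  then have "sorted_list_of_set A ! i = sorted_list_of_set B ! i" if "i < m - 1" for i
    using bound_mid[OF A, of "Suc i"] bound_mid[OF B, of "Suc i"] that by simp
  then have "sorted_list_of_set A = sorted_list_of_set B"
    using length_list_A[OF A] length_list_A[OF B] by (intro nth_equalityI) auto
  then show ?thesis
    using finite_A[OF A] finite_A[OF B] by (metis set_sorted_list_of_set)
qed

text \<open>Let the path leave row \<open>\<rho>\<close> in the last column in which \<open>Z\<close> has a cell in a row up to \<open>\<rho>\<close>.\<close>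

lemma chain_on_path:
  assumes Z: "Z \<subseteq> {1..m} \<times> {1..n - m + 1}"
    and chain: "\<And>\<rho> t \<rho>' t'. (\<rho>, t) \<in> Z \<Longrightarrow> (\<rho>', t') \<in> Z \<Longrightarrow> \<rho> < \<rho>' \<Longrightarrow> t \<le> t'"
  shows "\<exists>A. A \<subseteq> {2..n} \<and> card A = m - 1 \<and> (\<forall>(\<rho>, t)\<in>Z. on_path A \<rho> t)"
proof -
  let ?S = "\<lambda>\<rho>. insert 1 {t. \<exists>\<rho>'\<le>\<rho>. (\<rho>', t) \<in> Z}"
  define s where "s \<rho> = Max (?S \<rho>)" for \<rho>
  have finS: "finite (?S \<rho>)" for \<rho>
  proof -
    have "{t. \<exists>\<rho>'\<le>\<rho>. (\<rho>', t) \<in> Z} \<subseteq> {1..n - m + 1}" using Z by auto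
    then show ?thesis using finite_subset by blast
  qed
  have s_mono: "s \<rho> \<le> s \<rho>'" if "\<rho> \<le> \<rho>'" for \<rho> \<rho>'
    unfolding s_def using finS that by (intro Max_mono) (auto intro: order_trans)
  have s_ge: "t \<le> s \<rho>" if "(\<rho>, t) \<in> Z" for \<rho> t
    unfolding s_def using finS that by (intro Max_ge) auto
  have s1: "1 \<le> s \<rho>" for \<rho> unfolding s_def using finS by (intro Max_ge) auto
  have s_in: "s \<rho> \<in> ?S \<rho>" for \<rho> unfolding s_def using finS by (intro Max_in) auto
  have sg: "s \<rho> \<le> n - m + 1" for \<rho> using s_in[of \<rho>] Z by auto
  have s_le: "s (\<rho> - 1) \<le> t" if "(\<rho>, t) \<in> Z" for \<rho> t
  proof -
    have "\<rho> \<in> {1..m}" "t \<in> {1..n - m + 1}" using Z that by auto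
    then show ?thesis using s_in[of "\<rho> - 1"] chain[OF _ that] by fastforce
  qed
  \<comment> \<open>adding the row index makes the weakly increasing column indices strictly increasing\<close>
  define a where "a \<rho> = s \<rho> + \<rho>" for \<rho>
  have a_mono: "a i < a j" if "i < j" for i j using s_mono[of i j] that by (simp add: a_def)
  let ?A = "a ` {1..<m}"
  have inj: "inj_on a {1..<m}" by (rule inj_onI) (metis a_mono less_irrefl nat_neq_iff)
  have "?A \<subseteq> {2..n}"
  proof
    fix x assume "x \<in> ?A"
    then obtain \<rho> where r: "\<rho> \<in> {1..<m}" "x = s \<rho> + \<rho>" by (auto simp: a_def)
    then show "x \<in> {2..n}" using s1[of \<rho>] sg[of \<rho>] mn by auto
  qed
  moreover have "card ?A = m - 1" using inj by (simp add: card_image)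
  ultimately have A: "?A \<subseteq> {2..n}" "card ?A = m - 1" .
  have "sorted_wrt (<) (map a [1..<m])"
    unfolding sorted_wrt_map
    by (rule sorted_wrt_mono_rel[OF _ sorted_wrt_upt]) (use a_mono in auto)
  then have sl: "sorted_list_of_set ?A = map a [1..<m]"
    by (metis set_map set_upt sorted_list_of_set.idem_if_sorted_distinct strict_sorted_iff)
  have bd: "bound n ?A \<rho> = a \<rho>" if "\<rho> \<in> {1..<m}" for \<rho>
    unfolding bound_mid[OF A that] sl using that by (subst nth_map) auto
  have "on_path ?A \<rho> t" if z: "(\<rho>, t) \<in> Z" for \<rho> t
  proof -
    have rt: "\<rho> \<in> {1..m}" "t \<in> {1..n - m + 1}" using Z z by auto
    have 1: "bound n ?A (\<rho> - 1) < t + \<rho>"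
    proof (cases "\<rho> = 1")
      case True
      then show ?thesis using bound_0[OF A] rt by simp
    next
      case False
      then have "\<rho> - 1 \<in> {1..<m}" using rt by auto
      then show ?thesis using bd[of "\<rho> - 1"] s_le[OF z] rt by (auto simp: a_def)
    qed
    have 2: "t + \<rho> \<le> bound n ?A \<rho>"
    proof (cases "\<rho> = m")
      case True
      then show ?thesis using bound_m[OF A] rt mn by auto
    next
      case False
      then have "\<rho> \<in> {1..<m}" using rt by auto
      then show ?thesis using bd[of \<rho>] s_ge[OF z] by (simp add: a_def)
    qed
    show ?thesis unfolding on_path_def[OF A] using 1 2 by blast
  qed
  then show ?thesis using A by blast
qed

lemma lookup_diagonal_Y:
  "lookup (\<Sum>j = 1..g. var (Y j j)) v = (if v \<in> (\<lambda>j. Y j j) ` {1..g} then 1 else 0)"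
  by (rule lookup_sum_var) (auto simp: inj_on_def)

lemma beta_no_Y: "A \<subseteq> {2..n} \<Longrightarrow> card A = m - 1 \<Longrightarrow> lookup (beta m n A) (Y i k) = 0"
  by (simp add: lookup_beta) (auto simp: cell_def)

lemma alpha_no_Y: "lookup (alpha m t) (Y i k) = 0"
  by (auto simp: lookup_alpha cell_def)

text \<open>The constant antidiagonals show that every \<open>Y\<^sub>j\<^sub>j\<close> occurs in \<open>u\<close>. The antidiagonals with two values
  show that the cells with exponent \<open>0\<close> form a chain.\<close>

lemma dvd_gens:
  assumes H: "\<And>B. B \<subseteq> {1..n} \<Longrightarrow> card B = m \<Longrightarrow>
    \<exists>j\<in>{1..n - m + 1}. mon_dvd (var (Y j j) + alpha m j) (u + antidiagonal {1..m} B)"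
  shows "\<exists>w\<in>gens1 m n \<union> gens2 m n. mon_dvd w u"
proof (rule ccontr)
  assume contra: "\<not> ?thesis"
  let ?g = "n - m + 1"
  let ?u = "lookup u"
  have nodvd: "\<not> mon_dvd (var (Y j j) + alpha m j) u" if "j \<in> {1..?g}" for j
    using contra that by (auto simp: gens1_def)
  have key: "\<exists>j\<in>{1..?g}. 1 \<le> ?u (Y j j) \<and> (\<forall>\<rho>\<in>{1..m}. ?u (cell m \<rho> j) = 0 \<longrightarrow> \<tau> \<rho> = j)"
    if \<tau>: "\<And>i j. i \<in> {1..m} \<Longrightarrow> j \<in> {1..m} \<Longrightarrow> i \<le> j \<Longrightarrow> \<tau> i \<le> \<tau> j"
      "\<And>i. i \<in> {1..m} \<Longrightarrow> \<tau> i \<in> {1..?g}" for \<tau>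
  proof -
    let ?B = "(\<lambda>\<rho>. \<tau> \<rho> + \<rho> - 1) ` {1..m}"
    have "?B \<subseteq> {1..n}"
    proof
      fix x assume "x \<in> ?B"
      then obtain \<rho> where "\<rho> \<in> {1..m}" "x = \<tau> \<rho> + \<rho> - 1" by blast
      then show "x \<in> {1..n}" using \<tau>(2)[of \<rho>] mn by auto
    qed
    moreover have "card ?B = m" by (rule antidiagonal_increasing(2)[OF \<tau>(1)])
    ultimately obtain j where j: "j \<in> {1..?g}" "mon_dvd (var (Y j j) + alpha m j) (u + antidiagonal {1..m} ?B)"
      using H[of ?B] by blast
    have anti: "lookup (antidiagonal {1..m} ?B) v
        = (if v \<in> (\<lambda>\<rho>. cell m \<rho> (\<tau> \<rho>)) ` {1..m} then 1 else 0)" for v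
      using antidiagonal_increasing(1)[of m \<tau>] \<tau>(1)
      by (simp only:) (rule lookup_sum_var, auto simp: inj_on_def cell_eq_iff)
    note le = j(2)[unfolded mon_dvd_iff lookup_add anti, rule_format]
    have "1 \<le> ?u (Y j j)" using le[of "Y j j"] by (auto simp: cell_def alpha_no_Y split: if_splits)
    moreover have "\<tau> \<rho> = j" if "\<rho> \<in> {1..m}" "?u (cell m \<rho> j) = 0" for \<rho>
      using le[of "cell m \<rho> j"] that lookup_alpha_cell[OF that(1), of j j]
      by (auto simp: cell_eq_iff split: if_splits)
    ultimately show ?thesis using j(1) by blast
  qed
  have zero: "\<exists>\<rho>\<in>{1..m}. ?u (cell m \<rho> j) = 0" if "1 \<le> ?u (Y j j)" "j \<in> {1..?g}" for j
  proof (rule ccontr)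
    assume "\<not> ?thesis"
    then have "lookup (var (Y j j) + alpha m j) v \<le> ?u v" for v
      using that(1) by (auto simp: lookup_add lookup_single when_def lookup_alpha cell_def Suc_le_eq)
    then show False using nodvd[OF that(2)] by (simp add: mon_dvd_iff)
  qed
  have Y: "1 \<le> ?u (Y j j)" if j: "j \<in> {1..?g}" for j
    using key[of "\<lambda>_. j"] zero j by (metis order_refl)
  let ?Z = "{p \<in> {1..m} \<times> {1..?g}. ?u (cell m (fst p) (snd p)) = 0}"
  have "\<exists>A. A \<subseteq> {2..n} \<and> card A = m - 1 \<and> (\<forall>(\<rho>, t)\<in>?Z. on_path A \<rho> t)"
  proof (rule chain_on_path)
    fix \<rho> t \<rho>' t' assume z: "(\<rho>, t) \<in> ?Z" "(\<rho>', t') \<in> ?Z" "\<rho> < \<rho>'"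
    show "t \<le> t'"
    proof (rule ccontr)
      assume "\<not> t \<le> t'"
      \<comment> \<open>two zeros in the wrong order: a two-step diagonal avoids a zero in every column\<close>
      let ?\<tau> = "\<lambda>i. if i \<le> \<rho> then t' else t"
      have "\<exists>j\<in>{1..?g}. 1 \<le> ?u (Y j j) \<and> (\<forall>i\<in>{1..m}. ?u (cell m i j) = 0 \<longrightarrow> ?\<tau> i = j)"
        by (rule key) (use z \<open>\<not> t \<le> t'\<close> in auto)
      then obtain j where j: "j \<in> {1..?g}" "\<forall>i\<in>{1..m}. ?u (cell m i j) = 0 \<longrightarrow> ?\<tau> i = j"
        by blast
      obtain i where i: "i \<in> {1..m}" "?u (cell m i j) = 0" using zero[OF Y] j(1) by blast
      then have "?\<tau> i = j" using j(2) by blast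
      then have "j = t \<or> j = t'" by (auto split: if_splits)
      then show False
        using j(2)[rule_format, of \<rho>] j(2)[rule_format, of \<rho>'] z \<open>\<not> t \<le> t'\<close> by auto
    qed
  qed auto
  then obtain A where A: "A \<subseteq> {2..n}" "card A = m - 1" and path: "\<forall>(\<rho>, t)\<in>?Z. on_path A \<rho> t"
    by blast
  have "lookup ((\<Sum>j = 1..?g. var (Y j j)) + beta m n A) v \<le> ?u v" for v
  proof (cases "v \<in> (\<lambda>j. Y j j) ` {1..?g}")
    case True
    then show ?thesis using Y unfolding lookup_add lookup_diagonal_Y by (auto simp: beta_no_Y[OF A])
  next
    case False
    show ?thesis
    proof (cases "v \<in> (\<lambda>p. cell m (fst p) (snd p)) ` {p \<in> {1..m} \<times> {1..?g}. \<not> on_path A (fst p) (snd p)}")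
      case True
      then obtain p where p: "p \<in> {1..m} \<times> {1..?g}" "\<not> on_path A (fst p) (snd p)"
        "v = cell m (fst p) (snd p)" by blast
      have "p \<notin> ?Z"
      proof
        assume "p \<in> ?Z"
        then have "case p of (\<rho>, t) \<Rightarrow> on_path A \<rho> t" using path by blast
        then show False using p(2) by (simp add: split_beta)
      qed
      then have "?u v \<noteq> 0" using p(1,3) by simp
      then have "1 \<le> ?u v" by simp
      then show ?thesis using False unfolding lookup_add lookup_diagonal_Y lookup_beta[OF A] by simp
    qed (use False in \<open>unfold lookup_add lookup_diagonal_Y lookup_beta[OF A], simp\<close>)
  qed
  then have "mon_dvd ((\<Sum>j = 1..?g. var (Y j j)) + beta m n A) u" by (simp add: mon_dvd_iff)
  then show False using contra A by (auto simp: gens2_def)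
qed

lemma mdegree_gens1:
  assumes "u \<in> gens1 m n" shows "mdegree u = m + 1"
proof -
  obtain j where u: "u = var (Y j j) + alpha m j" using assms by (auto simp: gens1_def)
  show ?thesis
    unfolding u mdegree_add alpha_eq mdegree_sum_var[OF finite_atLeastAtMost] mdegree_var by simp
qed

lemma mdegree_gens2: "u \<in> gens2 m n \<Longrightarrow> mdegree u = m * (n - m) + 1"
proof -
  assume "u \<in> gens2 m n"
  then obtain A where A: "A \<subseteq> {2..n}" "card A = m - 1"
    and u: "u = (\<Sum>j = 1..n - m + 1. var (Y j j)) + beta m n A" by (auto simp: gens2_def)
  have "mdegree u = (n - m + 1) + (n - m) * (m - 1)"
    unfolding u mdegree_add mdegree_beta[OF A] by (subst mdegree_sum_var) auto
  also have "\<dots> = m * (n - m) + 1"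
  proof -
    obtain m' where "m = Suc m'" using mn by (cases m) auto
    then show ?thesis by simp
  qed
  finally show ?thesis .
qed

lemma squarefree_gens:
  assumes "u \<in> gens1 m n \<union> gens2 m n" shows "squarefree_mon u"
  using assms
proof
  assume "u \<in> gens1 m n"
  then obtain j where u: "u = var (Y j j) + alpha m j" by (auto simp: gens1_def)
  show ?thesis unfolding squarefree_mon_def
    by (auto simp: u lookup_add lookup_alpha lookup_single when_def cell_def)
next
  assume "u \<in> gens2 m n"
  then obtain A where A: "A \<subseteq> {2..n}" "card A = m - 1"
    and u: "u = (\<Sum>j = 1..n - m + 1. var (Y j j)) + beta m n A" by (auto simp: gens2_def)
  show ?thesis unfolding squarefree_mon_def
  proof
    fix v
    show "lookup u v \<le> 1"
      unfolding u lookup_add lookup_diagonal_Y lookup_beta[OF A] by (auto simp: cell_def)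
  qed
qed

lemma card_gens1: "card (gens1 m n) = n - m + 1"
proof -
  have "gens1 m n = (\<lambda>j. var (Y j j) + alpha m j) ` {1..n - m + 1}" by (auto simp: gens1_def)
  moreover have "inj_on (\<lambda>j. var (Y j j) + alpha m j) {1..n - m + 1}"
  proof (rule inj_onI)
    fix i j assume "var (Y i i) + alpha m i = var (Y j j) + alpha m j"
    then have "lookup (var (Y i i) + alpha m i) (Y i i)
        = lookup (var (Y j j) + alpha m j) (Y i i)" by simp
    then show "i = j" by (auto simp: lookup_add alpha_no_Y lookup_single when_def split: if_splits)
  qed
  ultimately show ?thesis by (simp add: card_image)
qed

lemma card_gens2: "card (gens2 m n) = (n - 1) choose (m - 1)"
proof -
  let ?S = "{A. A \<subseteq> {2..n} \<and> card A = m - 1}"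
  let ?f = "\<lambda>A. (\<Sum>j = 1..n - m + 1. var (Y j j)) + beta m n A"
  have "gens2 m n = ?f ` ?S" by (auto simp: gens2_def)
  moreover have "inj_on ?f ?S" using beta_inj by (auto simp: inj_on_def)
  moreover have "card ?S = (n - 1) choose (m - 1)" using n_subsets[of "{2..n}" "m - 1"] by simp
  ultimately show ?thesis by (simp add: card_image)
qed

text \<open>Each of the two families consists of monomials of one degree. A monomial of the first family does
  not divide one of the second because every lattice path meets every column, and a monomial of the
  second contains at least two of the \<open>Y\<^sub>j\<^sub>j\<close>, as \<open>m < n\<close>.\<close>

lemma gens_antichain:
  assumes u: "u \<in> gens1 m n \<union> gens2 m n" and v: "v \<in> gens1 m n \<union> gens2 m n" and dvd: "mon_dvd u v"
  shows "u = v"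
proof -
  have 12: "\<not> mon_dvd u v" if u: "u \<in> gens1 m n" and v: "v \<in> gens2 m n" for u v
  proof
    assume dvd: "mon_dvd u v"
    obtain j where j: "j \<in> {1..n - m + 1}" "u = var (Y j j) + alpha m j" using u by (auto simp: gens1_def)
    obtain A where A: "A \<subseteq> {2..n}" "card A = m - 1"
      and v: "v = (\<Sum>j = 1..n - m + 1. var (Y j j)) + beta m n A" using v by (auto simp: gens2_def)
    obtain \<rho> where r: "\<rho> \<in> {1..m}" "on_path A \<rho> j" using ex_on_path[OF A j(1)] by blast
    have "lookup u (cell m \<rho> j) \<le> lookup v (cell m \<rho> j)"
      using dvd by (simp add: mon_dvd_iff)
    moreover have "lookup v (cell m \<rho> j) = 0"
      using r lookup_beta_cell[OF A r(1) j(1)]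
      unfolding v lookup_add lookup_diagonal_Y by (auto simp: cell_def)
    moreover have "1 \<le> lookup u (cell m \<rho> j)"
      using lookup_alpha_cell[OF r(1), of j j] unfolding j(2) lookup_add by simp
    ultimately show False by simp
  qed
  have 21: "\<not> mon_dvd v u" if u: "u \<in> gens1 m n" and v: "v \<in> gens2 m n" for u v
  proof
    assume dvd: "mon_dvd v u"
    obtain j where j: "u = var (Y j j) + alpha m j" using u by (auto simp: gens1_def)
    obtain A where A: "A \<subseteq> {2..n}" "card A = m - 1"
      and v: "v = (\<Sum>j = 1..n - m + 1. var (Y j j)) + beta m n A" using v by (auto simp: gens2_def)
    obtain i where i: "i \<in> {1..n - m + 1}" "i \<noteq> j"
      using mn that by (cases "j = 1") (auto intro: that[of 1] that[of 2])
    have "lookup v (Y i i) \<le> lookup u (Y i i)"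
      using dvd by (simp add: mon_dvd_iff)
    then show False using i unfolding v j lookup_add lookup_diagonal_Y alpha_no_Y
      by (auto simp: lookup_single when_def)
  qed
  from u v show ?thesis
    using 12[of u v] 21[of v u] dvd mon_dvd_same_degree[OF dvd] mdegree_gens1 mdegree_gens2 by auto
qed

end

section \<open>The lexicographic extension of the term order\<close>

lemma lookup_x_part:
  "lookup (x_part u) v = (case v of X i j \<Rightarrow> lookup u v | Y i k \<Rightarrow> 0)"
  unfolding x_part_def by (cases v) (auto simp: lookup_mapp when_def in_keys_iff)

lemma x_part_add: "x_part (u + v) = x_part u + x_part v"
  by (intro poly_mapping_eqI) (simp add: lookup_x_part lookup_add split: indet.split)

lemma lookup_y_part:
  "lookup (u - x_part u) v = (case v of X i j \<Rightarrow> 0 | Y i k \<Rightarrow> lookup u v)"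
  by (cases v) (simp_all add: lookup_minus lookup_x_part)

lemma y_exponents_y_part: "y_exponents ys (u - x_part u) = y_exponents ys u"
  by (auto simp: y_exponents_def lookup_y_part)

lemma lex_less_than_iff:
  "(xs, zs) \<in> lex less_than \<longleftrightarrow> length xs = length zs \<and>
    (\<exists>i<length xs. (\<forall>j<i. xs ! j = zs ! j) \<and> xs ! i < zs ! i)"
proof -
  have "take i xs = take i zs \<longleftrightarrow> (\<forall>j<i. xs ! j = zs ! j)"
    if "i < length xs" "length xs = length zs" for i
    using that by (auto simp: list_eq_iff_nth_eq)
  then show ?thesis
    unfolding lexord_lex lexord_take_index_conv by auto
qed

lemma term_order_lex:
  assumes ys: "set ys = {(i, k). Y i k \<in> V}"
    and lt: "term_order_on {v \<in> V. \<exists>i j. v = X i j} lt"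
  shows "term_order_on V (link_order ys lt)"
proof -
  let ?X = "{v \<in> V. \<exists>i j. v = X i j}" and ?e = "y_exponents ys"
  have xm: "x_part u \<in> monomials ?X" if "u \<in> monomials V" for u
    using that by (fastforce simp: monomials_def in_keys_iff lookup_x_part subset_iff split: indet.splits)
  have yeq: "u - x_part u = v - x_part v \<longleftrightarrow> ?e u = ?e v"
    if uv: "u \<in> monomials V" "v \<in> monomials V" for u v
  proof
    assume "u - x_part u = v - x_part v"
    then show "?e u = ?e v" by (metis y_exponents_y_part)
  next
    assume e: "?e u = ?e v"
    show "u - x_part u = v - x_part v"
    proof (intro poly_mapping_eqI)
      fix w
      show "lookup (u - x_part u) w = lookup (v - x_part v) w"
      proof (cases w)
        case (Y i k)
        show ?thesis
        proof (cases "Y i k \<in> V")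
          case True
          then show ?thesis using e ys Y by (auto simp: y_exponents_def lookup_y_part)
        next
          case False
          then have "lookup u w = 0" "lookup v w = 0"
            using uv Y by (auto simp: monomials_def in_keys_iff)
          then show ?thesis using Y by (simp add: lookup_y_part)
        qed
      qed (simp add: lookup_y_part)
    qed
  qed
  have lo: "link_order ys lt u v \<longleftrightarrow> (?e u, ?e v) \<in> lex less_than \<or> ?e u = ?e v \<and> lt (x_part u) (x_part v)"
    if "u \<in> monomials V" "v \<in> monomials V" for u v
    using yeq[OF that] by (simp add: link_order_def y_exponents_y_part)
  have irr: "(a, a) \<notin> lex less_than" for a by (simp add: lex_less_than_iff)
  have tr: "(a, c) \<in> lex less_than" if "(a, b) \<in> lex less_than" "(b, c) \<in> lex less_than" for a b c
    using lex_transI[of less_than] that by (meson trans_less_than transD)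
  have tot: "(?e u, ?e v) \<in> lex less_than \<or> ?e u = ?e v \<or> (?e v, ?e u) \<in> lex less_than" for u v
  proof -
    have "\<forall>a b :: nat. (a, b) \<in> less_than \<or> a = b \<or> (b, a) \<in> less_than" by auto
    from lexord_linear[OF this] have "(?e u, ?e v) \<in> lexord less_than \<or> ?e u = ?e v \<or> (?e v, ?e u) \<in> lexord less_than" .
    moreover have "length (?e u) = length (?e v)" by (simp add: y_exponents_def)
    ultimately show ?thesis by (simp add: lexord_lex)
  qed
  note ltX = lt_irrefl[OF lt] lt_trans[OF lt] lt_total[OF lt] lt_pos[OF lt] lt_add[OF lt]
  have I: "\<not> link_order ys lt u u" if "u \<in> monomials V" for u
    using lo[OF that that] irr ltX(1) xm that by blast
  have T: "link_order ys lt u w"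
    if uvw: "u \<in> monomials V" "v \<in> monomials V" "w \<in> monomials V"
      and l: "link_order ys lt u v" "link_order ys lt v w" for u v w
  proof -
    have x: "lt (x_part u) (x_part w)" if "lt (x_part u) (x_part v)" "lt (x_part v) (x_part w)"
      by (rule ltX(2)[OF that xm[OF uvw(1)] xm[OF uvw(2)] xm[OF uvw(3)]])
    from l(1)[unfolded lo[OF uvw(1,2)]] l(2)[unfolded lo[OF uvw(2,3)]]
    show ?thesis unfolding lo[OF uvw(1,3)]
      by (elim disjE conjE) (simp_all add: tr[of "?e u" "?e v" "?e w"] x)
  qed
  have L: "link_order ys lt u v \<or> link_order ys lt v u"
    if uv: "u \<in> monomials V" "v \<in> monomials V" "u \<noteq> v" for u v
  proof (cases "?e u = ?e v")
    case True
    have "x_part u \<noteq> x_part v"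
    proof
      assume x: "x_part u = x_part v"
      have "lookup u w = lookup v w" for w
        using arg_cong[OF x, of "\<lambda>p. lookup p w"]
          arg_cong[OF yeq[OF uv(1,2), THEN iffD2, OF True], of "\<lambda>p. lookup p w"]
        by (cases w) (simp_all add: lookup_x_part lookup_y_part)
      then show False using uv(3) poly_mapping_eqI by blast
    qed
    then have "lt (x_part u) (x_part v) \<or> lt (x_part v) (x_part u)"
      using ltX(3)[OF xm[OF uv(1)] xm[OF uv(2)]] by blast
    then show ?thesis unfolding lo[OF uv(1,2)] lo[OF uv(2,1)] using True by auto
  next
    case False
    then show ?thesis using tot[of u v] lo[OF uv(1,2)] lo[OF uv(2,1)] by blast
  qed
  have N: "\<not> link_order ys lt u 0" if u: "u \<in> monomials V" "u \<noteq> 0" for u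
  proof
    assume l: "link_order ys lt u 0"
    have x0: "x_part 0 = 0" by (intro poly_mapping_eqI) (simp add: lookup_x_part split: indet.split)
    have "(?e u, ?e 0) \<notin> lex less_than" by (auto simp: lex_less_than_iff y_exponents_def split_beta)
    then have "?e u = ?e 0" "lt (x_part u) 0" using l lo[OF u(1) zero_in_monomials] x0 by auto
    moreover have "lt 0 (x_part u) \<or> x_part u = 0" using ltX(4) xm[OF u(1)] by blast
    ultimately show False
      using ltX(1)[OF xm[OF u(1)]] ltX(2)[OF _ _ xm[OF u(1)] zero_in_monomials xm[OF u(1)]] by auto
  qed
  have A: "link_order ys lt (u + w) (v + w)"
    if uvw: "u \<in> monomials V" "v \<in> monomials V" "w \<in> monomials V" and l: "link_order ys lt u v" for u v w
  proof -
    have e: "?e (u + w) = map2 (+) (?e u) (?e w)" for u w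
      by (simp add: y_exponents_def lookup_add map2_map_map split_beta)
    have len: "length (?e u) = length ys" for u by (simp add: y_exponents_def)
    note lo' = lo[OF add_in_monomials[OF uvw(1,3)] add_in_monomials[OF uvw(2,3)]]
    from l[unfolded lo[OF uvw(1,2)]] show ?thesis
    proof
      assume "(?e u, ?e v) \<in> lex less_than"
      then obtain i where i: "i < length ys" "\<forall>j<i. ?e u ! j = ?e v ! j" "?e u ! i < ?e v ! i"
        unfolding lex_less_than_iff len by blast
      then have "\<forall>j<i. ?e (u + w) ! j = ?e (v + w) ! j" "?e (u + w) ! i < ?e (v + w) ! i"
        unfolding e by (simp_all add: len)
      then have "(?e (u + w), ?e (v + w)) \<in> lex less_than"
        unfolding lex_less_than_iff using i(1) len by metis
      then show ?thesis unfolding lo' by blast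
    next
      assume "?e u = ?e v \<and> lt (x_part u) (x_part v)"
      then have "?e (u + w) = ?e (v + w)" "lt (x_part (u + w)) (x_part (v + w))"
        using ltX(5) xm uvw unfolding e x_part_add by auto
      then show ?thesis unfolding lo' by blast
    qed
  qed
  have P: "link_order ys lt 0 u" if "u \<in> monomials V" "u \<noteq> 0" for u
    using L[OF zero_in_monomials that(1)] N[OF that] that(2) by blast
  show ?thesis
    unfolding term_order_on_def irreflp_on_def transp_on_def totalp_on_def
    using I T L P A by blast
qed

text \<open>The diagonal indeterminates come first in the list \<open>ys\<close>, so a difference among their exponents
  decides the comparison.\<close>

lemma link_order_diagonal:
  assumes ys: "take g ys = map (\<lambda>j. (j, j)) [1..<Suc g]" and j: "j \<in> {1..g}"
    and eq: "\<And>i. 1 \<le> i \<Longrightarrow> i < j \<Longrightarrow> lookup u (Y i i) = lookup v (Y i i)"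
    and less: "lookup u (Y j j) < lookup v (Y j j)"
  shows "link_order ys lt u v"
proof -
  have len: "g \<le> length ys" using arg_cong[OF ys, of length] by (simp del: upt_Suc)
  have nth: "ys ! i = (Suc i, Suc i)" if "i < g" for i
  proof -
    have "ys ! i = take g ys ! i" using that by simp
    then show ?thesis unfolding ys using that by (simp del: upt_Suc)
  qed
  have e: "y_exponents ys u ! i = lookup u (Y (Suc i) (Suc i))" if "i < g" for u i
    using that len nth by (simp add: y_exponents_def)
  have "(y_exponents ys u, y_exponents ys v) \<in> lex less_than"
    unfolding lex_less_than_iff
  proof (intro conjI exI[of _ "j - 1"] allI impI)
    show "j - 1 < length (y_exponents ys u)" using j len by (auto simp: y_exponents_def)
    show "y_exponents ys u ! (j - 1) < y_exponents ys v ! (j - 1)" using e[of "j - 1"] j less by auto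
    fix i assume "i < j - 1"
    then show "y_exponents ys u ! i = y_exponents ys v ! i" using e[of i] j eq[of "Suc i"] by auto
  qed (simp add: y_exponents_def)
  then show ?thesis by (simp add: link_order_def y_exponents_y_part)
qed

lemma link_order_x:
  assumes "\<And>i k. lookup u (Y i k) = 0" "\<And>i k. lookup v (Y i k) = 0"
  shows "link_order ys lt u v \<longleftrightarrow> lt u v"
proof -
  have x: "x_part w = w" "w - x_part w = 0" if "\<And>i k. lookup w (Y i k) = 0" for w
    using that by (auto intro!: poly_mapping_eqI simp: lookup_x_part lookup_minus split: indet.split)
  show ?thesis by (simp add: link_order_def x assms lex_less_than_iff)
qed

section \<open>The generic link\<close>

text \<open>Sets of exponent vectors record how many of the \<open>Y\<^sub>j\<^sub>j\<close> occur in the monomials of a polynomial.\<close>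

definition supported :: "mon set \<Rightarrow> 'k::field mpoly set" where
  "supported K = {p. keys p \<subseteq> K}"

lemma supported_mult:
  assumes "p \<in> supported K" "q \<in> supported L" "\<And>u v. u \<in> K \<Longrightarrow> v \<in> L \<Longrightarrow> u + v \<in> N"
  shows "p * q \<in> supported N"
  using keys_mult[of p q] assms unfolding supported_def by fastforce

lemma supported_submodule:
  assumes "\<And>u v. u \<in> L \<Longrightarrow> v \<in> K \<Longrightarrow> u + v \<in> K"
  shows "submodule_of (supported L) (supported K :: 'k::field mpoly set)"
  unfolding submodule_of_def
proof (intro conjI ballI)
  fix p q :: "'k mpoly" assume "p \<in> supported K" "q \<in> supported K"
  then show "p + q \<in> supported K" using keys_add[of p q] by (auto simp: supported_def)
next
  fix p q :: "'k mpoly" assume "p \<in> supported L" "q \<in> supported K"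
  then show "p * q \<in> supported K" using assms by (rule supported_mult)
qed (simp add: supported_def)

lemma carrier_eq_supported: "polys V = supported (monomials V)"
  by (auto simp: supported_def carrier_poly_ring)

lemma subring_poly_ring: "subring_of (polys V :: 'k::field mpoly set)"
  by (simp add: subring_of_def)

lemma ideal_submodule:
  "ideal I (poly_ring V :: 'k::field mpoly ring) \<Longrightarrow> submodule_of (polys V) I"
  using ideal_poly_ringD[of I V] unfolding submodule_of_def by blast

lemma mono_poly_nonzero: "(mono_poly u :: 'k::field mpoly) \<noteq> 0"
  by (metis lookup_single_eq lookup_zero zero_neq_one)

lemma lead_mon_uminus: "lead_mon lt (- p) = lead_mon lt p"
  by (simp add: lead_mon_def)

context
  fixes m n :: nat and C :: "nat \<Rightarrow> nat set" and ys :: "(nat \<times> nat) list"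
    and less_x :: "mon \<Rightarrow> mon \<Rightarrow> bool"
  assumes m1: "1 \<le> m" and mn: "m < n"
    and C: "minor_enumeration m n C"
    and less_x: "antidiagonal_term_order TYPE('k::field) m n less_x"
    and ys: "y_ordering m n ys"
begin

abbreviation (input) "lo \<equiv> link_order ys less_x"
abbreviation (input) "\<S> \<equiv> s_indets m n"
abbreviation (input) "\<X> \<equiv> x_indets m n"

text \<open>Rows outside the matrix are set to \<open>0\<close> so that all entries lie in the polynomial ring.\<close>

definition x_entry :: "nat \<Rightarrow> nat \<Rightarrow> 'k mpoly" where
  "x_entry i j = (if i \<in> {1..m} then var_poly (X i j) else 0)"

lemma finite_S: "finite \<S>"
proof -
  have "x_indets m n = (\<lambda>(i, j). X i j) ` ({1..m} \<times> {1..n})"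
    and "y_indets m n = (\<lambda>(i, k). Y i k) ` ({1..n - m + 1} \<times> {1..n choose m})"
    by (auto simp: x_indets_def y_indets_def)
  then show ?thesis by (simp add: s_indets_def)
qed

lemma Y_in_S: "Y i k \<in> \<S> \<longleftrightarrow> i \<in> {1..n - m + 1} \<and> k \<in> {1..n choose m}"
  and X_in_X: "X i j \<in> \<X> \<longleftrightarrow> i \<in> {1..m} \<and> j \<in> {1..n}"
  and Y_in_X: "Y i k \<notin> \<X>"
  by (auto simp: s_indets_def x_indets_def y_indets_def)

lemma lo_order: "term_order_on \<S> lo"
proof (rule term_order_lex)
  show "set ys = {(i, k). Y i k \<in> \<S>}" using ys by (auto simp: y_ordering_def Y_in_S)
  have "{v \<in> \<S>. \<exists>i j. v = X i j} = \<X>" by (auto simp: s_indets_def x_indets_def y_indets_def)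
  then show "term_order_on {v \<in> \<S>. \<exists>i j. v = X i j} less_x"
    using less_x by (simp add: antidiagonal_term_order_def)
qed

lemma lo_diagonal:
  assumes "j \<in> {1..n - m + 1}"
    "\<And>i. 1 \<le> i \<Longrightarrow> i < j \<Longrightarrow> lookup u (Y i i) = lookup v (Y i i)"
    "lookup u (Y j j) < lookup v (Y j j)"
  shows "lo u v"
  using assms ys by (intro link_order_diagonal[of "n - m + 1" ys j]) (simp_all add: y_ordering_def)

lemma g_le: "n - m + 1 \<le> n choose m"
proof -
  have "take (n - m + 1) ys = map (\<lambda>j. (j, j)) [1..<n - m + 2]"
    using ys by (simp only: y_ordering_def)
  then have "(n - m + 1, n - m + 1) \<in> set (take (n - m + 1) ys)"
    by (auto simp del: upt_Suc)
  then have "(n - m + 1, n - m + 1) \<in> set ys" by (rule in_set_takeD)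
  then show ?thesis using ys by (simp add: y_ordering_def)
qed

lemma X_monomials_in_S: "w \<in> monomials \<X> \<Longrightarrow> w \<in> monomials \<S>"
  by (auto simp: monomials_def s_indets_def)

lemma X_monomial_Y: "w \<in> monomials \<X> \<Longrightarrow> lookup w (Y i k) = 0"
  using Y_in_X by (auto simp: monomials_def in_keys_iff)

lemma X_ring_in_S: "p \<in> polys \<X> \<Longrightarrow> p \<in> polys \<S>"
  using X_monomials_in_S by (auto simp: carrier_poly_ring)

lemma minor_in_X:
  assumes "A \<subseteq> {1..m}" "B \<subseteq> {1..n}" "card A = card B"
  shows "(minor A B :: 'k mpoly) \<in> polys \<X>"
proof -
  have fin: "finite A" "finite B" using assms finite_subset by blast+
  have prod: "prod f I \<in> polys \<X>"
    if "\<And>i. i \<in> I \<Longrightarrow> f i \<in> polys \<X>" for f :: "nat \<Rightarrow> 'k mpoly" and I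
    using that by (induction I rule: infinite_finite_induct) auto
  have sign: "signof p \<in> carrier (poly_ring \<X> :: 'k mpoly ring)" for p :: "nat \<Rightarrow> nat"
    by (cases p rule: sign_cases) simp_all
  have entry: "(var_poly (X (sorted_list_of_set A ! r) (sorted_list_of_set B ! s)) :: 'k mpoly) \<in> polys \<X>"
    if "r < card A" "s < card A" for r s
  proof -
    have "sorted_list_of_set A ! r \<in> A" "sorted_list_of_set B ! s \<in> B"
      using that fin assms(3) by (metis nth_mem length_sorted_list_of_set set_sorted_list_of_set)+
    then show ?thesis
      using assms by (intro single_in_poly_ring) (auto simp: monomials_def X_in_X)
  qed
  show ?thesis
    unfolding minor_def det_def using assms(3)
    by (auto intro!: sum_in_poly_ring poly_ring_closed(2) sign prod entry
        simp: permutes_in_image simp del: One_nat_def)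
qed

lemma lead_mon_one: "lead_mon lo (1 :: 'k mpoly) = 0"
proof -
  have "lead_mon lo (mono_poly 0 :: 'k mpoly) = 0"
    by (rule lead_mon_eqI[OF lo_order]) (simp_all add: zero_in_monomials)
  then show ?thesis by simp
qed

text \<open>The case without rows occurs for \<open>m = 1\<close>, where the minors that omit a row are \<open>1\<close>.\<close>

lemma lead_minor:
  assumes "A \<subseteq> {1..m}" "B \<subseteq> {1..n}" "card A = card B"
  shows "lead_mon lo (minor A B :: 'k mpoly) = antidiagonal A B" "(minor A B :: 'k mpoly) \<noteq> 0"
proof -
  have "lead_mon lo (minor A B :: 'k mpoly) = antidiagonal A B \<and> (minor A B :: 'k mpoly) \<noteq> 0"
  proof (cases "A = {}")
    case True
    then have "(minor A B :: 'k mpoly) = 1" "antidiagonal A B = 0"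
      using assms(3) by (simp_all add: minor_def antidiagonal_def det_dim_zero)
    then show ?thesis using lead_mon_one by simp
  next
    case False
    let ?p = "minor A B :: 'k mpoly" and ?w = "antidiagonal A B"
    have tx: "term_order_on \<X> less_x" and it: "initial_term less_x ?p \<in> {mono_poly ?w, - mono_poly ?w}"
      using less_x assms False by (auto simp: antidiagonal_term_order_def)
    have "- mono_poly ?w = (single ?w (- 1) :: 'k mpoly)" by (simp add: single_uminus)
    then have "keys (initial_term less_x ?p) = {?w}" using it by auto
    then have w: "lead_mon less_x ?p = ?w" and p: "?p \<noteq> 0"
      by (auto simp: initial_term_def lead_coeff_of_def split: if_splits)
    note pX = minor_in_X[OF assms]
    have no_Y: "lookup v (Y i k) = 0" if "v \<in> keys ?p" for v i k
      using pX that X_monomial_Y by (auto simp: carrier_poly_ring)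
    have "lead_mon lo ?p = ?w"
    proof (rule lead_mon_eqI[OF lo_order X_ring_in_S[OF pX]])
      show wk: "?w \<in> keys ?p" using lead_mon_in_keys[OF tx pX p] w by simp
      fix v assume v: "v \<in> keys ?p" "v \<noteq> ?w"
      have "less_x v ?w" using lt_lead_mon[OF tx pX p v(1)] v(2) w by simp
      then show "lo v ?w" using link_order_x[of v ?w ys less_x] no_Y v(1) wk by blast
    qed
    then show ?thesis using p by blast
  qed
  then show "lead_mon lo (minor A B :: 'k mpoly) = antidiagonal A B" "(minor A B :: 'k mpoly) \<noteq> 0"
    by auto
qed

lemma C_bij: "bij_betw C {1..n choose m} {B. B \<subseteq> {1..n} \<and> card B = m}"
  and C_diag: "j \<in> {1..n - m + 1} \<Longrightarrow> C j = {j..j + m - 1}"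
  using C by (auto simp: minor_enumeration_def)

lemma C_range: "k \<in> {1..n choose m} \<Longrightarrow> C k \<subseteq> {1..n} \<and> card (C k) = m"
  using bij_betwE[OF C_bij] by auto

definition link_rel :: "nat \<Rightarrow> 'k mpoly" where
  "link_rel i = (\<Sum>k = 1..n choose m. var_poly (Y i k) * minor {1..m} (C k))"

lemma link_relations_eq: "link_relations m n C = Idl\<^bsub>poly_ring \<S>\<^esub> (link_rel ` {1..n - m + 1})"
  unfolding link_relations_def link_rel_def by (rule arg_cong[where f = "genideal _"]) auto

lemma max_minor_in_S: "k \<in> {1..n choose m} \<Longrightarrow> (minor {1..m} (C k) :: 'k mpoly) \<in> polys \<S>"
  using C_range by (intro X_ring_in_S minor_in_X) auto

lemma Y_in_ring:
  "i \<in> {1..n - m + 1} \<Longrightarrow> k \<in> {1..n choose m} \<Longrightarrow> (var_poly (Y i k) :: 'k mpoly) \<in> polys \<S>"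
  by (intro single_in_poly_ring) (simp add: monomials_def Y_in_S)

lemma link_rel_in_ring: "i \<in> {1..n - m + 1} \<Longrightarrow> link_rel i \<in> polys \<S>"
  unfolding link_rel_def by (intro sum_in_poly_ring poly_ring_closed Y_in_ring max_minor_in_S)

lemma lead_var: "v \<in> V \<Longrightarrow> term_order_on V lt \<Longrightarrow> lead_mon lt (var_poly v :: 'k mpoly) = var v"
  by (rule lead_mon_eqI) (auto simp: monomials_def)

lemma lead_link_rel:
  assumes i: "i \<in> {1..n - m + 1}"
  shows "lead_mon lo (link_rel i) = var (Y i i) + alpha m i" "link_rel i \<noteq> 0"
proof -
  have ik: "i \<in> {1..n choose m}" using i g_le by auto
  let ?p = "var_poly (Y i i) * minor {1..m} (C i) :: 'k mpoly"
  let ?r = "\<Sum>k\<in>{1..n choose m} - {i}. var_poly (Y i k) * minor {1..m} (C k) :: 'k mpoly"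
  have eq: "link_rel i = ?p + ?r" unfolding link_rel_def using ik by (subst sum.remove[of _ i]) auto
  have Cm: "{1..m} \<subseteq> {1..m}" "C i \<subseteq> {1..n}" "card {1..m} = card (C i)" using C_range[OF ik] by auto
  have v0: "(var_poly (Y i i) :: 'k mpoly) \<noteq> 0" by (rule mono_poly_nonzero)
  have lm: "lead_mon lo (minor {1..m} (C i) :: 'k mpoly) = alpha m i"
    using lead_minor(1)[OF Cm] antidiagonal_consecutive[of i m] i C_diag[OF i] by simp
  have "Y i i \<in> \<S>" using i ik by (simp add: Y_in_S)
  from lead_mon_mult[OF lo_order Y_in_ring[OF i ik] v0 max_minor_in_S[OF ik] lead_minor(2)[OF Cm]]
  have p: "lead_mon lo ?p = var (Y i i) + alpha m i" "?p \<noteq> 0"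
    unfolding lm lead_var[OF \<open>Y i i \<in> \<S>\<close> lo_order] by auto
  have pS: "?p \<in> polys \<S>" by (intro poly_ring_closed Y_in_ring[OF i ik] max_minor_in_S[OF ik])
  have rS: "?r \<in> polys \<S>"
    using i by (intro sum_in_poly_ring poly_ring_closed Y_in_ring max_minor_in_S) auto
  have small: "lo v (lead_mon lo ?p)" if v: "v \<in> keys ?r" for v
  proof -
    let ?K = "{var (Y i k) + w | k w. k \<noteq> i \<and> w \<in> monomials \<X>}"
    have "?r \<in> supported ?K"
    proof (rule submodule_sum[of "supported {0}"])
      show "submodule_of (supported {0}) (supported ?K :: 'k mpoly set)"
        by (rule supported_submodule) auto
      fix k assume k: "k \<in> {1..n choose m} - {i}"
      show "var_poly (Y i k) * minor {1..m} (C k) \<in> (supported ?K :: 'k mpoly set)"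
      proof (rule supported_mult[of _ "{var (Y i k)}" _ "monomials \<X>"])
        have "(minor {1..m} (C k) :: 'k mpoly) \<in> polys \<X>"
          using k C_range[of k] by (intro minor_in_X) auto
        then show "minor {1..m} (C k) \<in> (supported (monomials \<X>) :: 'k mpoly set)"
          by (simp add: carrier_eq_supported)
      qed (use k in \<open>auto simp: supported_def\<close>)
    qed
    then have "v \<in> ?K" using v by (auto simp: supported_def)
    then obtain k w where v: "v = var (Y i k) + w" "k \<noteq> i" "w \<in> monomials \<X>" by blast
    have lv: "lookup v (Y j j) = 0" for j
      using v(2) unfolding v(1) lookup_add X_monomial_Y[OF v(3)] by (auto simp: lookup_single when_def)
    show ?thesis unfolding p
    proof (rule lo_diagonal[OF i])
      show "lookup v (Y i i) < lookup (var (Y i i) + alpha m i) (Y i i)"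
        unfolding lv lookup_add by simp
      fix j assume "1 \<le> j" "j < i"
      then show "lookup v (Y j j) = lookup (var (Y i i) + alpha m i) (Y j j)"
        unfolding lv lookup_add using m1 mn by (simp add: alpha_no_Y lookup_single when_def)
    qed
  qed
  note dom = dominant_summand[OF lo_order pS p(2) rS small]
  show "lead_mon lo (link_rel i) = var (Y i i) + alpha m i" unfolding eq by (rule trans[OF dom(1) p(1)])
  show "link_rel i \<noteq> 0" unfolding eq by (rule dom(2))
qed

lemma relations_in_ring: "link_rel ` {1..n - m + 1} \<subseteq> polys \<S>"
  using link_rel_in_ring by blast

lemma ideal_relations: "ideal (link_relations m n C :: 'k mpoly set) (poly_ring \<S>)"
  unfolding link_relations_eq by (rule ideal_Idl[OF relations_in_ring])

lemma link_rel_in_relations: "i \<in> {1..n - m + 1} \<Longrightarrow> link_rel i \<in> link_relations m n C"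
  unfolding link_relations_eq using subset_Idl[OF relations_in_ring] by blast

abbreviation (input) "maximal_minors \<equiv> {minor {1..m} B :: 'k mpoly | B. B \<subseteq> {1..n} \<and> card B = m}"

lemma maximal_minors_in_X: "maximal_minors \<subseteq> polys \<X>"
  using minor_in_X[of "{1..m}"] by auto

lemma determinantal_in_S: "(determinantal_ideal m n :: 'k mpoly set) \<subseteq> polys \<S>"
  unfolding determinantal_ideal_def
  using ideal_poly_ringD(1)[OF ideal_Idl[OF maximal_minors_in_X]] X_ring_in_S by blast

text \<open>The polynomials that \<open>f\<close> multiplies into \<open>\<aa>\<close> form an ideal, both in \<open>S\<close> and after intersecting with
  \<open>R\<close>, so it suffices to test the maximal minors.\<close>

lemma generic_link_iff:
  "f \<in> generic_link m n C \<longleftrightarrow> f \<in> polys \<S> \<and>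
    (\<forall>B. B \<subseteq> {1..n} \<and> card B = m \<longrightarrow> f * minor {1..m} B \<in> (link_relations m n C :: 'k mpoly set))"
  (is "_ \<longleftrightarrow> _ \<and> ?R")
proof
  assume f: "f \<in> generic_link m n C"
  have "minor {1..m} B \<in> Idl\<^bsub>poly_ring \<S>\<^esub> (determinantal_ideal m n :: 'k mpoly set)"
    if "B \<subseteq> {1..n}" "card B = m" for B
  proof -
    have "minor {1..m} B \<in> (determinantal_ideal m n :: 'k mpoly set)"
      unfolding determinantal_ideal_def using subset_Idl[OF maximal_minors_in_X] that by blast
    then show ?thesis using subset_Idl[OF determinantal_in_S] by blast
  qed
  then show "f \<in> polys \<S> \<and> ?R"
    using f unfolding generic_link_def colon_ideal_def by auto
next
  assume f: "f \<in> polys \<S> \<and> ?R"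
  note a = ideal_poly_ringD[OF ideal_relations]
  have colon: "ideal {h \<in> polys V. f * h \<in> link_relations m n C} (poly_ring V)"
    if V: "polys V \<subseteq> (polys \<S> :: 'k mpoly set)" for V
    unfolding ideal_poly_ring_iff
  proof (intro conjI ballI)
    fix p q :: "'k mpoly"
    assume p: "p \<in> {h \<in> polys V. f * h \<in> link_relations m n C}"
      and q: "q \<in> polys V"
    then have "f * p \<in> link_relations m n C" "q \<in> polys \<S>" using V by auto
    then have "q * (f * p) \<in> link_relations m n C" by (rule a(4))
    then show "q * p \<in> {h \<in> polys V. f * h \<in> link_relations m n C}"
      using p q by (simp add: mult.left_commute)
  qed (use a in \<open>auto simp: distrib_left\<close>)
  have "determinantal_ideal m n \<subseteq> {h \<in> polys \<X>. f * h \<in> link_relations m n C}"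
    unfolding determinantal_ideal_def
    by (intro Idl_minimal colon) (use f maximal_minors_in_X X_ring_in_S in auto)
  then have "Idl\<^bsub>poly_ring \<S>\<^esub> (determinantal_ideal m n)
      \<subseteq> {h \<in> polys \<S>. f * h \<in> link_relations m n C}"
    by (intro Idl_minimal colon) (use X_ring_in_S in auto)
  then show "f \<in> generic_link m n C"
    using f unfolding generic_link_def colon_ideal_def by auto
qed

lemma ideal_generic_link: "ideal (generic_link m n C :: 'k mpoly set) (poly_ring \<S>)"
proof -
  note a = ideal_poly_ringD[OF ideal_relations]
  show ?thesis
    unfolding ideal_poly_ring_iff
  proof (intro conjI ballI subsetI)
    fix p q :: "'k mpoly" assume "p \<in> generic_link m n C" "q \<in> polys \<S>"
    then show "q * p \<in> generic_link m n C"
      using a(4) unfolding generic_link_iff by (simp add: mult.assoc)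
  qed (use a in \<open>auto simp: generic_link_iff distrib_right\<close>)
qed

text \<open>The link contains the ideal \<open>\<aa>\<close> that defines it.\<close>

lemma link_rel_in_link: "i \<in> {1..n - m + 1} \<Longrightarrow> link_rel i \<in> generic_link m n C"
  unfolding generic_link_iff
  using link_rel_in_ring[of i] ideal_poly_ringD(4)[OF ideal_relations link_rel_in_relations[of i]]
    minor_in_X[of "{1..m}"] X_ring_in_S by (auto simp: mult.commute[of "link_rel i"])

text \<open>The lead monomial of \<open>f\<close> times a maximal minor is divisible by the lead monomial of a generator of
  \<open>\<aa>\<close>.\<close>

lemma link_lead_upper:
  assumes f: "f \<in> generic_link m n C" "(f :: 'k mpoly) \<noteq> 0"
  shows "\<exists>u\<in>gens1 m n \<union> gens2 m n. mon_dvd u (lead_mon lo f)"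
proof (rule dvd_gens[OF m1 mn])
  fix B assume B: "B \<subseteq> {1..n}" "card B = m"
  have fS: "f \<in> polys \<S>" and fB: "f * minor {1..m} B \<in> link_relations m n C"
    using f B unfolding generic_link_iff by auto
  have Bm: "{1..m} \<subseteq> {1..m}" "B \<subseteq> {1..n}" "card {1..m} = card B" using B by auto
  note mult = lead_mon_mult[OF lo_order fS f(2) X_ring_in_S[OF minor_in_X[OF Bm]] lead_minor(2)[OF Bm]]
  have disj: "keys (lead_mon lo (link_rel i)) \<inter> keys (lead_mon lo (link_rel j)) = {}"
    if ij: "i \<in> {1..n - m + 1}" "j \<in> {1..n - m + 1}" "i \<noteq> j" for i j
  proof -
    have "keys (lead_mon lo (link_rel i)) \<subseteq> insert (Y i i) ((\<lambda>\<rho>. cell m \<rho> i) ` {1..m})"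
      if "i \<in> {1..n - m + 1}" for i
      unfolding lead_link_rel(1)[OF that]
      by (auto simp: in_keys_iff lookup_add lookup_alpha lookup_single when_def split: if_splits)
    moreover have "insert (Y i i) ((\<lambda>\<rho>. cell m \<rho> i) ` {1..m}) \<inter>
        insert (Y j j) ((\<lambda>\<rho>. cell m \<rho> j) ` {1..m}) = {}"
      using ij(3) by (auto simp: cell_def)
    ultimately show ?thesis using ij(1,2) by blast
  qed
  have "\<exists>i\<in>{1..n - m + 1}. mon_dvd (lead_mon lo (link_rel i)) (lead_mon lo (f * minor {1..m} B))"
    using fB unfolding link_relations_eq
    by (intro lead_in_coprime_ideal[OF lo_order finite_S]) (use link_rel_in_ring lead_link_rel(2) disj mult(2) in auto)
  then show "\<exists>j\<in>{1..n - m + 1}. mon_dvd (var (Y j j) + alpha m j) (lead_mon lo f + antidiagonal {1..m} B)"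
    unfolding mult(1) lead_minor(1)[OF Bm] using lead_link_rel(1) by auto
qed


lemma x_entry_in_X: "j \<in> {1..n} \<Longrightarrow> x_entry i j \<in> polys \<X>"
  by (simp add: x_entry_def monomials_def X_in_X)

lemma row_minor_eq_minor:
  assumes "sorted rs" "distinct rs" "set rs = A" "A \<subseteq> {1..m}" "length rs = card B"
  shows "row_minor x_entry rs B = minor A B"
proof -
  have rs: "sorted_list_of_set A = rs"
    using assms(1-3) by (metis sorted_list_of_set.idem_if_sorted_distinct)
  have card: "card A = card B" using assms by (metis distinct_card)
  have "x_entry (rs ! r) j = var_poly (X (rs ! r) j)" if "r < card B" for r j
    using nth_mem[of r rs] that assms by (auto simp: x_entry_def)
  then show ?thesis
    unfolding row_minor_def minor_def rs card assms(5) by (intro arg_cong[where f = det] eq_matI) auto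
qed

lemma row_minor_max: "card B = m \<Longrightarrow> row_minor x_entry [1..<Suc m] B = minor {1..m} B"
  by (rule row_minor_eq_minor) (auto simp del: upt_Suc)

text \<open>The form \<open>\<phi>\<^sub>i\<close>, with the columns of \<open>Y\<close> relabelled by the column sets of the maximal minors.\<close>

definition row_form :: "nat \<Rightarrow> nat set \<Rightarrow> 'k mpoly" where
  "row_form i B = (if B \<subseteq> {1..n} \<and> card B = m
    then var_poly (Y i (the_inv_into {1..n choose m} C B)) else 0)"

lemma row_form_C: "k \<in> {1..n choose m} \<Longrightarrow> row_form i (C k) = var_poly (Y i k)"
  using C_range[of k] the_inv_into_f_f[of C "{1..n choose m}" k] C_bij
  by (simp add: row_form_def bij_betw_def)

lemma row_form_cases:
  assumes "row_form i B \<noteq> 0" obtains k where "k \<in> {1..n choose m}" "B = C k" "row_form i B = var_poly (Y i k)"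
proof -
  have "B \<in> {B. B \<subseteq> {1..n} \<and> card B = m}" using assms by (simp add: row_form_def split: if_splits)
  then obtain k where "k \<in> {1..n choose m}" "B = C k" using C_bij unfolding bij_betw_def by blast
  then show ?thesis using that row_form_C by blast
qed

lemma homog_row_form: "homog n m (row_form i)"
  by (simp add: homog_def row_form_def)

lemma row_form_in_S: "i \<in> {1..n - m + 1} \<Longrightarrow> row_form i B \<in> polys \<S>"
proof (cases "row_form i B = 0")
  case False
  assume "i \<in> {1..n - m + 1}"
  then show ?thesis using row_form_cases[OF False] Y_in_ring by metis
qed simp

lemma minor_form_row_form: "\<exists>s\<in>{1, -1}. minor_form m n x_entry (row_form i) = s * link_rel i"
proof -
  have "(\<Sum>B | B \<subseteq> {1..n} \<and> card B = m. row_form i B * row_minor x_entry [1..<Suc m] B)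
      = (\<Sum>k\<in>{1..n choose m}. row_form i (C k) * row_minor x_entry [1..<Suc m] (C k))"
    by (rule sum.reindex_bij_betw[OF C_bij, symmetric])
  also have "\<dots> = link_rel i"
    unfolding link_rel_def
  proof (intro sum.cong refl)
    fix k assume k: "k \<in> {1..n choose m}"
    show "row_form i (C k) * row_minor x_entry [1..<Suc m] (C k) = var_poly (Y i k) * minor {1..m} (C k)"
      unfolding row_form_C[OF k] row_minor_max[OF conjunct2[OF C_range[OF k]]] ..
  qed
  finally show ?thesis using minor_form_eq[of m n x_entry "row_form i"] by simp
qed

lemma minor_form_basis:
  assumes "B \<subseteq> {1..n}" "card B = m"
  shows "\<exists>s\<in>{1, -1}. minor_form m n x_entry (basis_ext 1 B) = s * minor {1..m} B"
proof -
  have "(\<Sum>D | D \<subseteq> {1..n} \<and> card D = m. basis_ext 1 B D * row_minor x_entry [1..<Suc m] D)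
      = (\<Sum>D\<in>{B}. basis_ext 1 B D * row_minor x_entry [1..<Suc m] D)"
    using assms by (intro sum.mono_neutral_right) (auto simp: basis_ext_def)
  also have "\<dots> = minor {1..m} B" unfolding row_minor_max[OF assms(2), symmetric]
    by (simp add: basis_ext_def del: upt_Suc)
  finally show ?thesis using minor_form_eq[of m n x_entry "basis_ext 1 B"] by simp
qed

lemma link_elem_in_link:
  assumes ks: "sorted ks" "set ks \<subseteq> {1..m}" "length ks = n - m"
  shows "link_elem m n x_entry ks (map row_form (rev [1..<n - m + 2])) Z \<in> generic_link m n C"
proof -
  let ?\<phi>s = "map row_form (rev [1..<n - m + 2])"
  note R = subring_poly_ring[of \<S>, where 'k = 'k]
  have x: "x_entry i j \<in> polys \<S>" if "j \<in> {1..n}" for i j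
    using x_entry_in_X[OF that] X_ring_in_S by blast
  have \<phi>s: "\<exists>i\<in>{1..n - m + 1}. \<psi> = row_form i" if "\<psi> \<in> set ?\<phi>s" for \<psi>
    using that by auto
  have len: "length ?\<phi>s = Suc (length ks)" "m + length ks = n" using ks mn by (auto simp del: upt_Suc)
  have "link_elem m n x_entry ks ?\<phi>s Z * minor {1..m} B \<in> link_relations m n C"
    if B: "B \<subseteq> {1..n}" "card B = m" for B
  proof -
    note a = ideal_poly_ringD[OF ideal_relations]
    \<comment> \<open>the additional form is a basis vector, whose associated scalar is a single minor up to sign\<close>
    have "link_elem m n x_entry ks ?\<phi>s Z * minor_form m n x_entry (basis_ext 1 B) \<in> link_relations m n C"
    proof (rule minor_form_mult_link_elem[OF R x ideal_submodule[OF ideal_relations] len(1) ks(1,2) m1 _ _ len(2)])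
      show "\<forall>\<psi>\<in>set (basis_ext 1 B # ?\<phi>s). homog n m \<psi> \<and> (\<forall>Z. \<psi> Z \<in> polys \<S>)"
        using \<phi>s homog_row_form row_form_in_S homog_basis_ext[OF B] by (auto simp: basis_ext_def)
      show "\<forall>\<psi>\<in>set ?\<phi>s. minor_form m n x_entry \<psi> \<in> link_relations m n C"
      proof
        fix \<psi> assume "\<psi> \<in> set ?\<phi>s"
        then obtain i where i: "i \<in> {1..n - m + 1}" "\<psi> = row_form i" using \<phi>s by blast
        obtain s where "s \<in> {1, -1}" "minor_form m n x_entry \<psi> = s * link_rel i" using minor_form_row_form i by blast
        moreover from this have "s \<in> polys \<S>" by auto
        ultimately show "minor_form m n x_entry \<psi> \<in> link_relations m n C"
          using a(4) link_rel_in_relations[OF i(1)] by simp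
      qed
    qed
    moreover obtain s where s: "s \<in> {1, -1}" "minor_form m n x_entry (basis_ext 1 B) = s * minor {1..m} B"
      using minor_form_basis[OF B] by blast
    moreover from s have "s \<in> polys \<S>" "s * s = 1" by auto
    ultimately have "s * (link_elem m n x_entry ks ?\<phi>s Z * (s * minor {1..m} B)) \<in> link_relations m n C"
      using a(4) by metis
    moreover have "s * (link_elem m n x_entry ks ?\<phi>s Z * (s * minor {1..m} B))
        = (s * s) * (link_elem m n x_entry ks ?\<phi>s Z * minor {1..m} B)" by (simp only: mult_ac)
    ultimately show ?thesis using \<open>s * s = 1\<close> by simp
  qed
  moreover have "link_elem m n x_entry ks ?\<phi>s Z \<in> polys \<S>"
    using \<phi>s row_form_in_S by (intro link_elem_in[OF R x]) blast+
  ultimately show ?thesis unfolding generic_link_iff by blast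
qed

text \<open>The monomials that can occur in a product of \<open>s\<close> row forms: each of the first \<open>s\<close> diagonal
  indeterminates at most once and none of the later ones. In \<open>small_mons\<close> at least one of them is missing,
  which makes the monomial smaller than any multiple of \<open>Y\<^sub>1\<^sub>1 \<dots> Y\<^sub>s\<^sub>s\<close> by an \<open>X\<close>-monomial.
  The sets \<open>row_mons\<close> and \<open>off_mons\<close> bound a single row form and its part without the diagonal
  indeterminate.\<close>

definition full_mons :: "nat \<Rightarrow> mon set" where
  "full_mons s = {u \<in> monomials \<S>. \<forall>j\<in>{1..n - m + 1}. lookup u (Y j j) \<le> (if j \<le> s then 1 else 0)}"

definition small_mons :: "nat \<Rightarrow> mon set" where
  "small_mons s = {u \<in> full_mons s. \<exists>j\<in>{1..s}. lookup u (Y j j) = 0}"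

definition row_mons :: "nat \<Rightarrow> mon set" where
  "row_mons s = {u \<in> monomials \<S>. \<forall>j\<in>{1..n - m + 1}. lookup u (Y j j) \<le> (if j = s then 1 else 0)}"

definition off_mons :: "mon set" where
  "off_mons = {u \<in> monomials \<S>. \<forall>j\<in>{1..n - m + 1}. lookup u (Y j j) = 0}"

lemma mons_submodule:
  "submodule_of (polys \<X>) (supported (full_mons s) :: 'k mpoly set)"
  "submodule_of (polys \<X>) (supported (small_mons s) :: 'k mpoly set)"
  "submodule_of (polys \<X>) (supported (row_mons s) :: 'k mpoly set)"
  "submodule_of (polys \<X>) (supported off_mons :: 'k mpoly set)"
  unfolding carrier_eq_supported
  by (rule supported_submodule,
      use X_monomial_Y X_monomials_in_S in
        \<open>simp add: full_mons_def small_mons_def row_mons_def off_mons_def lookup_add add_in_monomials\<close>)+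

lemma row_small:
  assumes "u \<in> row_mons (Suc s)" "v \<in> small_mons s" shows "u + v \<in> small_mons (Suc s)"
proof -
  have 1: "u \<in> monomials \<S>" "v \<in> monomials \<S>"
    using assms by (auto simp: row_mons_def small_mons_def full_mons_def)
  have 2: "lookup (u + v) (Y j j) \<le> (if j \<le> Suc s then 1 else 0)" if "j \<in> {1..n - m + 1}" for j
  proof -
    have "lookup u (Y j j) \<le> (if j = Suc s then 1 else 0)"
      "lookup v (Y j j) \<le> (if j \<le> s then 1 else 0)"
      using assms that unfolding row_mons_def small_mons_def full_mons_def by blast+
    then show ?thesis by (auto simp: lookup_add split: if_splits)
  qed
  obtain j where j: "j \<in> {1..s}" "lookup v (Y j j) = 0"
    using assms(2) by (auto simp: small_mons_def)
  have "lookup u (Y j j) = 0"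
  proof (cases "j \<in> {1..n - m + 1}")
    case True
    then have "lookup u (Y j j) \<le> (if j = Suc s then 1 else 0)"
      using assms(1) unfolding row_mons_def by blast
    then show ?thesis using j by auto
  next
    case False
    then show ?thesis using 1(1) by (auto simp: monomials_def in_keys_iff Y_in_S)
  qed
  then have "\<exists>j\<in>{1..Suc s}. lookup (u + v) (Y j j) = 0"
    using j by (intro bexI[of _ j]) (auto simp: lookup_add)
  then show ?thesis unfolding small_mons_def full_mons_def using 1 2 add_in_monomials by blast
qed

lemma off_full:
  assumes "u \<in> off_mons" "v \<in> full_mons s" "Suc s \<le> n - m + 1" shows "u + v \<in> small_mons (Suc s)"
proof -
  have 1: "u \<in> monomials \<S>" "v \<in> monomials \<S>"
    using assms by (auto simp: off_mons_def full_mons_def)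
  have 2: "lookup (u + v) (Y j j) \<le> (if j \<le> s then 1 else 0)" if "j \<in> {1..n - m + 1}" for j
    using assms that unfolding off_mons_def full_mons_def by (simp add: lookup_add)
  have "\<exists>j\<in>{1..Suc s}. lookup (u + v) (Y j j) = 0"
    using 2[of "Suc s"] assms(3) by (intro bexI[of _ "Suc s"]) auto
  moreover have "lookup (u + v) (Y j j) \<le> (if j \<le> Suc s then 1 else 0)"
    if "j \<in> {1..n - m + 1}" for j
    using 2[OF that] by (auto split: if_splits)
  ultimately show ?thesis unfolding small_mons_def full_mons_def using 1 add_in_monomials by blast
qed

lemma row_form_split:
  assumes s: "s \<in> {1..n - m + 1}"
  obtains \<psi> where "row_form s = (\<lambda>B. basis_ext (var_poly (Y s s)) {s..s + m - 1} B + \<psi> B)"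
    "\<And>B. \<psi> B \<in> supported off_mons"
proof
  let ?\<psi> = "\<lambda>B. row_form s B - basis_ext (var_poly (Y s s)) {s..s + m - 1} B"
  show "row_form s = (\<lambda>B. basis_ext (var_poly (Y s s)) {s..s + m - 1} B + ?\<psi> B)" by simp
  fix B
  have sk: "s \<in> {1..n choose m}" using s g_le by auto
  have 0: "(0 :: 'k mpoly) \<in> supported off_mons" by (simp add: supported_def)
  show "?\<psi> B \<in> supported off_mons"
  proof (cases "B = {s..s + m - 1}")
    case True
    then have "row_form s B = var_poly (Y s s)" using row_form_C[OF sk] C_diag[OF s] by simp
    then show ?thesis using True 0 by (simp add: basis_ext_def)
  next
    case B: False
    show ?thesis
    proof (cases "row_form s B = 0")
      case False
      then obtain k where k: "k \<in> {1..n choose m}" "B = C k" "row_form s B = var_poly (Y s k)"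
        by (rule row_form_cases)
      have "k \<noteq> s" using B k C_diag[OF s] by auto
      then have "var (Y s k) \<in> off_mons"
        using s k by (auto simp: off_mons_def monomials_def Y_in_S lookup_single when_def)
      then show ?thesis using B k by (simp add: basis_ext_def supported_def)
    qed (use B 0 in \<open>simp add: basis_ext_def\<close>)
  qed
qed

text \<open>The part of the element that contains all the \<open>Y\<^sub>j\<^sub>j\<close> comes from the diagonal parts of the row forms
  alone. The diagonal part of the \<open>j\<close>-th form is a multiple of the basis vector for
  \<open>{j..j + m - 1}\<close>, so the product of the first \<open>s\<close> of them is a multiple of the one for
  \<open>{1..<s + m}\<close>, and each further factor contributes one minor by \<open>link_product_basis\<close>.\<close>

lemma link_elem_expansion:
  assumes "1 \<le> s" "s \<le> n - m + 1" "\<And>t. t \<in> {2..s} \<Longrightarrow> k t \<in> {1..m}"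
  shows "\<exists>c R. c \<in> polys \<X> \<and> c \<noteq> 0 \<and>
    lead_mon lo c = (\<Sum>t\<in>{2..s}. antidiagonal ({1..m} - {k t}) {t..<t + m - 1}) \<and>
    (\<forall>Z. R Z \<in> supported (small_mons s)) \<and>
    link_elem m n x_entry (map k (rev [2..<Suc s])) (map row_form (rev [1..<Suc s])) =
      (\<lambda>Z. basis_ext (mono_poly (\<Sum>j = 1..s. var (Y j j)) * c) {1..<s + m} Z + R Z)"
  using assms
proof (induction s rule: nat_induct_at_least)
  case base
  have one: "1 \<in> {1..n - m + 1}" by simp
  obtain \<psi> where \<psi>: "row_form 1 = (\<lambda>B. basis_ext (var_poly (Y 1 1)) {1..1 + m - 1} B + \<psi> B)"
    "\<And>B. \<psi> B \<in> supported off_mons"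
    using row_form_split[OF one] by blast
  have "off_mons \<subseteq> small_mons 1"
    by (auto simp: off_mons_def small_mons_def full_mons_def)
  then have "\<psi> B \<in> supported (small_mons 1)" for B using \<psi>(2)[of B] by (auto simp: supported_def)
  moreover have "{1..1 + m - 1} = {1..<1 + m}" by auto
  then have "row_form 1 = (\<lambda>B. basis_ext (var_poly (Y 1 1)) {1..<1 + m} B + \<psi> B)"
    using \<psi>(1) by simp
  ultimately show ?case
    by (intro exI[of _ 1] exI[of _ \<psi>]) (simp add: numeral_2_eq_2 lead_mon_one)
next
  case (Suc s)
  let ?D = "\<lambda>s. \<Sum>j = 1..s. var (Y j j)" and ?a = "s + m" and ?k = "k (Suc s)"
  obtain c R where c: "c \<in> polys \<X>" "c \<noteq> 0"
      "lead_mon lo c = (\<Sum>t\<in>{2..s}. antidiagonal ({1..m} - {k t}) {t..<t + m - 1})"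
    and R: "\<And>Z. R Z \<in> supported (small_mons s)"
    and W: "link_elem m n x_entry (map k (rev [2..<Suc s])) (map row_form (rev [1..<Suc s])) =
      (\<lambda>Z. basis_ext (mono_poly (?D s) * c) {1..<s + m} Z + R Z)" (is "?W = _")
    using Suc.IH Suc.prems by auto
  have s: "Suc s \<in> {1..n - m + 1}" and k: "?k \<in> {1..m}" using Suc.prems Suc.hyps by auto
  obtain \<psi> where \<psi>: "row_form (Suc s) = (\<lambda>B. basis_ext (var_poly (Y (Suc s) (Suc s))) {Suc s..Suc s + m - 1} B + \<psi> B)"
    "\<And>B. \<psi> B \<in> supported off_mons"
    using row_form_split[OF s] by blast
  let ?main = "basis_ext (var_poly (Y (Suc s) (Suc s)) :: 'k mpoly) {Suc s..?a}"
  let ?base = "basis_ext (mono_poly (?D s) * c) {1..<?a}"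
  let ?rows = "[1..<?k] @ [Suc ?k..<Suc m]" and ?cols = "{Suc s..<?a}"
  have \<phi>: "row_form (Suc s) = (\<lambda>B. ?main B + \<psi> B)" using \<psi>(1) by simp
  have "link_elem m n x_entry (map k (rev [2..<Suc (Suc s)])) (map row_form (rev [1..<Suc (Suc s)]))
      = link_product m n x_entry ?k (row_form (Suc s)) ?W"
    using Suc.hyps by (simp add: upt_rec[of 1])
  also have "\<dots> = (\<lambda>Z. link_product m n x_entry ?k ?main ?base Z
      + (link_product m n x_entry ?k ?main R Z + link_product m n x_entry ?k \<psi> ?W Z))"
    unfolding \<phi> link_product_add_left by (subst W) (simp add: link_product_add_right add.assoc)
  finally have link: "link_elem m n x_entry (map k (rev [2..<Suc (Suc s)])) (map row_form (rev [1..<Suc (Suc s)]))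
      = (\<lambda>Z. link_product m n x_entry ?k ?main ?base Z
      + (link_product m n x_entry ?k ?main R Z + link_product m n x_entry ?k \<psi> ?W Z))" (is "_ = (\<lambda>Z. _ + ?R Z)") .
  have "1 \<le> Suc s" "1 \<le> ?k" "?k \<le> m" "Suc ?a = Suc s + m" "?a \<le> n"
    using k Suc.prems(1) mn by auto
  from link_product_basis[OF this, where x = x_entry] obtain t where t: "t \<in> {1, -1}"
    "link_product m n x_entry ?k ?main ?base =
      basis_ext (t * var_poly (Y (Suc s) (Suc s)) * (mono_poly (?D s) * c) * row_minor x_entry ?rows ?cols) {1..?a}"
    by blast
  have cols: "?cols \<subseteq> {1..n}" "card ?cols = m - 1" using Suc.prems(1) mn by auto
  have rm: "row_minor x_entry ?rows ?cols = minor ({1..m} - {?k}) ?cols"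
    by (rule row_minor_eq_minor) (use k cols in \<open>auto simp: sorted_append simp del: upt_Suc\<close>)
  have A: "{1..m} - {?k} \<subseteq> {1..m}" "?cols \<subseteq> {1..n}" "card ({1..m} - {?k}) = card ?cols"
    using k cols by auto
  let ?c = "t * (c * minor ({1..m} - {?k}) ?cols)"
  have main: "link_product m n x_entry ?k ?main ?base = basis_ext (mono_poly (?D (Suc s)) * ?c) {1..<Suc s + m}"
  proof -
    have "var_poly (Y (Suc s) (Suc s)) * mono_poly (?D s) = (mono_poly (?D (Suc s)) :: 'k mpoly)"
      by (simp add: mult_single add.commute)
    then have "t * var_poly (Y (Suc s) (Suc s)) * (mono_poly (?D s) * c) * row_minor x_entry ?rows ?cols
        = mono_poly (?D (Suc s)) * ?c"
      unfolding rm by (simp only: mult_ac)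
    moreover have "{1..?a} = {1..<Suc s + m}" by auto
    ultimately show ?thesis using t(2) by simp
  qed
  note min = lead_minor[OF A] minor_in_X[OF A]
  note mult = lead_mon_mult[OF lo_order X_ring_in_S[OF c(1)] c(2) X_ring_in_S[OF min(3)] min(2)]
  have cX: "c * minor ({1..m} - {?k}) ?cols \<in> polys \<X>" using c min by simp
  have c': "?c \<in> polys \<X>" "?c \<noteq> 0"
    "lead_mon lo ?c = (\<Sum>t\<in>{2..Suc s}. antidiagonal ({1..m} - {k t}) {t..<t + m - 1})"
    using t(1) cX mult Suc.hyps unfolding c(3) min(1) by (auto simp: lead_mon_uminus)
  note RX = subring_poly_ring[of \<X>, where 'k = 'k]
  have R1: "link_product m n x_entry ?k ?main R Z \<in> supported (small_mons (Suc s))" for Z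
  proof (rule link_product_in[OF RX x_entry_in_X mons_submodule(2) mons_submodule(3)[of "Suc s"] mons_submodule(2)])
    have "var (Y (Suc s) (Suc s)) \<in> row_mons (Suc s)"
      using s g_le by (auto simp: row_mons_def monomials_def Y_in_S lookup_single when_def)
    then show "?main Z \<in> supported (row_mons (Suc s))" for Z
      by (simp add: basis_ext_def supported_def)
  qed (use R supported_mult row_small in blast)+
  have R2: "link_product m n x_entry ?k \<psi> ?W Z \<in> supported (small_mons (Suc s))" for Z
  proof (rule link_product_in[OF RX x_entry_in_X mons_submodule(2) mons_submodule(4) mons_submodule(1)])
    have "lookup (?D s) v = (if v \<in> (\<lambda>j. Y j j) ` {1..s} then 1 else 0)" for v
      by (rule lookup_diagonal_Y[OF m1 mn])
    then have D: "?D s \<in> full_mons s"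
      using Suc.prems(1) g_le
      by (auto simp: full_mons_def monomials_def in_keys_iff Y_in_S split: if_splits)
    have "mono_poly (?D s) * c \<in> supported (full_mons s)"
      using mons_submodule(1)[of s] c(1) D unfolding submodule_of_def supported_def
      by (simp add: mult.commute)
    moreover have "R Z \<in> supported (full_mons s)" for Z
      using R[of Z] by (auto simp: supported_def small_mons_def)
    ultimately show "?W Z \<in> supported (full_mons s)" for Z
      using mons_submodule(1)[of s] unfolding W submodule_of_def basis_ext_def by auto
  qed (use \<psi>(2) supported_mult off_full Suc.prems(1) in blast)+
  have "?R Z \<in> supported (small_mons (Suc s))" for Z
    using R1 R2 mons_submodule(2) unfolding submodule_of_def by blast
  then show ?case
    using c' link main by (intro exI[of _ ?c] exI[of _ ?R]) simp
qed


text \<open>Read the row indices off the path: \<open>k t\<close> is the row of \<open>X\<close> in which the path enters column \<open>t\<close> of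
  the grid. They decrease weakly in \<open>t\<close> because the path is monotone, so in the order of
  \<open>link_elem\<close>, last factor first, the list is sorted.\<close>

lemma ex_link_lead:
  assumes A: "A \<subseteq> {2..n}" "card A = m - 1"
  shows "\<exists>f\<in>generic_link m n C. (f :: 'k mpoly) \<noteq> 0 \<and>
    lead_mon lo f = (\<Sum>j = 1..n - m + 1. var (Y j j)) + beta m n A"
proof -
  let ?g = "n - m + 1" and ?D = "\<Sum>j = 1..n - m + 1. var (Y j j)"
  define k where "k t = m + 1 - step n A t" for t
  have step: "step n A t \<in> {1..m}" if "t \<in> {2..?g}" for t by (rule step_range[OF m1 mn A that])
  have k: "k t \<in> {1..m}" if "t \<in> {2..?g}" for t
    using step[OF that] by (auto simp: k_def)
  let ?ks = "map k (rev [2..<Suc ?g])"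
  let ?W = "link_elem m n x_entry ?ks (map row_form (rev [1..<Suc ?g]))"
  have "sorted_wrt (\<lambda>s t. k t \<le> k s) [2..<Suc ?g]"
  proof (rule sorted_wrt_mono_rel[OF _ sorted_wrt_upt])
    fix s t assume "s \<in> set [2..<Suc ?g]" "t \<in> set [2..<Suc ?g]" "s < t"
    then show "k t \<le> k s" using step_mono[OF m1 mn A, of s t] by (auto simp: k_def simp del: upt_Suc)
  qed
  then have "sorted ?ks" by (simp add: sorted_wrt_map sorted_wrt_rev del: upt_Suc)
  moreover have "set ?ks \<subseteq> {1..m}" using k by (auto simp del: upt_Suc)
  moreover have "length ?ks = n - m" by (simp del: upt_Suc)
  moreover have "Suc ?g = n - m + 2" by simp
  ultimately have GJ: "?W Z \<in> generic_link m n C" for Z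
    using link_elem_in_link[of ?ks Z] by metis
  obtain c R where c: "c \<in> polys \<X>" "c \<noteq> 0"
      "lead_mon lo c = (\<Sum>t\<in>{2..?g}. antidiagonal ({1..m} - {k t}) {t..<t + m - 1})"
    and R: "\<And>Z. R Z \<in> supported (small_mons ?g)"
    and W: "?W = (\<lambda>Z. basis_ext (mono_poly ?D * c) {1..<?g + m} Z + R Z)"
    using link_elem_expansion[of ?g k] k by auto
  have lc: "lead_mon lo c = beta m n A"
    unfolding c(3) beta_eq_antidiagonals[OF m1 mn A] k_def ..
  let ?Z = "{1..<?g + m}" and ?p = "mono_poly ?D * c"
  have W_top: "?W ?Z = ?p + R ?Z" unfolding W by (simp add: basis_ext_def)
  have lookup_D: "lookup ?D v = (if v \<in> (\<lambda>j. Y j j) ` {1..?g} then 1 else 0)" for v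
    by (rule lookup_diagonal_Y[OF m1 mn])
  have D: "?D \<in> monomials \<S>"
  proof -
    have "x \<in> \<S>" if "x \<in> keys ?D" for x
      using that g_le unfolding in_keys_iff lookup_D by (auto simp: Y_in_S split: if_splits)
    then show ?thesis unfolding monomials_def by blast
  qed
  have "lead_mon lo (mono_poly ?D :: 'k mpoly) = ?D"
    by (rule lead_mon_eqI[OF lo_order]) (use D in simp_all)
  then have p: "lead_mon lo ?p = ?D + beta m n A" "?p \<noteq> 0"
    using lead_mon_mult[OF lo_order single_in_poly_ring[OF D] mono_poly_nonzero X_ring_in_S[OF c(1)] c(2)]
      lc by simp_all
  have pS: "?p \<in> polys \<S>"
    by (rule poly_ring_closed(2)[OF single_in_poly_ring[OF D] X_ring_in_S[OF c(1)]])
  have RS: "R ?Z \<in> polys \<S>"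
    using R[of ?Z] by (auto simp: supported_def carrier_poly_ring small_mons_def full_mons_def)
  have small: "lo v (lead_mon lo ?p)" if v: "v \<in> keys (R ?Z)" for v
  proof -
    have vs: "v \<in> small_mons ?g" using R[of ?Z] v by (auto simp: supported_def)
    \<comment> \<open>the first diagonal indeterminate that is missing decides the comparison\<close>
    define j where "j = (LEAST j. j \<in> {1..?g} \<and> lookup v (Y j j) = 0)"
    have ex: "\<exists>j. j \<in> {1..?g} \<and> lookup v (Y j j) = 0"
      using vs unfolding small_mons_def by blast
    have j: "j \<in> {1..?g}" "lookup v (Y j j) = 0"
      using LeastI_ex[OF ex] unfolding j_def by blast+
    have top: "lookup (?D + beta m n A) (Y i i) = 1" if "i \<in> {1..?g}" for i
      unfolding lookup_add lookup_D beta_no_Y[OF m1 mn A] using that by simp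
    show ?thesis unfolding p(1)
    proof (rule lo_diagonal[OF j(1)])
      show "lookup v (Y j j) < lookup (?D + beta m n A) (Y j j)"
        unfolding top[OF j(1)] j(2) by simp
      fix i assume i: "1 \<le> i" "i < j"
      then have ig: "i \<in> {1..?g}" using j(1) by auto
      have "\<not> (i \<in> {1..?g} \<and> lookup v (Y i i) = 0)"
        using i(2) unfolding j_def by (rule not_less_Least)
      then have "lookup v (Y i i) \<noteq> 0" using ig by simp
      moreover have "lookup v (Y i i) \<le> 1"
        using vs ig unfolding small_mons_def full_mons_def by force
      ultimately show "lookup v (Y i i) = lookup (?D + beta m n A) (Y i i)"
        unfolding top[OF ig] by simp
    qed
  qed
  note dom = dominant_summand[OF lo_order pS p(2) RS small]
  show ?thesis
  proof (intro bexI conjI)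
    show "?W ?Z \<noteq> 0" unfolding W_top by (rule dom(2))
    show "lead_mon lo (?W ?Z) = ?D + beta m n A" unfolding W_top by (rule trans[OF dom(1) p(1)])
  qed (rule GJ)
qed

lemma link_lead_lower:
  assumes "u \<in> gens1 m n \<union> gens2 m n"
  shows "\<exists>f\<in>generic_link m n C. (f :: 'k mpoly) \<noteq> 0 \<and> lead_mon lo f = u"
  using assms
proof
  assume "u \<in> gens1 m n"
  then obtain j where "j \<in> {1..n - m + 1}" "u = var (Y j j) + alpha m j" by (auto simp: gens1_def)
  then show ?thesis using link_rel_in_link lead_link_rel by blast
next
  assume "u \<in> gens2 m n"
  then obtain A where "A \<subseteq> {2..n}" "card A = m - 1"
    and "u = (\<Sum>j = 1..n - m + 1. var (Y j j)) + beta m n A" unfolding gens2_def by blast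
  then show ?thesis using ex_link_lead by blast
qed

lemma gens_in_S: "gens1 m n \<union> gens2 m n \<subseteq> monomials \<S>"
proof
  fix u assume "u \<in> gens1 m n \<union> gens2 m n"
  then obtain f where "f \<in> generic_link m n C" "(f :: 'k mpoly) \<noteq> 0" "lead_mon lo f = u"
    using link_lead_lower by blast
  then show "u \<in> monomials \<S>"
    using lead_mon_in_monomials[OF lo_order, of f] ideal_poly_ringD(1)[OF ideal_generic_link] by blast
qed

lemma finite_gens: "finite (gens1 m n \<union> gens2 m n)"
proof -
  have "gens1 m n = (\<lambda>j. var (Y j j) + alpha m j) ` {1..n - m + 1}"
    "gens2 m n = (\<lambda>A. (\<Sum>j = 1..n - m + 1. var (Y j j)) + beta m n A) ` {A. A \<subseteq> {2..n} \<and> card A = m - 1}"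
    by (auto simp: gens1_def gens2_def)
  then show ?thesis by simp
qed

lemmas link_lead_monomials =
  lead_monomials_determine[OF lo_order finite_S ideal_generic_link finite_gens gens_in_S
    gens_antichain[OF m1 mn] link_lead_upper link_lead_lower]

end

theorem theorem3p4:
  fixes m n :: nat
    and C :: "nat \<Rightarrow> nat set"
    and ys :: "(nat \<times> nat) list"
    and less_x :: "mon \<Rightarrow> mon \<Rightarrow> bool"
    and J :: "'k::field mpoly set"
  assumes "1 \<le> m" and "m < n"
    and "minor_enumeration m n C"
    and "antidiagonal_term_order TYPE('k) m n less_x"
    and "y_ordering m n ys"
    and "J = generic_link m n C"
  shows
    "minimal_monomial_generators (s_indets m n)
       (initial_ideal (s_indets m n) (link_order ys less_x) J) (gens1 m n \<union> gens2 m n) \<and>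
     (\<exists>!G. reduced_groebner_basis (s_indets m n) (link_order ys less_x) J G) \<and>
     (\<forall>G. reduced_groebner_basis (s_indets m n) (link_order ys less_x) J G \<longrightarrow>
        lead_mon (link_order ys less_x) ` G = gens1 m n \<union> gens2 m n) \<and>
     card (gens1 m n) = n - m + 1 \<and>
     (\<forall>u\<in>gens1 m n. squarefree_mon u \<and> mdegree u = m + 1) \<and>
     card (gens2 m n) = (n - 1) choose (m - 1) \<and>
     (\<forall>u\<in>gens2 m n. squarefree_mon u \<and> mdegree u = m * (n - m) + 1)"
proof -
  note L = link_lead_monomials[OF assms(1-5), folded assms(6)]
  note S = squarefree_gens[OF assms(1,2)]
  show ?thesis
    using L card_gens1[OF assms(1,2)] card_gens2[OF assms(1,2)]
      mdegree_gens1[OF assms(1,2)] mdegree_gens2[OF assms(1,2)] S by blast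
qed

end
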